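(* Over $\mathsf{RCA}_0$: if the discrete order $\mathbf 3$ on $\{0,1,2\}$ is $\Delta^0_2\text{-}\mathsf{BQO}$, then $\Omega\oplus\Omega$ is $\Delta^0_2\text{-}\mathsf{BQO}$ for every well order $\Omega$.
   Context: $[\mathbb N]^\omega$ denotes the infinite subsets of $\mathbb N$; for $X\in[\mathbb N]^\omega$, $X^-$ is $X$ without its least element. A function $F:[\mathbb N]^\omega\to Q$ into a quasi order is bad if there is no $X\in[\mathbb N]^\omega$ with $F(X)\leq_Q F(X^-)$. In $\mathsf{RCA}_0$, a $\Delta^0_2$-function $F:[\mathbb N]^\omega\to Q$ is one whose graph relation $F(X)=q$ is defined by a $\Sigma^0_2$-formula (possibly with parameters) that defines a total function. $Q$ is $\Delta^0_2\text{-}\mathsf{BQO}$ if there is no bad $\Delta^0_2$-function $F:[\mathbb N]^\omega\to Q$. For quasi orders $Q_0,Q_1$, $Q_0\oplus Q_1$ is the disjoint union $\{\langle i,q\rangle\mid i\in\{0,1\},q\in Q_i\}$ with $\langle i,p\rangle\leq\langle j,q\rangle$ iff $i=j$ and $p\leq_{Q_i}q$. *)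

theory Defs
  imports Main
begin

section \<open>The language of second-order arithmetic\<close>

text \<open>Number variables and set variables are separate sorts, each indexed by \<open>nat\<close>.\<close>

datatype tm = Var nat | Zero | One | Plus tm tm | Times tm tm

datatype fm =
    Eq tm tm
  | Less tm tm
  | Mem tm nat
  | Neg fm
  | And fm fm
  | Or fm fm
  | Imp fm fm
  | AllN nat fm
  | ExN nat fm
  | AllS nat fm
  | ExS nat fm

fun tm_vars :: "tm \<Rightarrow> nat set" where
  "tm_vars (Var x) = {x}"
| "tm_vars Zero = {}"
| "tm_vars One = {}"
| "tm_vars (Plus s t) = tm_vars s \<union> tm_vars t"
| "tm_vars (Times s t) = tm_vars s \<union> tm_vars t"

text \<open>Set variables may occur free in the following classes, but they are never quantified.\<close>

inductive bounded_fm :: "fm \<Rightarrow> bool" where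
  "bounded_fm (Eq s t)"
| "bounded_fm (Less s t)"
| "bounded_fm (Mem t X)"
| "bounded_fm \<phi> \<Longrightarrow> bounded_fm (Neg \<phi>)"
| "bounded_fm \<phi> \<Longrightarrow> bounded_fm \<psi> \<Longrightarrow> bounded_fm (And \<phi> \<psi>)"
| "bounded_fm \<phi> \<Longrightarrow> bounded_fm \<psi> \<Longrightarrow> bounded_fm (Or \<phi> \<psi>)"
| "bounded_fm \<phi> \<Longrightarrow> bounded_fm \<psi> \<Longrightarrow> bounded_fm (Imp \<phi> \<psi>)"
| "bounded_fm \<phi> \<Longrightarrow> x \<notin> tm_vars t \<Longrightarrow> bounded_fm (AllN x (Imp (Less (Var x) t) \<phi>))"
| "bounded_fm \<phi> \<Longrightarrow> x \<notin> tm_vars t \<Longrightarrow> bounded_fm (ExN x (And (Less (Var x) t) \<phi>))"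

definition Sigma1 :: "fm \<Rightarrow> bool" where
  "Sigma1 \<phi> \<longleftrightarrow> (\<exists>x \<theta>. bounded_fm \<theta> \<and> \<phi> = ExN x \<theta>)"

definition Pi1 :: "fm \<Rightarrow> bool" where
  "Pi1 \<phi> \<longleftrightarrow> (\<exists>x \<theta>. bounded_fm \<theta> \<and> \<phi> = AllN x \<theta>)"

definition Sigma2 :: "fm \<Rightarrow> bool" where
  "Sigma2 \<phi> \<longleftrightarrow> (\<exists>x \<psi>. Pi1 \<psi> \<and> \<phi> = ExN x \<psi>)"

section \<open>Structures and models of \<open>RCA\<^sub>0\<close>\<close>

text \<open>
  The numbers of a structure are all elements of the type \<open>'m\<close>, and its sets form
  an arbitrary collection of subsets of \<open>'m\<close>. Models may be nonstandard (they need not be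
  \<open>\<omega>\<close>-models), so quantifying over all of them expresses derivability from the axioms.
\<close>

record 'm l2_structure =
  m_zero :: 'm
  m_one :: 'm
  m_add :: "'m \<Rightarrow> 'm \<Rightarrow> 'm"
  m_mul :: "'m \<Rightarrow> 'm \<Rightarrow> 'm"
  m_less :: "'m \<Rightarrow> 'm \<Rightarrow> bool"
  m_sets :: "'m set set"

fun tm_val :: "'m l2_structure \<Rightarrow> (nat \<Rightarrow> 'm) \<Rightarrow> tm \<Rightarrow> 'm" where
  "tm_val M e (Var x) = e x"
| "tm_val M e Zero = m_zero M"
| "tm_val M e One = m_one M"
| "tm_val M e (Plus s t) = m_add M (tm_val M e s) (tm_val M e t)"
| "tm_val M e (Times s t) = m_mul M (tm_val M e s) (tm_val M e t)"

fun sat :: "'m l2_structure \<Rightarrow> (nat \<Rightarrow> 'm) \<Rightarrow> (nat \<Rightarrow> 'm set) \<Rightarrow> fm \<Rightarrow> bool" where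
  "sat M e E (Eq s t) \<longleftrightarrow> tm_val M e s = tm_val M e t"
| "sat M e E (Less s t) \<longleftrightarrow> m_less M (tm_val M e s) (tm_val M e t)"
| "sat M e E (Mem t X) \<longleftrightarrow> tm_val M e t \<in> E X"
| "sat M e E (Neg \<phi>) \<longleftrightarrow> \<not> sat M e E \<phi>"
| "sat M e E (And \<phi> \<psi>) \<longleftrightarrow> sat M e E \<phi> \<and> sat M e E \<psi>"
| "sat M e E (Or \<phi> \<psi>) \<longleftrightarrow> sat M e E \<phi> \<or> sat M e E \<psi>"
| "sat M e E (Imp \<phi> \<psi>) \<longleftrightarrow> (sat M e E \<phi> \<longrightarrow> sat M e E \<psi>)"
| "sat M e E (AllN x \<phi>) \<longleftrightarrow> (\<forall>a. sat M (e(x := a)) E \<phi>)"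
| "sat M e E (ExN x \<phi>) \<longleftrightarrow> (\<exists>a. sat M (e(x := a)) E \<phi>)"
| "sat M e E (AllS X \<phi>) \<longleftrightarrow> (\<forall>A\<in>m_sets M. sat M e (E(X := A)) \<phi>)"
| "sat M e E (ExS X \<phi>) \<longleftrightarrow> (\<exists>A\<in>m_sets M. sat M e (E(X := A)) \<phi>)"

abbreviation m_succ :: "'m l2_structure \<Rightarrow> 'm \<Rightarrow> 'm" where
  "m_succ M a \<equiv> m_add M a (m_one M)"

definition basic_axioms :: "'m l2_structure \<Rightarrow> bool" where
  "basic_axioms M \<longleftrightarrow>
     (\<forall>a. m_succ M a \<noteq> m_zero M) \<and>
     (\<forall>a b. m_succ M a = m_succ M b \<longrightarrow> a = b) \<and>
     (\<forall>a. m_add M a (m_zero M) = a) \<and>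
     (\<forall>a b. m_add M a (m_succ M b) = m_succ M (m_add M a b)) \<and>
     (\<forall>a. m_mul M a (m_zero M) = m_zero M) \<and>
     (\<forall>a b. m_mul M a (m_succ M b) = m_add M (m_mul M a b) a) \<and>
     (\<forall>a. \<not> m_less M a (m_zero M)) \<and>
     (\<forall>a b. m_less M a (m_succ M b) \<longleftrightarrow> m_less M a b \<or> a = b)"

text \<open>
  The two schemes are given by the truth of the universal closures of their instances:
  \<open>e\<close> and \<open>E\<close> assign values to all parameters.
\<close>

definition Sigma1_induction :: "'m l2_structure \<Rightarrow> bool" where
  "Sigma1_induction M \<longleftrightarrow>
     (\<forall>\<phi> x e E. Sigma1 \<phi> \<and> range E \<subseteq> m_sets M \<and>
        sat M (e(x := m_zero M)) E \<phi> \<and>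
        (\<forall>a. sat M (e(x := a)) E \<phi> \<longrightarrow> sat M (e(x := m_succ M a)) E \<phi>)
        \<longrightarrow> (\<forall>a. sat M (e(x := a)) E \<phi>))"

definition Delta1_comprehension :: "'m l2_structure \<Rightarrow> bool" where
  "Delta1_comprehension M \<longleftrightarrow>
     (\<forall>\<phi> \<psi> x e E. Sigma1 \<phi> \<and> Pi1 \<psi> \<and> range E \<subseteq> m_sets M \<and>
        (\<forall>a. sat M (e(x := a)) E \<phi> \<longleftrightarrow> sat M (e(x := a)) E \<psi>)
        \<longrightarrow> {a. sat M (e(x := a)) E \<phi>} \<in> m_sets M)"

text \<open>Both sorts of a structure are nonempty; for sets this has to be demanded explicitly.\<close>

definition rca0_model :: "'m l2_structure \<Rightarrow> bool" where
  "rca0_model M \<longleftrightarrow>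
     m_sets M \<noteq> {} \<and> basic_axioms M \<and> Sigma1_induction M \<and> Delta1_comprehension M"

section \<open>Orders inside a model\<close>

text \<open>The usual pairing \<open>(a + b)\<^sup>2 + a\<close> of second-order arithmetic.\<close>

definition m_pair :: "'m l2_structure \<Rightarrow> 'm \<Rightarrow> 'm \<Rightarrow> 'm" where
  "m_pair M a b = m_add M (m_mul M (m_add M a b) (m_add M a b)) a"

text \<open>An order consists of its underlying set and of the set of codes of related pairs.\<close>

type_synonym 'm ord = "'m set \<times> 'm set"

definition ord_le :: "'m l2_structure \<Rightarrow> 'm ord \<Rightarrow> 'm \<Rightarrow> 'm \<Rightarrow> bool" where
  "ord_le M Q p q \<longleftrightarrow> m_pair M p q \<in> snd Q"

definition is_quasi_order :: "'m l2_structure \<Rightarrow> 'm ord \<Rightarrow> bool" where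
  "is_quasi_order M Q \<longleftrightarrow>
     fst Q \<in> m_sets M \<and> snd Q \<in> m_sets M \<and>
     snd Q \<subseteq> {m_pair M p q | p q. p \<in> fst Q \<and> q \<in> fst Q} \<and>
     (\<forall>p\<in>fst Q. ord_le M Q p p) \<and>
     (\<forall>p\<in>fst Q. \<forall>q\<in>fst Q. \<forall>r\<in>fst Q. ord_le M Q p q \<and> ord_le M Q q r \<longrightarrow> ord_le M Q p r)"

definition is_linear_order :: "'m l2_structure \<Rightarrow> 'm ord \<Rightarrow> bool" where
  "is_linear_order M Q \<longleftrightarrow> is_quasi_order M Q \<and>
     (\<forall>p\<in>fst Q. \<forall>q\<in>fst Q. ord_le M Q p q \<and> ord_le M Q q p \<longrightarrow> p = q) \<and>
     (\<forall>p\<in>fst Q. \<forall>q\<in>fst Q. ord_le M Q p q \<or> ord_le M Q q p)"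

text \<open>The sequences of the model: its sets that code functions from numbers to \<open>A\<close>.\<close>

definition is_sequence :: "'m l2_structure \<Rightarrow> 'm set \<Rightarrow> 'm set \<Rightarrow> bool" where
  "is_sequence M f A \<longleftrightarrow> f \<in> m_sets M \<and>
     f \<subseteq> {m_pair M n a | n a. a \<in> A} \<and> (\<forall>n. \<exists>!a. m_pair M n a \<in> f)"

text \<open>
  As usual in reverse mathematics, well-foundedness only excludes descending sequences that
  belong to the model.
\<close>

definition is_well_order :: "'m l2_structure \<Rightarrow> 'm ord \<Rightarrow> bool" where
  "is_well_order M Q \<longleftrightarrow> is_linear_order M Q \<and>
     \<not> (\<exists>f. is_sequence M f (fst Q) \<and>
          (\<forall>n a b. m_pair M n a \<in> f \<and> m_pair M (m_succ M n) b \<in> f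
             \<longrightarrow> ord_le M Q b a \<and> b \<noteq> a))"

definition discrete3 :: "'m l2_structure \<Rightarrow> 'm ord" where
  "discrete3 M =
     (let C = {m_zero M, m_one M, m_add M (m_one M) (m_one M)}
      in (C, {m_pair M a a | a. a \<in> C}))"

definition ord_sum :: "'m l2_structure \<Rightarrow> 'm ord \<Rightarrow> 'm ord \<Rightarrow> 'm ord" where
  "ord_sum M Q0 Q1 =
     ({m_pair M (m_zero M) q | q. q \<in> fst Q0} \<union> {m_pair M (m_one M) q | q. q \<in> fst Q1},
      {m_pair M (m_pair M (m_zero M) p) (m_pair M (m_zero M) q) | p q.
         p \<in> fst Q0 \<and> q \<in> fst Q0 \<and> ord_le M Q0 p q} \<union>
      {m_pair M (m_pair M (m_one M) p) (m_pair M (m_one M) q) | p q.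
         p \<in> fst Q1 \<and> q \<in> fst Q1 \<and> ord_le M Q1 p q})"

section \<open>Better quasi orders with respect to \<open>\<Delta>\<^sup>0\<^sub>2\<close>-functions\<close>

text \<open>Infinity is meant in the sense of the model, i.e. as unboundedness.\<close>

definition infinite_sets :: "'m l2_structure \<Rightarrow> 'm set set" where
  "infinite_sets M = {X \<in> m_sets M. \<forall>a. \<exists>b\<in>X. m_less M a b}"

definition drop_least :: "'m l2_structure \<Rightarrow> 'm set \<Rightarrow> 'm set" where
  "drop_least M X = X - {a \<in> X. \<forall>b\<in>X. \<not> m_less M b a}"

text \<open>
  \<open>F\<close> is external to the model, and only its values on \<open>infinite_sets M\<close> matter. In the
  defining formula, set variable \<open>0\<close> stands for the argument and number variable \<open>0\<close> for the
  value; \<open>e\<close> and \<open>E\<close> provide parameters from the model for all other variables.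
\<close>

definition Delta2_function ::
    "'m l2_structure \<Rightarrow> 'm set \<Rightarrow> ('m set \<Rightarrow> 'm) \<Rightarrow> bool" where
  "Delta2_function M A F \<longleftrightarrow>
     (\<forall>X\<in>infinite_sets M. F X \<in> A) \<and>
     (\<exists>\<phi> e E. Sigma2 \<phi> \<and> range E \<subseteq> m_sets M \<and>
        (\<forall>X\<in>infinite_sets M. \<forall>q. sat M (e(0 := q)) (E(0 := X)) \<phi> \<longleftrightarrow> F X = q))"

definition bad :: "'m l2_structure \<Rightarrow> 'm ord \<Rightarrow> ('m set \<Rightarrow> 'm) \<Rightarrow> bool" where
  "bad M Q F \<longleftrightarrow> \<not> (\<exists>X\<in>infinite_sets M. ord_le M Q (F X) (F (drop_least M X)))"

definition Delta2_BQO :: "'m l2_structure \<Rightarrow> 'm ord \<Rightarrow> bool" where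
  "Delta2_BQO M Q \<longleftrightarrow> is_quasi_order M Q \<and>
     \<not> (\<exists>F. Delta2_function M (fst Q) F \<and> bad M Q F)"

end

(*
  Suppose first that some \<Sigma>\<^sup>0\<^sub>1-definable class K is not a set of the model. Call a stage in an
  enumeration of K true if all later stages enumerate larger numbers. Along every infinite X of the
  model, infinitely many intervals between successive elements contain a true stage (true stages
  are unbounded) and infinitely many do not (otherwise counting elements of X would bound the
  stages and K would be \<Delta>\<^sup>0\<^sub>1 in X). Any \<Delta>\<^sup>0\<^sub>2-bit that alternates infinitely often along every X
  yields a bad function into 3, coloured by the bit and by the parity of the distance to its next
  change. So 3 being \<Delta>\<^sup>0\<^sub>2-BQO implies arithmetical comprehension. Given the latter, a bad function
  F into \<Omega> + \<Omega> yields such a bit, namely the summand of F(X): if it were eventually constant along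
  X, then the values of F would form a descending sequence of \<Omega> that belongs to the model.
*)
theory Submission
  imports Defs
begin

section \<open>Definability with parameters\<close>

text \<open>Models may be nonstandard and offer only Sigma_1 induction, so every step must track
  definability. This is done semantically: a predicate is definable if some formula with parameters
  has it as its truth set, and closure rules replace work on formulas. Three colours suffice for the
  following reason. If the bit changes from X to X without its least element, the former shows its
  bit and the latter the other bit or 2. Otherwise both refer to the same change, at distances of
  opposite parity, and exactly one is coloured 2. The obstacle is that the colouring must have a
  Sigma_2 graph, while constancy of the bit up to \<open>b\<close> puts a bounded quantifier in
  front of a Sigma_2 statement. For true stages this is harmless: the two values of the bit are
  Sigma_1 and Pi_1, classes closed under bounded quantifiers. For the summand of F(X), arithmetical
  comprehension supplies the missing collection. Parity and enumeration inside the model require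
  codes for bounded sets, which are obtained from divisibility.\<close>

fun tren :: "(nat \<Rightarrow> nat) \<Rightarrow> tm \<Rightarrow> tm" where
  "tren \<rho> (Var x) = Var (\<rho> x)"
| "tren \<rho> Zero = Zero"
| "tren \<rho> One = One"
| "tren \<rho> (Plus s t) = Plus (tren \<rho> s) (tren \<rho> t)"
| "tren \<rho> (Times s t) = Times (tren \<rho> s) (tren \<rho> t)"

fun fren :: "(nat \<Rightarrow> nat) \<Rightarrow> (nat \<Rightarrow> nat) \<Rightarrow> fm \<Rightarrow> fm" where
  "fren \<rho> \<sigma> (Eq s t) = Eq (tren \<rho> s) (tren \<rho> t)"
| "fren \<rho> \<sigma> (Less s t) = Less (tren \<rho> s) (tren \<rho> t)"
| "fren \<rho> \<sigma> (Mem t X) = Mem (tren \<rho> t) (\<sigma> X)"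
| "fren \<rho> \<sigma> (Neg \<phi>) = Neg (fren \<rho> \<sigma> \<phi>)"
| "fren \<rho> \<sigma> (And \<phi> \<psi>) = And (fren \<rho> \<sigma> \<phi>) (fren \<rho> \<sigma> \<psi>)"
| "fren \<rho> \<sigma> (Or \<phi> \<psi>) = Or (fren \<rho> \<sigma> \<phi>) (fren \<rho> \<sigma> \<psi>)"
| "fren \<rho> \<sigma> (Imp \<phi> \<psi>) = Imp (fren \<rho> \<sigma> \<phi>) (fren \<rho> \<sigma> \<psi>)"
| "fren \<rho> \<sigma> (AllN x \<phi>) = AllN (\<rho> x) (fren \<rho> \<sigma> \<phi>)"
| "fren \<rho> \<sigma> (ExN x \<phi>) = ExN (\<rho> x) (fren \<rho> \<sigma> \<phi>)"
| "fren \<rho> \<sigma> (AllS X \<phi>) = AllS (\<sigma> X) (fren \<rho> \<sigma> \<phi>)"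
| "fren \<rho> \<sigma> (ExS X \<phi>) = ExS (\<sigma> X) (fren \<rho> \<sigma> \<phi>)"

lemma tm_val_tren: "tm_val M e (tren \<rho> t) = tm_val M (e \<circ> \<rho>) t"
  by (induction t) auto

lemma tm_vars_tren: "tm_vars (tren \<rho> t) = \<rho> ` tm_vars t"
  by (induction t) auto

lemma fun_upd_comp_inj: "inj \<rho> \<Longrightarrow> e(\<rho> x := a) \<circ> \<rho> = (e \<circ> \<rho>)(x := a)"
  by (auto simp: fun_eq_iff inj_def)

lemma bounded_fm_fren: "bounded_fm \<theta> \<Longrightarrow> inj \<rho> \<Longrightarrow> bounded_fm (fren \<rho> \<sigma> \<theta>)"
  by (induction rule: bounded_fm.induct)
    (auto intro!: bounded_fm.intros simp: tm_vars_tren inj_image_mem_iff)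

text \<open>Injectivity of \<open>\<rho>\<close> ensures that assigning a value to a renamed bound
  variable changes no other variable. Set variables are never bound in a bounded formula, so
  \<open>\<sigma>\<close> is arbitrary.\<close>

lemma sat_fren:
  "bounded_fm \<theta> \<Longrightarrow> inj \<rho> \<Longrightarrow> sat M e E (fren \<rho> \<sigma> \<theta>) \<longleftrightarrow> sat M (e \<circ> \<rho>) (E \<circ> \<sigma>) \<theta>"
  by (induction arbitrary: e rule: bounded_fm.induct) (simp_all add: tm_val_tren fun_upd_comp_inj)

text \<open>
  Even variables hold the arguments of a predicate, odd ones its parameters. Quantifiers act on
  argument \<open>0\<close> in de Bruijn style, so no side conditions on fresh variables arise.
\<close>

definition mrg :: "(nat \<Rightarrow> 'm) \<Rightarrow> (nat \<Rightarrow> 'm) \<Rightarrow> nat \<Rightarrow> 'm" where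
  "mrg e r n = (if even n then e (n div 2) else r (n div 2))"

lemma mrg_simps [simp]: "mrg e r (2 * n) = e n" "mrg e r (Suc (2 * n)) = r n"
  by (auto simp: mrg_def)

lemma nat_parity_cases:
  obtains k where "n = 2 * k" | k where "n = Suc (2 * k)"
  by (metis evenE oddE Suc_eq_plus1)

lemma mrg_upd_arg: "(mrg e r)(2 * n := a) = mrg (e(n := a)) r"
  by (auto simp: fun_eq_iff mrg_def) 

lemma mrg_upd_param: "(mrg e (case_nat x r))(1 := a) = mrg e (case_nat a r)"
  by (auto simp: fun_eq_iff mrg_def split: nat.splits) presburger

lemma case_nat_eta [simp]: "case_nat (e 0) (\<lambda>n. e (Suc n)) = e"
  by (auto simp: fun_eq_iff split: nat.splits)

text \<open>Shifts of the parameters that make room for a second list or for one more element.\<close>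

definition \<rho>L :: "nat \<Rightarrow> nat" where "\<rho>L n = (if even n then n else 4 * (n div 2) + 1)"
definition \<rho>R :: "nat \<Rightarrow> nat" where "\<rho>R n = (if even n then n else 4 * (n div 2) + 3)"
definition \<rho>S :: "nat \<Rightarrow> nat" where "\<rho>S n = (if even n then n else n + 2)"
definition \<rho>Q :: "nat \<Rightarrow> nat" where "\<rho>Q n = (if n = 0 then 1 else if even n then n - 2 else n + 2)"
definition \<sigma>L :: "nat \<Rightarrow> nat" where "\<sigma>L = case_nat 0 (\<lambda>k. Suc (2 * k))"
definition \<sigma>R :: "nat \<Rightarrow> nat" where "\<sigma>R = case_nat 0 (\<lambda>k. Suc (Suc (2 * k)))"

lemma \<rho>_simps [simp]:
  "\<rho>L (2 * k) = 2 * k" "\<rho>L (Suc (2 * k)) = Suc (2 * (2 * k))"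
  "\<rho>R (2 * k) = 2 * k" "\<rho>R (Suc (2 * k)) = Suc (2 * Suc (2 * k))"
  "\<rho>S (2 * k) = 2 * k" "\<rho>S (Suc (2 * k)) = Suc (2 * Suc k)"
  "\<rho>Q 0 = Suc (2 * 0)" "\<rho>Q (2 * Suc k) = 2 * k" "\<rho>Q (Suc (2 * k)) = Suc (2 * Suc k)"
  by (simp_all add: \<rho>L_def \<rho>R_def \<rho>S_def \<rho>Q_def)

lemma inj_\<rho>: "inj \<rho>L" "inj \<rho>R" "inj \<rho>S" "inj \<rho>Q"
  unfolding inj_def \<rho>L_def \<rho>R_def \<rho>S_def \<rho>Q_def
  by (auto split: if_splits elim!: evenE oddE; arith)+

lemma mrg_\<rho>: "mrg e (mrg r s) \<circ> \<rho>L = mrg e r" "mrg e (mrg r s) \<circ> \<rho>R = mrg e s"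
  "mrg e (case_nat a r) \<circ> \<rho>S = mrg e r" "mrg e (case_nat a r) \<circ> \<rho>Q = mrg (case_nat a e) r"
proof -
  have "mrg e (mrg r s) (\<rho>L n) = mrg e r n" "mrg e (mrg r s) (\<rho>R n) = mrg e s n"
    "mrg e (case_nat a r) (\<rho>S n) = mrg e r n" for n
    by (cases n rule: nat_parity_cases; simp only: \<rho>_simps mrg_simps nat.case)+
  moreover have "mrg e (case_nat a r) (\<rho>Q n) = mrg (case_nat a e) r n" for n
  proof (cases n rule: nat_parity_cases)
    case (1 k)
    then show ?thesis
      using mrg_simps(2)[of e "case_nat a r" 0] mrg_simps(1)[of "case_nat a e" r 0]
      by (cases k) (simp_all only: \<rho>_simps mrg_simps nat.case mult_0_right)
  next
    case (2 k)
    then show ?thesis by (simp only: \<rho>_simps mrg_simps nat.case)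
  qed
  ultimately show "mrg e (mrg r s) \<circ> \<rho>L = mrg e r" "mrg e (mrg r s) \<circ> \<rho>R = mrg e s"
    "mrg e (case_nat a r) \<circ> \<rho>S = mrg e r" "mrg e (case_nat a r) \<circ> \<rho>Q = mrg (case_nat a e) r"
    by (simp_all add: fun_eq_iff)
qed

lemma case_nat_\<sigma>: "case_nat X (mrg E F) \<circ> \<sigma>L = case_nat X E" "case_nat X (mrg E F) \<circ> \<sigma>R = case_nat X F"
  by (auto simp: fun_eq_iff \<sigma>L_def \<sigma>R_def split: nat.splits)

lemma range_mrg: "range E \<subseteq> A \<Longrightarrow> range F \<subseteq> A \<Longrightarrow> range (mrg E F) \<subseteq> A"
  by (auto simp: mrg_def)

section \<open>Terms and bounded predicates of a model\<close>

locale rca0 =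
  fixes M :: "'m l2_structure"
  assumes model: "rca0_model M"
begin

abbreviation S where "S \<equiv> m_sets M"
abbreviation zero ("\<zero>") where "\<zero> \<equiv> m_zero M"
abbreviation one ("\<one>") where "\<one> \<equiv> m_one M"
abbreviation add (infixl "\<oplus>" 65) where "a \<oplus> b \<equiv> m_add M a b"
abbreviation mul (infixl "\<otimes>" 70) where "a \<otimes> b \<equiv> m_mul M a b"
abbreviation less (infix "\<prec>" 50) where "a \<prec> b \<equiv> m_less M a b"
definition le (infix "\<preceq>" 50) where "a \<preceq> b \<longleftrightarrow> a \<prec> b \<or> a = b"
abbreviation pair where "pair \<equiv> m_pair M"

text \<open>
  \<open>D0 P\<close>, \<open>S1 P\<close>, \<open>P1 P\<close> and \<open>S2 P\<close> say that \<open>P e X\<close> is definable by a bounded, \<open>\<Sigma>\<^sup>0\<^sub>1\<close>-, \<open>\<Pi>\<^sup>0\<^sub>1\<close>- or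
  \<open>\<Sigma>\<^sup>0\<^sub>2\<close>-formula with parameters from the model, uniformly in the numbers \<open>e\<close> and the set \<open>X\<close>.
\<close>

definition repT where "repT t r g \<longleftrightarrow> (\<forall>e. tm_val M (mrg e r) t = g e)"
definition repD where "repD \<theta> r E P \<longleftrightarrow> bounded_fm \<theta> \<and> range E \<subseteq> S \<and>
  (\<forall>e. \<forall>X\<in>S. sat M (mrg e r) (case_nat X E) \<theta> \<longleftrightarrow> P e X)"

definition T :: "((nat \<Rightarrow> 'm) \<Rightarrow> 'm) \<Rightarrow> bool" where
  "T g \<longleftrightarrow> (\<exists>t r. repT t r g)"
definition D0 :: "((nat \<Rightarrow> 'm) \<Rightarrow> 'm set \<Rightarrow> bool) \<Rightarrow> bool" where
  "D0 P \<longleftrightarrow> (\<exists>\<theta> r E. repD \<theta> r E P)"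

lemma S_nonempty: "S \<noteq> {}"
  using model by (simp add: rca0_model_def)

lemma obtain_params:
  obtains E :: "nat \<Rightarrow> 'm set" where "range E \<subseteq> S"
proof -
  obtain A where "A \<in> S" using S_nonempty by blast
  then show thesis by (intro that[of "\<lambda>_. A"]) auto
qed

lemma repT_L: "repT t r g \<Longrightarrow> repT (tren \<rho>L t) (mrg r s) g"
  and repT_R: "repT t s g \<Longrightarrow> repT (tren \<rho>R t) (mrg r s) g"
  and repT_S: "repT t r g \<Longrightarrow> repT (tren \<rho>S t) (case_nat a r) g"
  by (simp_all add: repT_def tm_val_tren mrg_\<rho>)

lemma repD_L: "repD \<theta> r E P \<Longrightarrow> range F \<subseteq> S \<Longrightarrow> repD (fren \<rho>L \<sigma>L \<theta>) (mrg r s) (mrg E F) P"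
  and repD_R: "repD \<theta> s F P \<Longrightarrow> range E \<subseteq> S \<Longrightarrow> repD (fren \<rho>R \<sigma>R \<theta>) (mrg r s) (mrg E F) P"
  by (simp_all add: repD_def sat_fren mrg_\<rho> case_nat_\<sigma> inj_\<rho> bounded_fm_fren range_mrg)

lemma T_two:
  assumes "T g" "T h"
  obtains t u r where "repT t r g" "repT u r h"
proof -
  from assms obtain t r u s where "repT t r g" "repT u s h"
    unfolding T_def by blast
  then show thesis
    by (rule that[OF repT_L repT_R])
qed

text \<open>Interleaving the two parameter lists gives both formulas the same assignment, which a
  binary connective needs; \<open>\<sigma>L\<close> and \<open>\<sigma>R\<close> keep set variable 0
  for the common argument.\<close>

lemma D0_two:
  assumes "D0 P" "D0 Q"
  obtains \<theta> \<eta> r E where "repD \<theta> r E P" "repD \<eta> r E Q"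
proof -
  from assms obtain \<theta> r E \<eta> s F where "repD \<theta> r E P" "repD \<eta> s F Q"
    unfolding D0_def by blast
  moreover from this have "range E \<subseteq> S" "range F \<subseteq> S"
    by (simp_all add: repD_def)
  ultimately show thesis
    by (intro that[OF repD_L repD_R])
qed

lemma T_D0_two:
  assumes "T g" "D0 Q"
  obtains t \<eta> r E where "repT t r g" "repD \<eta> r E Q"
proof -
  obtain E :: "nat \<Rightarrow> _" where E: "range E \<subseteq> S" by (rule obtain_params)
  from assms obtain t r \<eta> s F where "repT t r g" "repD \<eta> s F Q"
    unfolding D0_def T_def by blast
  then show thesis
    using E by (intro that[OF repT_L repD_R])
qed

text \<open>These rules follow the syntax of a predicate, so that \<open>intro dfn\<close>
  establishes boundedness. Predicates below are therefore written with explicit guards at their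
  quantifiers.\<close>

named_theorems dfn

lemma T_var [dfn]: "T (\<lambda>e. e n)"
  unfolding T_def repT_def by (rule exI[of _ "Var (2 * n)"]) simp

lemma T_const [dfn]: "T (\<lambda>e. c)"
  unfolding T_def repT_def
  by (intro exI[of _ "Var 1"] exI[of _ "\<lambda>_. c"]) (simp add: mrg_def)

lemma T_add [dfn]: "T g \<Longrightarrow> T h \<Longrightarrow> T (\<lambda>e. g e \<oplus> h e)"
  and T_mul [dfn]: "T g \<Longrightarrow> T h \<Longrightarrow> T (\<lambda>e. g e \<otimes> h e)"
proof -
  assume "T g" "T h"
  then obtain t u r where *: "repT t r g" "repT u r h"
    by (rule T_two)
  have "repT (Plus t u) r (\<lambda>e. g e \<oplus> h e)" "repT (Times t u) r (\<lambda>e. g e \<otimes> h e)"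
    using * by (simp_all add: repT_def)
  then show "T (\<lambda>e. g e \<oplus> h e)" "T (\<lambda>e. g e \<otimes> h e)"
    unfolding T_def by blast+
qed

lemma T_pair [dfn]: "T g \<Longrightarrow> T h \<Longrightarrow> T (\<lambda>e. pair (g e) (h e))"
  unfolding m_pair_def by (intro dfn)

lemma D0_eq [dfn]: "T g \<Longrightarrow> T h \<Longrightarrow> D0 (\<lambda>e X. g e = h e)"
  and D0_less [dfn]: "T g \<Longrightarrow> T h \<Longrightarrow> D0 (\<lambda>e X. g e \<prec> h e)"
proof -
  assume "T g" "T h"
  then obtain t u r where *: "repT t r g" "repT u r h"
    by (rule T_two)
  obtain E :: "nat \<Rightarrow> _" where "range E \<subseteq> S" by (rule obtain_params)
  then have "repD (Eq t u) r E (\<lambda>e X. g e = h e)" "repD (Less t u) r E (\<lambda>e X. g e \<prec> h e)"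
    using * by (simp_all add: repT_def repD_def bounded_fm.intros)
  then show "D0 (\<lambda>e X. g e = h e)" "D0 (\<lambda>e X. g e \<prec> h e)"
    unfolding D0_def by blast+
qed

lemma D0_neg [dfn]: "D0 P \<Longrightarrow> D0 (\<lambda>e X. \<not> P e X)"
proof -
  assume "D0 P"
  then obtain \<theta> r E where "repD \<theta> r E P" unfolding D0_def by blast
  then have "repD (Neg \<theta>) r E (\<lambda>e X. \<not> P e X)"
    by (simp add: repD_def bounded_fm.intros)
  then show ?thesis unfolding D0_def by blast
qed

lemma D0_conj [dfn]: "D0 P \<Longrightarrow> D0 Q \<Longrightarrow> D0 (\<lambda>e X. P e X \<and> Q e X)"
  and D0_disj [dfn]: "D0 P \<Longrightarrow> D0 Q \<Longrightarrow> D0 (\<lambda>e X. P e X \<or> Q e X)"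
  and D0_imp [dfn]: "D0 P \<Longrightarrow> D0 Q \<Longrightarrow> D0 (\<lambda>e X. P e X \<longrightarrow> Q e X)"
proof -
  assume "D0 P" "D0 Q"
  then obtain \<theta> \<eta> r E where "repD \<theta> r E P" "repD \<eta> r E Q" by (rule D0_two)
  then have "repD (And \<theta> \<eta>) r E (\<lambda>e X. P e X \<and> Q e X)"
    "repD (Or \<theta> \<eta>) r E (\<lambda>e X. P e X \<or> Q e X)"
    "repD (Imp \<theta> \<eta>) r E (\<lambda>e X. P e X \<longrightarrow> Q e X)"
    by (simp_all add: repD_def bounded_fm.intros)
  then show "D0 (\<lambda>e X. P e X \<and> Q e X)" "D0 (\<lambda>e X. P e X \<or> Q e X)" "D0 (\<lambda>e X. P e X \<longrightarrow> Q e X)"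
    unfolding D0_def by blast+
qed

lemma D0_iff [dfn]: "D0 P \<Longrightarrow> D0 Q \<Longrightarrow> D0 (\<lambda>e X. P e X \<longleftrightarrow> Q e X)"
  unfolding iff_conv_conj_imp by (intro dfn)

lemma D0_le [dfn]: "T g \<Longrightarrow> T h \<Longrightarrow> D0 (\<lambda>e X. g e \<preceq> h e)"
  unfolding le_def by (intro dfn)

lemma D0_mem_arg [dfn]: "T g \<Longrightarrow> D0 (\<lambda>e X. g e \<in> X)"
proof -
  assume "T g"
  then obtain t r where *: "repT t r g" unfolding T_def by blast
  obtain E :: "nat \<Rightarrow> _" where "range E \<subseteq> S" by (rule obtain_params)
  with * have "repD (Mem t 0) r E (\<lambda>e X. g e \<in> X)"
    by (simp add: repT_def repD_def bounded_fm.intros)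
  then show ?thesis unfolding D0_def by blast
qed

lemma D0_mem [dfn]: "T g \<Longrightarrow> A \<in> S \<Longrightarrow> D0 (\<lambda>e X. g e \<in> A)"
proof -
  assume "T g" "A \<in> S"
  then obtain t r where "repT t r g" unfolding T_def by blast
  with \<open>A \<in> S\<close> have "repD (Mem t 1) r (\<lambda>_. A) (\<lambda>e X. g e \<in> A)"
    by (auto simp add: repT_def repD_def bounded_fm.intros)
  then show ?thesis unfolding D0_def by blast
qed

text \<open>\<open>\<rho>Q\<close> renames argument 0 to number variable 1, the first parameter, and
  shifts everything else to make room. Quantifying variable 1 of the renamed formula thus amounts to
  quantifying argument 0.\<close>

lemma repD_quant:
  assumes "repD \<theta> r E P"
  shows "sat M (mrg e (case_nat a r)) F (fren \<rho>Q id \<theta>) \<longleftrightarrow> sat M (mrg (case_nat a e) r) F \<theta>"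
  using assms by (simp add: repD_def sat_fren inj_\<rho> mrg_\<rho>)

lemma D0_ball_less [dfn]:
  assumes "T g" "D0 (\<lambda>e X. P (e 0) (\<lambda>n. e (Suc n)) X)"
  shows "D0 (\<lambda>e X. \<forall>a. a \<prec> g e \<longrightarrow> P a e X)"
proof -
  obtain t \<theta> r E where t: "repT t r g" and \<theta>: "repD \<theta> r E (\<lambda>e X. P (e 0) (\<lambda>n. e (Suc n)) X)"
    using assms by (rule T_D0_two)
  \<comment> \<open>\<open>\<rho>S\<close> frees variable 1, so the bound cannot contain the
    quantified variable. The head \<open>\<zero>\<close> of \<open>?r\<close> is a placeholder that
    the quantifier overwrites.\<close>
  let ?t = "tren \<rho>S t" and ?\<theta> = "fren \<rho>Q id \<theta>" and ?r = "case_nat \<zero> r"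
  have "1 \<notin> tm_vars ?t"
    by (auto simp: tm_vars_tren \<rho>S_def)
  moreover have "bounded_fm ?\<theta>"
    using \<theta> by (simp add: repD_def bounded_fm_fren inj_\<rho>)
  ultimately have "repD (AllN 1 (Imp (Less (Var 1) ?t) ?\<theta>)) ?r E (\<lambda>e X. \<forall>a. a \<prec> g e \<longrightarrow> P a e X)"
    using \<theta> t repT_S[OF t] unfolding repD_def sat.simps mrg_upd_param repD_quant[OF \<theta>]
    by (auto simp: repT_def mrg_def intro!: bounded_fm.intros)
  then show ?thesis unfolding D0_def by blast
qed

lemma D0_bex_less [dfn]:
  assumes "T g" "D0 (\<lambda>e X. P (e 0) (\<lambda>n. e (Suc n)) X)"
  shows "D0 (\<lambda>e X. \<exists>a. a \<prec> g e \<and> P a e X)"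
proof -
  have "D0 (\<lambda>e X. \<not> (\<forall>a. a \<prec> g e \<longrightarrow> \<not> P a e X))"
    using assms by (intro dfn)
  then show ?thesis by simp
qed

lemma less_succ: "a \<prec> b \<oplus> \<one> \<longleftrightarrow> a \<preceq> b"
  using model by (simp add: rca0_model_def basic_axioms_def le_def)

lemma D0_ball_le [dfn]:
  assumes "T g" "D0 (\<lambda>e X. P (e 0) (\<lambda>n. e (Suc n)) X)"
  shows "D0 (\<lambda>e X. \<forall>a. a \<preceq> g e \<longrightarrow> P a e X)"
  unfolding less_succ[symmetric] using assms by (intro dfn)

lemma D0_bex_le [dfn]:
  assumes "T g" "D0 (\<lambda>e X. P (e 0) (\<lambda>n. e (Suc n)) X)"
  shows "D0 (\<lambda>e X. \<exists>a. a \<preceq> g e \<and> P a e X)"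
  unfolding less_succ[symmetric] using assms by (intro dfn)

lemma range_case_nat: "X \<in> A \<Longrightarrow> range E \<subseteq> A \<Longrightarrow> range (case_nat X E) \<subseteq> A"
  by (auto simp: image_subset_iff split: nat.splits)

lemma D0_rename:
  assumes "repD \<theta> r E P" "inj \<rho>" "range F \<subseteq> S"
    and "\<And>e X. X \<in> S \<Longrightarrow> mrg e s \<circ> \<rho> = mrg (h e X) r \<and> case_nat X F \<circ> \<sigma> = case_nat (k e X) E \<and> k e X \<in> S"
  shows "D0 (\<lambda>e X. P (h e X) (k e X))"
proof -
  have "repD (fren \<rho> \<sigma> \<theta>) s F (\<lambda>e X. P (h e X) (k e X))"
    unfolding repD_def
  proof (intro conjI allI ballI)
    fix e X assume "X \<in> S"
    then show "sat M (mrg e s) (case_nat X F) (fren \<rho> \<sigma> \<theta>) \<longleftrightarrow> P (h e X) (k e X)"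
      using assms(1,2) assms(4)[of X e] by (simp add: repD_def sat_fren)
  qed (use assms in \<open>auto simp: repD_def bounded_fm_fren\<close>)
  then show ?thesis unfolding D0_def by blast
qed

lemma D0_lift:
  assumes "D0 P"
  shows "D0 (\<lambda>e X. P (\<lambda>n. e (Suc n)) X)"
proof -
  obtain \<theta> r E where \<theta>: "repD \<theta> r E P" using assms unfolding D0_def by blast
  let ?\<rho> = "\<lambda>n. if even n then n + 2 else n"
  have inj: "inj ?\<rho>"
    unfolding inj_def by (auto elim!: evenE)
  have "mrg e r \<circ> ?\<rho> = mrg (\<lambda>n. e (Suc n)) r" for e
    by (simp add: fun_eq_iff mrg_def)
  then show ?thesis
    using \<theta> by (intro D0_rename[OF \<theta> inj, of E r _ id]) (auto simp: repD_def)
qed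

lemma T_lift:
  assumes "T g"
  shows "T (\<lambda>e. g (\<lambda>n. e (Suc n)))"
proof -
  obtain t r where t: "repT t r g" using assms unfolding T_def by blast
  let ?\<rho> = "\<lambda>n. if even n then n + 2 else n"
  have "mrg e r \<circ> ?\<rho> = mrg (\<lambda>n. e (Suc n)) r" for e
    by (simp add: fun_eq_iff mrg_def)
  then have "repT (tren ?\<rho> t) r (\<lambda>e. g (\<lambda>n. e (Suc n)))"
    using t by (simp add: repT_def tm_val_tren)
  then show ?thesis unfolding T_def by blast
qed

text \<open>A bounded quantifier pinned to the value \<open>g e\<close> simulates substitution, so
  no substitution into formulas has to be defined.\<close>

lemma D0_subst:
  assumes "D0 P" "T g"
  shows "D0 (\<lambda>e X. P (case_nat (g e) e) X)"
proof -
  have "D0 (\<lambda>e X. \<exists>a. a \<preceq> g e \<and> (a = g e \<and> P (case_nat a e) X))"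
    using assms T_lift[OF assms(2)] by (intro dfn) auto
  moreover have "(\<exists>a. a \<preceq> g e \<and> (a = g e \<and> P (case_nat a e) X)) = P (case_nat (g e) e) X" for e X
    by (auto simp: le_def)
  ultimately show ?thesis by simp
qed

lemma D0_app2:
  assumes "D0 (\<lambda>e X. R (e 0) (e 1) X)" "T g" "T h"
  shows "D0 (\<lambda>e X. R (g e) (h e) X)"
  using D0_subst[OF D0_subst[OF assms(1) T_lift[OF assms(2)]] assms(3)] by simp

text \<open>All arguments from \<open>k\<close> on and the set argument become parameters. This
  prepares predicates for collection, where only a few numbers may vary.\<close>

lemma D0_fix:
  assumes "D0 P" "X0 \<in> S"
  shows "D0 (\<lambda>e' X. P (\<lambda>n. if n < k then e' n else e (n - k)) X0)"
proof -
  obtain \<theta> r E where \<theta>: "repD \<theta> r E P" using assms unfolding D0_def by blast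
  let ?\<rho> = "\<lambda>n. if even n \<and> n < 2 * k then n else Suc (2 * n)"
  let ?r = "mrg (\<lambda>n. e (n - k)) r"
  have inj: "inj ?\<rho>"
    unfolding inj_def by (auto split: if_splits)
  have "(mrg e' ?r \<circ> ?\<rho>) n = mrg (\<lambda>n. if n < k then e' n else e (n - k)) r n" for n e'
  proof (cases n rule: nat_parity_cases)
    case (2 m)
    then have "?\<rho> n = Suc (2 * Suc (2 * m))" by simp
    then show ?thesis using 2 by (simp only: comp_apply mrg_simps)
  next
    case (1 m)
    show ?thesis
    proof (cases "m < k")
      case True
      with 1 have "?\<rho> n = 2 * m" by simp
      then show ?thesis using 1 True by (simp only: comp_apply mrg_simps if_True)
    next
      case False
      with 1 have "?\<rho> n = Suc (2 * (2 * m))" by simp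
      then show ?thesis using 1 False by (simp only: comp_apply mrg_simps if_False)
    qed
  qed
  then show ?thesis
    using \<theta> assms(2)
    by (intro D0_rename[OF \<theta> inj, of "case_nat X0 E" ?r _ Suc] range_case_nat conjI ext)
      (simp_all add: repD_def)
qed

lemma D0_fix2: "D0 P \<Longrightarrow> X0 \<in> S \<Longrightarrow> D0 (\<lambda>e' X. P (case_nat (e' 0) (case_nat (e' 1) e)) X0)"
proof -
  assume "D0 P" "X0 \<in> S"
  have eq: "(\<lambda>e' X. P (\<lambda>n. if n < 2 then e' n else e (n - 2)) X0)
    = (\<lambda>e' X. P (case_nat (e' 0) (case_nat (e' 1) e)) X0)"
    by (intro ext arg_cong2[where f = P]) (auto split: nat.splits simp: numeral_eq_Suc)
  show ?thesis unfolding eq[symmetric] by (rule D0_fix) fact+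
qed

lemma D0_fix3: "D0 P \<Longrightarrow> X0 \<in> S \<Longrightarrow> D0 (\<lambda>e' X. P (case_nat (e' 0) (case_nat (e' 1) (case_nat (e' 2) e))) X0)"
proof -
  assume "D0 P" "X0 \<in> S"
  have eq: "(\<lambda>e' X. P (\<lambda>n. if n < 3 then e' n else e (n - 3)) X0)
    = (\<lambda>e' X. P (case_nat (e' 0) (case_nat (e' 1) (case_nat (e' 2) e))) X0)"
    by (intro ext arg_cong2[where f = P]) (auto split: nat.splits simp: numeral_eq_Suc)
  show ?thesis unfolding eq[symmetric] by (rule D0_fix) fact+
qed

section \<open>Unbounded quantifiers and the axiom schemes\<close>

definition S1 where
  "S1 P \<longleftrightarrow> (\<exists>Q. D0 Q \<and> (\<forall>e. \<forall>X\<in>S. P e X \<longleftrightarrow> (\<exists>a. Q (case_nat a e) X)))"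
definition P1 where
  "P1 P \<longleftrightarrow> (\<exists>Q. D0 Q \<and> (\<forall>e. \<forall>X\<in>S. P e X \<longleftrightarrow> (\<forall>a. Q (case_nat a e) X)))"
definition S2 where
  "S2 P \<longleftrightarrow> (\<exists>Q. D0 Q \<and> (\<forall>e. \<forall>X\<in>S. P e X \<longleftrightarrow> (\<exists>u. \<forall>v. Q (case_nat v (case_nat u e)) X)))"

lemma S1_D0: "D0 P \<Longrightarrow> S1 P"
  and P1_D0: "D0 P \<Longrightarrow> P1 P"
  unfolding S1_def P1_def by (intro exI[of _ "\<lambda>e X. P (\<lambda>n. e (Suc n)) X"] conjI D0_lift; simp)+

lemma S1_ex_D0: "D0 (\<lambda>e X. P (e 0) (\<lambda>n. e (Suc n)) X) \<Longrightarrow> S1 (\<lambda>e X. \<exists>a. P a e X)"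
  and P1_all_D0: "D0 (\<lambda>e X. P (e 0) (\<lambda>n. e (Suc n)) X) \<Longrightarrow> P1 (\<lambda>e X. \<forall>a. P a e X)"
  unfolding S1_def P1_def by (intro exI[of _ "\<lambda>e X. P (e 0) (\<lambda>n. e (Suc n)) X"]; simp)+

lemma P1_neg: "S1 P \<Longrightarrow> P1 (\<lambda>e X. \<not> P e X)"
  and S1_neg: "P1 P \<Longrightarrow> S1 (\<lambda>e X. \<not> P e X)"
proof -
  assume "S1 P"
  then obtain Q where "D0 Q" "\<forall>e. \<forall>X\<in>S. P e X \<longleftrightarrow> (\<exists>a. Q (case_nat a e) X)"
    unfolding S1_def by blast
  then show "P1 (\<lambda>e X. \<not> P e X)"
    unfolding P1_def by (intro exI[of _ "\<lambda>e X. \<not> Q e X"]) (auto intro!: dfn)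
next
  assume "P1 P"
  then obtain Q where "D0 Q" "\<forall>e. \<forall>X\<in>S. P e X \<longleftrightarrow> (\<forall>a. Q (case_nat a e) X)"
    unfolding P1_def by blast
  then show "S1 (\<lambda>e X. \<not> P e X)"
    unfolding S1_def by (intro exI[of _ "\<lambda>e X. \<not> Q e X"]) (auto intro!: dfn)
qed

lemma mrg_upd_0: "(mrg e r)(0 := a) = mrg (e(0 := a)) r"
  using mrg_upd_arg[of e r 0 a] by simp

lemma S1_induct:
  assumes S1: "S1 (\<lambda>e X. P (e 0))" and zero: "P \<zero>" and succ: "\<And>a. P a \<Longrightarrow> P (a \<oplus> \<one>)"
  shows "P a"
proof -
  obtain Q where "D0 Q" and Q: "\<And>e X. X \<in> S \<Longrightarrow> P (e 0) \<longleftrightarrow> (\<exists>a. Q (case_nat a e) X)"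
    using S1 unfolding S1_def by blast
  then obtain \<theta> r E where \<theta>: "repD \<theta> r E Q" unfolding D0_def by blast
  \<comment> \<open>\<open>P\<close> does not look at the set argument, but set variable 0 of the
    formula must get a value from the model.\<close>
  obtain X where X: "X \<in> S" using S_nonempty by blast
  let ?\<phi> = "ExN 1 (fren \<rho>Q id \<theta>)" and ?e = "mrg (\<lambda>_. \<zero>) (case_nat \<zero> r)" and ?E = "case_nat X E"
  have "sat M (?e(0 := a)) ?E ?\<phi> \<longleftrightarrow> P a" for a
    using X Q[of X "(\<lambda>_. \<zero>)(0 := a)"] \<theta>
    unfolding sat.simps mrg_upd_0 mrg_upd_param repD_quant[OF \<theta>] by (simp add: repD_def)
  moreover have "Sigma1 ?\<phi>"
    using \<theta> unfolding Sigma1_def by (auto simp: repD_def inj_\<rho> bounded_fm_fren)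
  moreover have "range ?E \<subseteq> S"
    using \<theta> X by (intro range_case_nat) (simp_all add: repD_def)
  moreover have "Sigma1_induction M"
    using model by (simp add: rca0_model_def)
  ultimately show ?thesis
    using zero succ unfolding Sigma1_induction_def by metis
qed

lemma D1_comprehension:
  assumes "S1 (\<lambda>e X. P (e 0))" "P1 (\<lambda>e X. P (e 0))"
  shows "{a. P a} \<in> S"
proof -
  obtain Q R where "D0 Q" and Q: "\<And>e X. X \<in> S \<Longrightarrow> P (e 0) \<longleftrightarrow> (\<exists>a. Q (case_nat a e) X)"
    and "D0 R" and R: "\<And>e X. X \<in> S \<Longrightarrow> P (e 0) \<longleftrightarrow> (\<forall>a. R (case_nat a e) X)"
    using assms unfolding S1_def P1_def by blast
  obtain \<theta> \<eta> r E where \<theta>: "repD \<theta> r E Q" and \<eta>: "repD \<eta> r E R"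
    using \<open>D0 Q\<close> \<open>D0 R\<close> by (rule D0_two)
  obtain X where X: "X \<in> S" using S_nonempty by blast
  let ?\<phi> = "ExN 1 (fren \<rho>Q id \<theta>)" and ?\<psi> = "AllN 1 (fren \<rho>Q id \<eta>)"
  let ?e = "mrg (\<lambda>_. \<zero>) (case_nat \<zero> r)" and ?E = "case_nat X E"
  have \<phi>: "sat M (?e(0 := a)) ?E ?\<phi> \<longleftrightarrow> P a" for a
    using X Q[of X "(\<lambda>_. \<zero>)(0 := a)"] \<theta>
    unfolding sat.simps mrg_upd_0 mrg_upd_param repD_quant[OF \<theta>] by (simp add: repD_def)
  have \<psi>: "sat M (?e(0 := a)) ?E ?\<psi> \<longleftrightarrow> P a" for a
    using X R[of X "(\<lambda>_. \<zero>)(0 := a)"] \<eta>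
    unfolding sat.simps mrg_upd_0 mrg_upd_param repD_quant[OF \<eta>] by (simp add: repD_def)
  have "Sigma1 ?\<phi>" "Pi1 ?\<psi>"
    using \<theta> \<eta> unfolding Sigma1_def Pi1_def by (auto simp: repD_def inj_\<rho> bounded_fm_fren)
  moreover have "range ?E \<subseteq> S"
    using \<theta> X by (intro range_case_nat) (simp_all add: repD_def)
  moreover have "\<forall>a. sat M (?e(0 := a)) ?E ?\<phi> \<longleftrightarrow> sat M (?e(0 := a)) ?E ?\<psi>"
    unfolding \<phi> \<psi> by simp
  moreover have "Delta1_comprehension M"
    using model by (simp add: rca0_model_def)
  ultimately have "{a. sat M (?e(0 := a)) ?E ?\<phi>} \<in> S"
    unfolding Delta1_comprehension_def by metis
  then show ?thesis unfolding \<phi> .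
qed

lemma D0_comprehension: "D0 (\<lambda>e X. P (e 0)) \<Longrightarrow> {a. P a} \<in> S"
  by (intro D1_comprehension S1_D0 P1_D0)

lemma D0_induct: "D0 (\<lambda>e X. P (e 0)) \<Longrightarrow> P \<zero> \<Longrightarrow> (\<And>a. P a \<Longrightarrow> P (a \<oplus> \<one>)) \<Longrightarrow> P a"
  using S1_induct[OF S1_D0] .

section \<open>Arithmetic in a model\<close>

lemma succ_neq_zero: "a \<oplus> \<one> \<noteq> \<zero>"
  and succ_inj: "a \<oplus> \<one> = b \<oplus> \<one> \<Longrightarrow> a = b"
  and add_zero: "a \<oplus> \<zero> = a"
  and add_succ: "a \<oplus> (b \<oplus> \<one>) = (a \<oplus> b) \<oplus> \<one>"
  and mul_zero: "a \<otimes> \<zero> = \<zero>"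
  and mul_succ: "a \<otimes> (b \<oplus> \<one>) = a \<otimes> b \<oplus> a"
  and not_less_zero: "\<not> a \<prec> \<zero>"
  using model by (simp_all add: rca0_model_def basic_axioms_def)

lemma add_assoc: "a \<oplus> b \<oplus> c = a \<oplus> (b \<oplus> c)"
  by (rule D0_induct[where P = "\<lambda>c. a \<oplus> b \<oplus> c = a \<oplus> (b \<oplus> c)"]; (intro dfn)?) (simp_all add: add_zero add_succ)

lemma zero_add: "\<zero> \<oplus> a = a"
  by (rule D0_induct[where P = "\<lambda>a. \<zero> \<oplus> a = a"]; (intro dfn)?) (simp_all add: add_zero add_succ)

lemma succ_add: "a \<oplus> \<one> \<oplus> b = a \<oplus> b \<oplus> \<one>"
  by (rule D0_induct[where P = "\<lambda>b. a \<oplus> \<one> \<oplus> b = a \<oplus> b \<oplus> \<one>"]; (intro dfn)?) (simp_all add: add_zero add_succ)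

lemma add_commute: "a \<oplus> b = b \<oplus> a"
proof (rule D0_induct[where P = "\<lambda>b. a \<oplus> b = b \<oplus> a"]; (intro dfn)?)
  fix b assume "a \<oplus> b = b \<oplus> a"
  then show "a \<oplus> (b \<oplus> \<one>) = b \<oplus> \<one> \<oplus> a" by (simp only: add_succ succ_add)
qed (simp only: add_zero zero_add)

lemma add_cancel: "a \<oplus> c = b \<oplus> c \<Longrightarrow> a = b"
  by (erule rev_mp, rule D0_induct[where P = "\<lambda>c. a \<oplus> c = b \<oplus> c \<longrightarrow> a = b"]; (intro dfn)?)
    (auto simp: add_zero add_succ dest: succ_inj)

lemma distrib_left: "a \<otimes> (b \<oplus> c) = a \<otimes> b \<oplus> a \<otimes> c"
  by (rule D0_induct[where P = "\<lambda>c. a \<otimes> (b \<oplus> c) = a \<otimes> b \<oplus> a \<otimes> c"]; (intro dfn)?)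
    (simp_all only: add_zero add_succ mul_zero mul_succ add_assoc[symmetric])

lemma mul_assoc: "a \<otimes> b \<otimes> c = a \<otimes> (b \<otimes> c)"
proof (rule D0_induct[where P = "\<lambda>c. a \<otimes> b \<otimes> c = a \<otimes> (b \<otimes> c)"]; (intro dfn)?)
  fix c assume "a \<otimes> b \<otimes> c = a \<otimes> (b \<otimes> c)"
  then show "a \<otimes> b \<otimes> (c \<oplus> \<one>) = a \<otimes> (b \<otimes> (c \<oplus> \<one>))" by (metis mul_succ distrib_left)
qed (simp only: mul_zero)

lemma zero_mul: "\<zero> \<otimes> a = \<zero>"
  by (rule D0_induct[where P = "\<lambda>a. \<zero> \<otimes> a = \<zero>"]; (intro dfn)?) (simp_all add: mul_zero mul_succ add_zero)

lemma succ_mul: "(a \<oplus> \<one>) \<otimes> b = a \<otimes> b \<oplus> b"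
proof (rule D0_induct[where P = "\<lambda>b. (a \<oplus> \<one>) \<otimes> b = a \<otimes> b \<oplus> b"]; (intro dfn)?)
  fix b assume "(a \<oplus> \<one>) \<otimes> b = a \<otimes> b \<oplus> b"
  then show "(a \<oplus> \<one>) \<otimes> (b \<oplus> \<one>) = a \<otimes> (b \<oplus> \<one>) \<oplus> (b \<oplus> \<one>)"
    by (metis add_assoc add_commute mul_succ)
qed (simp add: mul_zero add_zero)

lemma mul_commute: "a \<otimes> b = b \<otimes> a"
  by (rule D0_induct[where P = "\<lambda>b. a \<otimes> b = b \<otimes> a"]; (intro dfn)?)
    (simp_all add: mul_zero zero_mul mul_succ succ_mul)

lemma one_mul: "\<one> \<otimes> a = a"
  using succ_mul[of \<zero> a] by (simp add: zero_add zero_mul)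

lemma zero_or_succ: "a = \<zero> \<or> (\<exists>b. a = b \<oplus> \<one>)"
proof -
  have "\<exists>b. a = \<zero> \<or> a = b \<oplus> \<one>"
    by (rule S1_induct[where P = "\<lambda>a. \<exists>b. a = \<zero> \<or> a = b \<oplus> \<one>"], rule S1_ex_D0, intro dfn) auto
  then show ?thesis by blast
qed

lemma less_iff_add: "a \<prec> b \<longleftrightarrow> (\<exists>c. a \<oplus> (c \<oplus> \<one>) = b)"
proof
  \<comment> \<open>The premise is moved below the quantifier, so that the induction statement is
    one existential in front of a bounded matrix.\<close>
  have "\<exists>c. a \<prec> b \<longrightarrow> a \<oplus> (c \<oplus> \<one>) = b"
  proof (rule S1_induct[where P = "\<lambda>b. \<exists>c. a \<prec> b \<longrightarrow> a \<oplus> (c \<oplus> \<one>) = b"], rule S1_ex_D0, intro dfn)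
    fix b assume "\<exists>c. a \<prec> b \<longrightarrow> a \<oplus> (c \<oplus> \<one>) = b"
    then show "\<exists>c. a \<prec> b \<oplus> \<one> \<longrightarrow> a \<oplus> (c \<oplus> \<one>) = b \<oplus> \<one>"
      unfolding less_succ le_def by (metis add_succ add_zero)
  qed (simp add: not_less_zero)
  then show "a \<prec> b \<Longrightarrow> \<exists>c. a \<oplus> (c \<oplus> \<one>) = b" by blast
  have "a \<prec> a \<oplus> (c \<oplus> \<one>)" for c
    by (rule D0_induct[where P = "\<lambda>c. a \<prec> a \<oplus> (c \<oplus> \<one>)"]; (intro dfn)?)
      (auto simp: add_succ add_zero zero_add less_succ le_def)
  then show "\<exists>c. a \<oplus> (c \<oplus> \<one>) = b \<Longrightarrow> a \<prec> b" by blast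
qed

lemma less_irrefl: "\<not> a \<prec> a"
  unfolding less_iff_add by (metis add_cancel add_commute add_zero succ_neq_zero)

lemma less_trans: "a \<prec> b \<Longrightarrow> b \<prec> c \<Longrightarrow> a \<prec> c"
  unfolding less_iff_add by (metis add_assoc)

lemma less_linear: "a \<prec> b \<or> a = b \<or> b \<prec> a"
proof (rule D0_induct[where P = "\<lambda>b. a \<prec> b \<or> a = b \<or> b \<prec> a"]; (intro dfn)?)
  show "a \<prec> \<zero> \<or> a = \<zero> \<or> \<zero> \<prec> a"
    unfolding less_iff_add using zero_or_succ[of a] by (auto simp: zero_add)
next
  fix b assume "a \<prec> b \<or> a = b \<or> b \<prec> a"
  then show "a \<prec> b \<oplus> \<one> \<or> a = b \<oplus> \<one> \<or> b \<oplus> \<one> \<prec> a"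
  proof (elim disjE)
    assume "b \<prec> a"
    then obtain c where c: "a = b \<oplus> (c \<oplus> \<one>)" unfolding less_iff_add by blast
    show ?thesis
    proof (cases "c = \<zero>")
      case False
      then obtain d where "c = d \<oplus> \<one>" using zero_or_succ by blast
      with c have "b \<oplus> \<one> \<oplus> (d \<oplus> \<one>) = a" by (simp only: add_succ succ_add[of b d])
      then show ?thesis unfolding less_iff_add by blast
    qed (simp add: c zero_add)
  qed (auto simp: less_succ le_def)
qed

sublocale sr: comm_semiring_1 where one = \<one> and times = "(\<otimes>)" and plus = "(\<oplus>)" and zero = \<zero>
proof
  show "\<zero> \<noteq> \<one>" using succ_neq_zero[of \<zero>] by (simp add: zero_add)
  show "(a \<oplus> b) \<otimes> c = a \<otimes> c \<oplus> b \<otimes> c" for a b c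
    by (simp add: mul_commute[of _ c] distrib_left)
qed (fact add_assoc add_commute zero_add mul_assoc mul_commute one_mul zero_mul mul_zero)+

sublocale ord: linorder where less_eq = "(\<preceq>)" and less = "(\<prec>)"
  by standard (unfold le_def, (metis less_irrefl less_trans less_linear)+)

lemma le_iff_add: "a \<preceq> b \<longleftrightarrow> (\<exists>c. a \<oplus> c = b)"
  unfolding le_def less_iff_add using zero_or_succ by (metis add_zero)

lemma zero_le [simp]: "\<zero> \<preceq> a"
  unfolding le_iff_add by (metis zero_add)

lemma le_zero_iff [simp]: "a \<preceq> \<zero> \<longleftrightarrow> a = \<zero>"
  by (metis le_def not_less_zero)

lemma le_add1 [simp]: "a \<preceq> a \<oplus> b" "a \<preceq> b \<oplus> a"
  unfolding le_iff_add using add_commute by blast+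

lemma less_succ_self [simp]: "a \<prec> a \<oplus> \<one>"
  by (simp add: less_succ le_def)

lemma succ_le_iff: "a \<oplus> \<one> \<preceq> b \<longleftrightarrow> a \<prec> b"
  unfolding le_iff_add less_iff_add using add_assoc add_commute by metis

lemma add_mono: "a \<preceq> b \<Longrightarrow> c \<preceq> d \<Longrightarrow> a \<oplus> c \<preceq> b \<oplus> d"
  unfolding le_iff_add by (metis sr.add.commute sr.add.left_commute)

lemma mul_mono: "a \<preceq> b \<Longrightarrow> c \<preceq> d \<Longrightarrow> a \<otimes> c \<preceq> b \<otimes> d"
proof -
  assume "a \<preceq> b" "c \<preceq> d"
  then obtain x y where "b = a \<oplus> x" "d = c \<oplus> y" unfolding le_iff_add by blast
  then have "b \<otimes> d = a \<otimes> c \<oplus> (a \<otimes> y \<oplus> x \<otimes> (c \<oplus> y))"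
    by (simp add: sr.distrib_left sr.distrib_right sr.add.assoc sr.add.left_commute)
  then show ?thesis by (metis le_add1(1))
qed

text \<open>Components never exceed the code, so a quantifier over them can be bounded by the code.
  Many definitions below stay bounded for this reason.\<close>

lemma le_pair: "a \<preceq> pair a b" "b \<preceq> pair a b"
proof -
  have le_sq: "x \<preceq> x \<otimes> x" for x
    using mul_mono[of \<one> x x x] zero_or_succ[of x] by (auto simp: mul_zero mul_succ)
  show "a \<preceq> pair a b" by (simp add: m_pair_def)
  have "b \<preceq> a \<oplus> b" by simp
  also have "\<dots> \<preceq> (a \<oplus> b) \<otimes> (a \<oplus> b)" by (rule le_sq)
  also have "\<dots> \<preceq> pair a b" by (simp add: m_pair_def)
  finally show "b \<preceq> pair a b" .
qed

lemma pair_mono: "a \<preceq> b \<Longrightarrow> c \<preceq> d \<Longrightarrow> pair a c \<preceq> pair b d"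
  unfolding m_pair_def by (intro add_mono mul_mono)

text \<open>Codes of pairs with sum \<open>s\<close> lie between \<open>s \<otimes> s\<close> and
  \<open>s \<otimes> s \<oplus> s\<close>, hence below the square of
  \<open>s \<oplus> \<one>\<close>. So the code determines the sum, and then the components.\<close>

lemma pair_sum_less:
  assumes "a \<oplus> b \<prec> c \<oplus> d"
  shows "pair a b \<prec> pair c d"
proof -
  define s where "s = a \<oplus> b"
  have "a \<preceq> s" by (simp add: s_def)
  have "pair a b \<preceq> s \<otimes> s \<oplus> s"
    unfolding m_pair_def s_def[symmetric] using add_mono[OF ord.order_refl \<open>a \<preceq> s\<close>] .
  also have "\<dots> \<prec> s \<otimes> s \<oplus> s \<oplus> (s \<oplus> \<one>)"
    unfolding less_iff_add by blast
  also have "\<dots> = (s \<oplus> \<one>) \<otimes> (s \<oplus> \<one>)"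
    by (simp only: mul_succ succ_mul add_assoc)
  also have "\<dots> \<preceq> (c \<oplus> d) \<otimes> (c \<oplus> d)"
    using assms unfolding s_def[symmetric] succ_le_iff[symmetric] by (intro mul_mono)
  also have "\<dots> \<preceq> pair c d"
    by (simp add: m_pair_def)
  finally show ?thesis .
qed

lemma pair_inject [simp]: "pair a b = pair c d \<longleftrightarrow> a = c \<and> b = d"
proof
  assume eq: "pair a b = pair c d"
  then have s: "a \<oplus> b = c \<oplus> d"
    using pair_sum_less less_linear less_irrefl by metis
  with eq have "a = c"
    unfolding m_pair_def using add_cancel add_commute by metis
  with s show "a = c \<and> b = d"
    using add_cancel add_commute by metis
qed simp

section \<open>Closure properties of the definability classes\<close>

lemma D0_reindex:
  assumes "D0 P" "inj \<pi>"
  shows "D0 (\<lambda>e X. P (\<lambda>n. e (\<pi> n)) X)"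
proof -
  obtain \<theta> r E where \<theta>: "repD \<theta> r E P" using assms unfolding D0_def by blast
  let ?\<rho> = "\<lambda>n. if even n then 2 * \<pi> (n div 2) else n"
  have inj: "inj ?\<rho>"
  proof (rule injI)
    fix m n assume eq: "?\<rho> m = ?\<rho> n"
    show "m = n"
    proof (cases "even m"; cases "even n")
      assume "even m" "even n"
      with eq have "\<pi> (m div 2) = \<pi> (n div 2)" by simp
      with assms(2) have "m div 2 = n div 2" by (rule injD)
      with \<open>even m\<close> \<open>even n\<close> show ?thesis by (metis dvd_mult_div_cancel)
    next
      assume "even m" "odd n"
      with eq have "n = 2 * \<pi> (m div 2)" by simp
      with \<open>odd n\<close> show ?thesis by simp
    next
      assume "odd m" "even n"
      with eq have "m = 2 * \<pi> (n div 2)" by simp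
      with \<open>odd m\<close> show ?thesis by simp
    qed (use eq in simp)
  qed
  have "mrg e r \<circ> ?\<rho> = mrg (\<lambda>n. e (\<pi> n)) r" for e
    by (simp add: fun_eq_iff mrg_def)
  then show ?thesis
    using \<theta> by (intro D0_rename[OF \<theta> inj, of E r _ id]) (auto simp: repD_def)
qed

lemma D0_fixX:
  assumes "D0 P" "X0 \<in> S"
  shows "D0 (\<lambda>e X. P e X0)"
proof -
  obtain \<theta> r E where \<theta>: "repD \<theta> r E P" using assms unfolding D0_def by blast
  show ?thesis
    using assms(2) \<theta> by (intro D0_rename[OF \<theta> inj_on_id, of "case_nat X0 E" r _ Suc] range_case_nat conjI)
      (auto simp: repD_def)
qed

text \<open>The inserted argument 1 stands for a bound or witness that is quantified further
  out.\<close>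

lemma D0_skip1: "D0 P \<Longrightarrow> D0 (\<lambda>e X. P (case_nat (e 0) (\<lambda>n. e (Suc (Suc n)))) X)"
proof -
  assume "D0 P"
  then have "D0 (\<lambda>e X. P (\<lambda>n. e (case_nat 0 (\<lambda>n. Suc (Suc n)) n)) X)"
    by (rule D0_reindex) (auto simp: inj_def split: nat.splits)
  moreover have "(\<lambda>n. e (case_nat 0 (\<lambda>n. Suc (Suc n)) n)) = case_nat (e 0) (\<lambda>n. e (Suc (Suc n)))" for e :: "nat \<Rightarrow> 'm"
    by (simp add: fun_eq_iff split: nat.splits)
  ultimately show ?thesis by (simp only:)
qed

lemma D0_skip2: "D0 P \<Longrightarrow> D0 (\<lambda>e X. P (case_nat (e 0) (case_nat (e 1) (\<lambda>n. e (Suc (Suc (Suc n)))))) X)"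
proof -
  assume "D0 P"
  then have "D0 (\<lambda>e X. P (\<lambda>n. e (case_nat 0 (case_nat 1 (\<lambda>n. Suc (Suc (Suc n)))) n)) X)"
    by (rule D0_reindex) (auto simp: inj_def split: nat.splits)
  moreover have "(\<lambda>n. e (case_nat 0 (case_nat 1 (\<lambda>n. Suc (Suc (Suc n)))) n))
      = case_nat (e 0) (case_nat (e 1) (\<lambda>n. e (Suc (Suc (Suc n)))))" for e :: "nat \<Rightarrow> 'm"
    by (simp add: fun_eq_iff split: nat.splits)
  ultimately show ?thesis by (simp only:)
qed

lemma S1_I:
  assumes "D0 Q" "\<And>e X. X \<in> S \<Longrightarrow> P e X \<longleftrightarrow> (\<exists>a. Q (case_nat a e) X)"
  shows "S1 P"
  using assms unfolding S1_def by blast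

lemma P1_I:
  assumes "D0 Q" "\<And>e X. X \<in> S \<Longrightarrow> P e X \<longleftrightarrow> (\<forall>a. Q (case_nat a e) X)"
  shows "P1 P"
  using assms unfolding P1_def by blast

lemma S2_I:
  assumes "D0 Q" "\<And>e X. X \<in> S \<Longrightarrow> P e X \<longleftrightarrow> (\<exists>u. \<forall>v. Q (case_nat v (case_nat u e)) X)"
  shows "S2 P"
  using assms unfolding S2_def by blast

lemma P1_iff_S1: "P1 P \<longleftrightarrow> S1 (\<lambda>e X. \<not> P e X)"
  using S1_neg[of P] P1_neg[of "\<lambda>e X. \<not> P e X"] by auto

lemma S2_cong: "S2 P \<Longrightarrow> (\<And>e X. X \<in> S \<Longrightarrow> P' e X \<longleftrightarrow> P e X) \<Longrightarrow> S2 P'"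
  unfolding S2_def by simp

lemma upper_bound: obtains c where "a \<preceq> c" "b \<preceq> c"
  using le_add1 by blast

lemma S1_conj: "S1 P \<Longrightarrow> S1 P' \<Longrightarrow> S1 (\<lambda>e X. P e X \<and> P' e X)"
proof -
  assume "S1 P" "S1 P'"
  then obtain Q Q' where Q: "D0 Q" "\<forall>e. \<forall>X\<in>S. P e X \<longleftrightarrow> (\<exists>a. Q (case_nat a e) X)"
    and Q': "D0 Q'" "\<forall>e. \<forall>X\<in>S. P' e X \<longleftrightarrow> (\<exists>a. Q' (case_nat a e) X)"
    unfolding S1_def by blast
  let ?R = "\<lambda>e X. (\<exists>a. a \<preceq> e 0 \<and> Q (case_nat a (\<lambda>n. e (Suc n))) X)
    \<and> (\<exists>a. a \<preceq> e 0 \<and> Q' (case_nat a (\<lambda>n. e (Suc n))) X)"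
  have "D0 ?R"
    using D0_skip1[OF Q(1)] D0_skip1[OF Q'(1)] by (intro dfn)
  then show ?thesis
  proof (rule S1_I)
    fix e X assume "X \<in> S"
    then show "P e X \<and> P' e X \<longleftrightarrow> (\<exists>a. ?R (case_nat a e) X)"
      unfolding Q(2)[rule_format, OF \<open>X \<in> S\<close>] Q'(2)[rule_format, OF \<open>X \<in> S\<close>] by simp (metis upper_bound)
  qed
qed

text \<open>One number that bounds both witnesses merges two unbounded quantifiers;
  \<open>S1_conj\<close> uses the same idea.\<close>

lemma ex2_bounded: "(\<exists>a b. R a b) \<longleftrightarrow> (\<exists>c. \<exists>a. a \<preceq> c \<and> (\<exists>b. b \<preceq> c \<and> R a b))"
  by (metis upper_bound)

lemma S1_ex:
  assumes "S1 (\<lambda>e X. P (e 0) (\<lambda>n. e (Suc n)) X)"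
  shows "S1 (\<lambda>e X. \<exists>a. P a e X)"
proof -
  obtain Q where Q: "D0 Q" "\<forall>e. \<forall>X\<in>S. P (e 0) (\<lambda>n. e (Suc n)) X \<longleftrightarrow> (\<exists>b. Q (case_nat b e) X)"
    using assms unfolding S1_def by blast
  have Q2: "P a e X \<longleftrightarrow> (\<exists>b. Q (case_nat b (case_nat a e)) X)" if "X \<in> S" for a e X
    using Q(2)[rule_format, OF that, of "case_nat a e"] by simp
  let ?R = "\<lambda>e X. \<exists>a. a \<preceq> e 0 \<and> (\<exists>b. b \<preceq> e 0 \<and> Q (case_nat b (case_nat a (\<lambda>n. e (Suc n)))) X)"
  have "D0 ?R"
    using D0_skip2[OF Q(1)] by (intro dfn) simp
  then show ?thesis
  proof (rule S1_I)
    fix e X assume "X \<in> S"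
    then show "(\<exists>a. P a e X) \<longleftrightarrow> (\<exists>a. ?R (case_nat a e) X)"
      unfolding Q2[OF \<open>X \<in> S\<close>] by (simp add: ex2_bounded[where R = "\<lambda>a b. Q (case_nat b (case_nat a e)) X"])
  qed
qed

lemma S1_disj: "S1 P \<Longrightarrow> S1 P' \<Longrightarrow> S1 (\<lambda>e X. P e X \<or> P' e X)"
proof -
  assume "S1 P" "S1 P'"
  then obtain Q Q' where Q: "D0 Q" "\<forall>e. \<forall>X\<in>S. P e X \<longleftrightarrow> (\<exists>a. Q (case_nat a e) X)"
    and Q': "D0 Q'" "\<forall>e. \<forall>X\<in>S. P' e X \<longleftrightarrow> (\<exists>a. Q' (case_nat a e) X)"
    unfolding S1_def by blast
  show ?thesis
    by (rule S1_I[of "\<lambda>e X. Q e X \<or> Q' e X"]) (use Q Q' in \<open>auto intro: dfn\<close>)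
qed

lemma P1_conj: "P1 P \<Longrightarrow> P1 P' \<Longrightarrow> P1 (\<lambda>e X. P e X \<and> P' e X)"
  and P1_disj: "P1 P \<Longrightarrow> P1 P' \<Longrightarrow> P1 (\<lambda>e X. P e X \<or> P' e X)"
  and P1_imp: "S1 R \<Longrightarrow> P1 P' \<Longrightarrow> P1 (\<lambda>e X. R e X \<longrightarrow> P' e X)"
  and S1_imp: "P1 P \<Longrightarrow> S1 R' \<Longrightarrow> S1 (\<lambda>e X. P e X \<longrightarrow> R' e X)"
proof -
  show "P1 P \<Longrightarrow> P1 P' \<Longrightarrow> P1 (\<lambda>e X. P e X \<and> P' e X)"
    unfolding P1_iff_S1 de_Morgan_conj by (rule S1_disj)
  show "P1 P \<Longrightarrow> P1 P' \<Longrightarrow> P1 (\<lambda>e X. P e X \<or> P' e X)"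
    unfolding P1_iff_S1 de_Morgan_disj by (rule S1_conj)
  show "S1 R \<Longrightarrow> P1 P' \<Longrightarrow> P1 (\<lambda>e X. R e X \<longrightarrow> P' e X)"
    unfolding P1_iff_S1 not_imp by (rule S1_conj)
  show "P1 P \<Longrightarrow> S1 R' \<Longrightarrow> S1 (\<lambda>e X. P e X \<longrightarrow> R' e X)"
    unfolding P1_iff_S1 imp_conv_disj by (rule S1_disj)
qed

lemma P1_all: "P1 (\<lambda>e X. P (e 0) (\<lambda>n. e (Suc n)) X) \<Longrightarrow> P1 (\<lambda>e X. \<forall>a. P a e X)"
  unfolding P1_iff_S1 using S1_ex[of "\<lambda>a e X. \<not> P a e X"] by simp

lemma S1_subst: "S1 P \<Longrightarrow> T g \<Longrightarrow> S1 (\<lambda>e X. P (case_nat (g e) e) X)"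
proof -
  assume "S1 P" "T g"
  then have "S1 (\<lambda>e X. \<exists>a. a = g e \<and> P (case_nat a e) X)"
    by (intro S1_ex S1_conj S1_D0[OF D0_eq] T_var T_lift) simp_all
  then show ?thesis by simp
qed

lemma S1_app1: "S1 (\<lambda>e X. R (e 0) X) \<Longrightarrow> T g \<Longrightarrow> S1 (\<lambda>e X. R (g e) X)"
  by (drule (1) S1_subst) simp

lemma S1_app2:
  assumes "S1 (\<lambda>e X. R (e 0) (e 1) X)" "T g" "T h"
  shows "S1 (\<lambda>e X. R (g e) (h e) X)"
  using S1_subst[OF S1_subst[OF assms(1) T_lift[OF assms(2)]] assms(3)] by simp

lemma P1_app2: "P1 (\<lambda>e X. R (e 0) (e 1) X) \<Longrightarrow> T g \<Longrightarrow> T h \<Longrightarrow> P1 (\<lambda>e X. R (g e) (h e) X)"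
  unfolding P1_iff_S1 by (rule S1_app2)

lemma S1_fixX: "S1 P \<Longrightarrow> X0 \<in> S \<Longrightarrow> S1 (\<lambda>e X. P e X0)"
proof -
  assume "S1 P" "X0 \<in> S"
  then obtain Q where Q: "D0 Q" "\<forall>e. \<forall>X\<in>S. P e X \<longleftrightarrow> (\<exists>a. Q (case_nat a e) X)"
    unfolding S1_def by blast
  show ?thesis
    by (rule S1_I[OF D0_fixX[OF Q(1) \<open>X0 \<in> S\<close>]]) (simp add: Q(2) \<open>X0 \<in> S\<close>)
qed

text \<open>By Sigma_1 induction on the initial segment up to \<open>c\<close>, the common bound
  \<open>w\<close> grows by the witness for the new element. The guard \<open>a \<preceq> b\<close>
  stays in the induction statement because witnesses are only known there.\<close>

lemma collection:
  assumes "D0 (\<lambda>e X. R (e 0) (e 1))" "\<And>a. a \<preceq> b \<Longrightarrow> \<exists>u. R u a"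
  shows "\<exists>w. \<forall>a. a \<preceq> b \<longrightarrow> (\<exists>u. u \<preceq> w \<and> R u a)"
proof -
  have "\<exists>w. \<forall>a. a \<preceq> c \<longrightarrow> a \<preceq> b \<longrightarrow> (\<exists>u. u \<preceq> w \<and> R u a)" for c
  proof (rule S1_induct[where P = "\<lambda>c. \<exists>w. \<forall>a. a \<preceq> c \<longrightarrow> a \<preceq> b \<longrightarrow> (\<exists>u. u \<preceq> w \<and> R u a)"])
    show "S1 (\<lambda>e X. \<exists>w. \<forall>a. a \<preceq> e 0 \<longrightarrow> a \<preceq> b \<longrightarrow> (\<exists>u. u \<preceq> w \<and> R u a))"
      by (intro S1_ex_D0 dfn) (use assms(1) in simp)
    show "\<exists>w. \<forall>a. a \<preceq> \<zero> \<longrightarrow> a \<preceq> b \<longrightarrow> (\<exists>u. u \<preceq> w \<and> R u a)"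
      using assms(2)[of \<zero>] by auto
  next
    fix c assume "\<exists>w. \<forall>a. a \<preceq> c \<longrightarrow> a \<preceq> b \<longrightarrow> (\<exists>u. u \<preceq> w \<and> R u a)"
    then obtain w where w: "\<And>a. a \<preceq> c \<Longrightarrow> a \<preceq> b \<Longrightarrow> \<exists>u. u \<preceq> w \<and> R u a" by blast
    show "\<exists>w. \<forall>a. a \<preceq> c \<oplus> \<one> \<longrightarrow> a \<preceq> b \<longrightarrow> (\<exists>u. u \<preceq> w \<and> R u a)"
    proof (cases "c \<oplus> \<one> \<preceq> b")
      case True
      then obtain u where u: "R u (c \<oplus> \<one>)" using assms(2) by blast
      have "\<exists>u'. u' \<preceq> w \<oplus> u \<and> R u' a" if "a \<preceq> c \<oplus> \<one>" "a \<preceq> b" for a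
        using that w[of a] u unfolding le_def[of a "c \<oplus> \<one>"] less_succ
        using le_add1 ord.order_trans by metis
      then show ?thesis by blast
    next
      case False
      then show ?thesis using w less_succ le_def by metis
    qed
  qed
  from this[of b] show ?thesis by blast
qed

text \<open>Collection moves the unbounded witness, as a common bound, in front of the bounded
  quantifier. The analogue for \<open>S2\<close> is shown only under arithmetical comprehension, in
  \<open>ACA_S2_ball_le\<close>.\<close>

lemma S1_ball_le:
  assumes "T g" "S1 (\<lambda>e X. P (e 0) (\<lambda>n. e (Suc n)) X)"
  shows "S1 (\<lambda>e X. \<forall>a. a \<preceq> g e \<longrightarrow> P a e X)"
proof -
  obtain Q where Q: "D0 Q" "\<forall>e. \<forall>X\<in>S. P (e 0) (\<lambda>n. e (Suc n)) X \<longleftrightarrow> (\<exists>b. Q (case_nat b e) X)"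
    using assms(2) unfolding S1_def by blast
  have Q2: "P a e X \<longleftrightarrow> (\<exists>b. Q (case_nat b (case_nat a e)) X)" if "X \<in> S" for a e X
    using Q(2)[rule_format, OF that, of "case_nat a e"] by simp
  let ?R = "\<lambda>e X. \<forall>a. a \<preceq> g (\<lambda>n. e (Suc n)) \<longrightarrow> (\<exists>b. b \<preceq> e 0 \<and> Q (case_nat b (case_nat a (\<lambda>n. e (Suc n)))) X)"
  have "D0 ?R"
    using D0_skip2[OF Q(1)] by (intro dfn T_lift assms(1)) simp
  then show ?thesis
  proof (rule S1_I)
    fix e X assume X: "X \<in> S"
    have "D0 (\<lambda>e' X'. Q (case_nat (e' 0) (case_nat (e' 1) e)) X)"
      by (rule D0_fix2[OF Q(1) X])
    then have "D0 (\<lambda>e' X'. (\<lambda>u a. Q (case_nat u (case_nat a e)) X) (e' 0) (e' 1))"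
      by simp
    from collection[OF this, of "g e"]
    show "(\<forall>a. a \<preceq> g e \<longrightarrow> P a e X) \<longleftrightarrow> (\<exists>a. ?R (case_nat a e) X)"
      unfolding Q2[OF X] by auto
  qed
qed

lemma P1_ball_le: "T g \<Longrightarrow> P1 (\<lambda>e X. P (e 0) (\<lambda>n. e (Suc n)) X) \<Longrightarrow> P1 (\<lambda>e X. \<forall>a. a \<preceq> g e \<longrightarrow> P a e X)"
  by (intro P1_all P1_imp S1_D0[OF D0_le] T_var T_lift) simp_all

lemma P1_bex_le: "T g \<Longrightarrow> P1 (\<lambda>e X. P (e 0) (\<lambda>n. e (Suc n)) X) \<Longrightarrow> P1 (\<lambda>e X. \<exists>a. a \<preceq> g e \<and> P a e X)"
  unfolding P1_iff_S1 using S1_ball_le[of g "\<lambda>a e X. \<not> P a e X"] by simp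

lemma S2_P1: "P1 P \<Longrightarrow> S2 P"
proof -
  assume "P1 P"
  then obtain Q where Q: "D0 Q" "\<forall>e. \<forall>X\<in>S. P e X \<longleftrightarrow> (\<forall>a. Q (case_nat a e) X)"
    unfolding P1_def by blast
  show ?thesis
    by (rule S2_I[OF D0_skip1[OF Q(1)]]) (simp add: Q(2))
qed

lemma S2_ex_P1:
  assumes "P1 (\<lambda>e X. P (e 0) (\<lambda>n. e (Suc n)) X)"
  shows "S2 (\<lambda>e X. \<exists>a. P a e X)"
proof -
  obtain Q where Q: "D0 Q" "\<forall>e. \<forall>X\<in>S. P (e 0) (\<lambda>n. e (Suc n)) X \<longleftrightarrow> (\<forall>b. Q (case_nat b e) X)"
    using assms unfolding P1_def by blast
  show ?thesis
  proof (rule S2_I[OF Q(1)])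
    fix e X assume "X \<in> S"
    then show "(\<exists>a. P a e X) \<longleftrightarrow> (\<exists>u. \<forall>v. Q (case_nat v (case_nat u e)) X)"
      using Q(2)[rule_format, of X "case_nat u e" for u] by simp
  qed
qed

lemma S2_D_P1:
  assumes "S2 P"
  shows "\<exists>R. P1 R \<and> (\<forall>e. \<forall>X\<in>S. P e X \<longleftrightarrow> (\<exists>u. R (case_nat u e) X))"
proof -
  obtain Q where Q: "D0 Q" "\<forall>e. \<forall>X\<in>S. P e X \<longleftrightarrow> (\<exists>u. \<forall>v. Q (case_nat v (case_nat u e)) X)"
    using assms unfolding S2_def by blast
  have "P1 (\<lambda>e X. \<forall>v. Q (case_nat v e) X)"
    by (rule P1_all_D0) (simp add: Q(1))
  then show ?thesis by (rule exI[of _ "\<lambda>e X. \<forall>v. Q (case_nat v e) X", OF conjI]) (use Q(2) in simp)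
qed

lemma S2_S1: "S1 P \<Longrightarrow> S2 P"
proof -
  assume "S1 P"
  then obtain Q where Q: "D0 Q" "\<forall>e. \<forall>X\<in>S. P e X \<longleftrightarrow> (\<exists>a. Q (case_nat a e) X)"
    unfolding S1_def by blast
  have "S2 (\<lambda>e X. \<exists>a. Q (case_nat a e) X)"
    by (rule S2_ex_P1, rule P1_D0) (simp add: Q(1))
  then show ?thesis by (rule S2_cong) (simp add: Q(2))
qed

lemma S2_D0: "D0 P \<Longrightarrow> S2 P"
  by (intro S2_S1 S1_D0)

text \<open>A common bound would not do here, as witnesses chosen after \<open>\<forall>v\<close>
  might depend on \<open>v\<close>. The equation with \<open>y\<close> fixes them independently of
  \<open>v\<close>, while the decoding quantifiers are bounded and may stand inside the
  matrix.\<close>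

lemma ex_all_pairing:
  "(\<exists>a u. \<forall>v. R v u a) \<longleftrightarrow> (\<exists>y. \<forall>v. \<exists>a. a \<preceq> y \<and> (\<exists>u. u \<preceq> y \<and> (y = pair a u \<and> R v u a)))"
proof
  assume "\<exists>a u. \<forall>v. R v u a"
  then obtain a u where R: "\<forall>v. R v u a" by (elim exE)
  show "\<exists>y. \<forall>v. \<exists>a. a \<preceq> y \<and> (\<exists>u. u \<preceq> y \<and> (y = pair a u \<and> R v u a))"
    by (rule exI[of _ "pair a u"], intro allI exI[of _ a] exI[of _ u] conjI) (simp_all add: le_pair R)
next
  assume "\<exists>y. \<forall>v. \<exists>a. a \<preceq> y \<and> (\<exists>u. u \<preceq> y \<and> (y = pair a u \<and> R v u a))"
  then obtain y where y: "\<forall>v. \<exists>a. a \<preceq> y \<and> (\<exists>u. u \<preceq> y \<and> (y = pair a u \<and> R v u a))" by (elim exE)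
  from spec[OF y, of undefined] obtain a u where au: "y = pair a u" by (elim exE conjE)
  have "R v u a" for v
    using spec[OF y, of v] by (auto simp: au)
  then have "\<forall>v. R v u a" by (rule allI)
  then show "\<exists>a u. \<forall>v. R v u a" by (intro exI)
qed

lemma S2_ex:
  assumes "S2 (\<lambda>e X. P (e 0) (\<lambda>n. e (Suc n)) X)"
  shows "S2 (\<lambda>e X. \<exists>a. P a e X)"
proof -
  obtain Q where Q: "D0 Q" "\<forall>e. \<forall>X\<in>S. P (e 0) (\<lambda>n. e (Suc n)) X \<longleftrightarrow> (\<exists>u. \<forall>v. Q (case_nat v (case_nat u e)) X)"
    using assms unfolding S2_def by blast
  have Q2: "P a e X \<longleftrightarrow> (\<exists>u. \<forall>v. Q (case_nat v (case_nat u (case_nat a e))) X)" if "X \<in> S" for a e X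
    using Q(2)[rule_format, OF that, of "case_nat a e"] by simp
  let ?R = "\<lambda>e X. \<exists>a. a \<preceq> e 1 \<and> (\<exists>u. u \<preceq> e 1 \<and> (e 1 = pair a u \<and>
    Q (case_nat (e 0) (case_nat u (case_nat a (\<lambda>n. e (Suc (Suc n)))))) X))"
  \<comment> \<open>Under the two bounded quantifiers of \<open>?R\<close> the arguments read u, a,
    v, y and then the rest, while \<open>Q\<close> expects v, u, a and then the rest.\<close>
  let ?\<pi> = "case_nat 2 (case_nat 0 (case_nat 1 (\<lambda>n. Suc (Suc (Suc (Suc n))))))"
  have "D0 (\<lambda>e X. Q (\<lambda>n. e (?\<pi> n)) X)"
    by (rule D0_reindex[OF Q(1)]) (auto simp: inj_def split: nat.splits)
  moreover have "(\<lambda>n. e (?\<pi> n)) = case_nat (e 2) (case_nat (e 0) (case_nat (e 1) (\<lambda>n. e (Suc (Suc (Suc (Suc n)))))))" for e :: "nat \<Rightarrow> 'm"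
    by (simp add: fun_eq_iff split: nat.splits)
  ultimately have "D0 (\<lambda>e X. Q (case_nat (e 2) (case_nat (e 0) (case_nat (e 1) (\<lambda>n. e (Suc (Suc (Suc (Suc n)))))))) X)"
    by (simp only:)
  then have "D0 ?R"
    by (intro dfn) (simp add: numeral_eq_Suc)
  then show ?thesis
  proof (rule S2_I)
    fix e X assume "X \<in> S"
    show "(\<exists>a. P a e X) \<longleftrightarrow> (\<exists>y. \<forall>v. ?R (case_nat v (case_nat y e)) X)"
      unfolding Q2[OF \<open>X \<in> S\<close>] ex_all_pairing by simp
  qed
qed

lemma P1_skip1: "P1 P \<Longrightarrow> P1 (\<lambda>e X. P (case_nat (e 0) (\<lambda>n. e (Suc (Suc n)))) X)"
proof -
  assume "P1 P"
  then obtain Q where Q: "D0 Q" "\<forall>e. \<forall>X\<in>S. P e X \<longleftrightarrow> (\<forall>a. Q (case_nat a e) X)"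
    unfolding P1_def by blast
  show ?thesis
    by (rule P1_I[OF D0_skip2[OF Q(1)]]) (simp add: Q(2))
qed

lemma P1_lift: "P1 P \<Longrightarrow> P1 (\<lambda>e X. P (\<lambda>n. e (Suc n)) X)"
proof -
  assume "P1 P"
  then obtain Q where Q: "D0 Q" "\<forall>e. \<forall>X\<in>S. P e X \<longleftrightarrow> (\<forall>a. Q (case_nat a e) X)"
    unfolding P1_def by blast
  show ?thesis
    by (rule P1_I[OF D0_skip1[OF Q(1)]]) (simp add: Q(2))
qed

lemma case_nat_eta_Suc [simp]: "case_nat (e (Suc 0)) (\<lambda>n. e (Suc (Suc n))) = (\<lambda>n. e (Suc n))"
  by (rule case_nat_eta[of "\<lambda>n. e (Suc n)"])

lemma S2_conj: "S2 P \<Longrightarrow> S2 P' \<Longrightarrow> S2 (\<lambda>e X. P e X \<and> P' e X)"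
  and S2_disj: "S2 P \<Longrightarrow> S2 P' \<Longrightarrow> S2 (\<lambda>e X. P e X \<or> P' e X)"
proof -
  assume "S2 P" "S2 P'"
  from S2_D_P1[OF this(1)] S2_D_P1[OF this(2)] obtain Q Q' where Q: "P1 Q" "\<forall>e. \<forall>X\<in>S. P e X \<longleftrightarrow> (\<exists>a. Q (case_nat a e) X)"
    and Q': "P1 Q'" "\<forall>e. \<forall>X\<in>S. P' e X \<longleftrightarrow> (\<exists>a. Q' (case_nat a e) X)"
    by (elim exE conjE)
  have "S2 (\<lambda>e X. \<exists>a b. Q (case_nat a e) X \<and> Q' (case_nat b e) X)"
    by (rule S2_ex, rule S2_ex_P1, rule P1_conj) (use P1_lift[OF Q(1)] P1_skip1[OF Q'(1)] in simp_all)
  then show "S2 (\<lambda>e X. P e X \<and> P' e X)"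
    by (rule S2_cong) (simp add: Q(2) Q'(2))
  have "S2 (\<lambda>e X. \<exists>a. Q (case_nat a e) X \<or> Q' (case_nat a e) X)"
    by (rule S2_ex_P1, rule P1_disj) (use Q(1) Q'(1) in simp_all)
  then show "S2 (\<lambda>e X. P e X \<or> P' e X)"
    by (rule S2_cong) (auto simp add: Q(2) Q'(2))
qed

lemma S2_subst: "S2 P \<Longrightarrow> T g \<Longrightarrow> S2 (\<lambda>e X. P (case_nat (g e) e) X)"
proof -
  assume "S2 P" "T g"
  then have "S2 (\<lambda>e X. \<exists>a. a = g e \<and> P (case_nat a e) X)"
    by (intro S2_ex S2_conj S2_D0[OF D0_eq] T_var T_lift) simp_all
  then show ?thesis by simp
qed

lemma S2_app2:
  assumes "S2 (\<lambda>e X. R (e 0) (e 1) X)" "T g" "T h"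
  shows "S2 (\<lambda>e X. R (g e) (h e) X)"
  using S2_subst[OF S2_subst[OF assms(1) T_lift[OF assms(2)]] assms(3)] by simp

section \<open>Least number principles\<close>

text \<open>Counting down from a counterexample \<open>a\<close> is a Sigma_1 induction: some
  \<open>d\<close> with \<open>b \<oplus> d = a\<close> violates \<open>P\<close>, and by
  \<open>zero\<close> and \<open>succ\<close> its predecessor does as well. At \<open>b = a\<close>
  this contradicts \<open>zero\<close>.\<close>

lemma P1_induct:
  assumes P1: "P1 (\<lambda>e X. P (e 0))" and zero: "P \<zero>" and succ: "\<And>a. P a \<Longrightarrow> P (a \<oplus> \<one>)"
  shows "P a"
proof (rule ccontr)
  assume a: "\<not> P a"
  have "\<exists>d. b \<preceq> a \<longrightarrow> b \<oplus> d = a \<and> \<not> P d" for b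
  proof (rule S1_induct[where P = "\<lambda>b. \<exists>d. b \<preceq> a \<longrightarrow> b \<oplus> d = a \<and> \<not> P d"])
    show "S1 (\<lambda>e X. \<exists>d. e 0 \<preceq> a \<longrightarrow> e 0 \<oplus> d = a \<and> \<not> P d)"
      by (rule S1_ex, rule S1_imp, rule P1_D0, intro dfn, rule S1_conj, rule S1_D0, intro dfn,
          rule S1_neg, rule P1)
    show "\<exists>d. \<zero> \<preceq> a \<longrightarrow> \<zero> \<oplus> d = a \<and> \<not> P d"
      using a by (auto simp: zero_add)
  next
    fix b assume IH: "\<exists>d. b \<preceq> a \<longrightarrow> b \<oplus> d = a \<and> \<not> P d"
    show "\<exists>d. b \<oplus> \<one> \<preceq> a \<longrightarrow> b \<oplus> \<one> \<oplus> d = a \<and> \<not> P d"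
    proof (cases "b \<oplus> \<one> \<preceq> a")
      case True
      then have "b \<preceq> a" using succ_le_iff le_def by blast
      with IH obtain d where d: "b \<oplus> d = a" "\<not> P d" by blast
        then obtain c where c: "d = c \<oplus> \<one>" using zero zero_or_succ[of d] by auto
      then have "b \<oplus> \<one> \<oplus> c = a"
        using d by (simp add: add_succ succ_add)
      moreover have "\<not> P c" using succ c d by blast
      ultimately show ?thesis by blast
    qed blast
  qed
  from this[of a] obtain d where "a \<oplus> d = a" "\<not> P d" by (auto simp: le_def)
  then have "d = \<zero>" using add_cancel[of d a \<zero>] by (simp add: sr.add.commute zero_add)
  with zero \<open>\<not> P d\<close> show False by simp
qed

text \<open>Without a least element, \<open>P\<close> would fail on ever longer initial segments.
  That statement is Pi_1.\<close>

lemma S1_least: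
  assumes "S1 (\<lambda>e X. P (e 0))" "P a"
  shows "\<exists>m. P m \<and> (\<forall>b. b \<prec> m \<longrightarrow> \<not> P b)"
proof (rule ccontr)
  assume no: "\<not> ?thesis"
  have "\<forall>b. b \<preceq> c \<longrightarrow> \<not> P b" for c
  proof (rule P1_induct[where P = "\<lambda>c. \<forall>b. b \<preceq> c \<longrightarrow> \<not> P b"])
    show "P1 (\<lambda>e X. \<forall>b. b \<preceq> e 0 \<longrightarrow> \<not> P b)"
      by (rule P1_ball_le, rule T_var, rule P1_neg, rule assms)
    show "\<forall>b. b \<preceq> \<zero> \<longrightarrow> \<not> P b" using no not_less_zero by auto
    show "\<forall>b. b \<preceq> c \<oplus> \<one> \<longrightarrow> \<not> P b" if "\<forall>b. b \<preceq> c \<longrightarrow> \<not> P b" for c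
      using that no less_succ le_def by metis
  qed
  with \<open>P a\<close> show False using ord.order_refl by blast
qed

text \<open>Here failure on an initial segment is Sigma_1, thanks to collection, so the induction
  axiom applies.\<close>

lemma P1_least:
  assumes "P1 (\<lambda>e X. P (e 0))" "P a"
  shows "\<exists>m. P m \<and> (\<forall>b. b \<prec> m \<longrightarrow> \<not> P b)"
proof (rule ccontr)
  assume no: "\<not> ?thesis"
  have "\<forall>b. b \<preceq> c \<longrightarrow> \<not> P b" for c
  proof (rule S1_induct[where P = "\<lambda>c. \<forall>b. b \<preceq> c \<longrightarrow> \<not> P b"])
    show "S1 (\<lambda>e X. \<forall>b. b \<preceq> e 0 \<longrightarrow> \<not> P b)"
      by (rule S1_ball_le, rule T_var, rule S1_neg, rule assms)
    show "\<forall>b. b \<preceq> \<zero> \<longrightarrow> \<not> P b" using no not_less_zero by auto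
    show "\<forall>b. b \<preceq> c \<oplus> \<one> \<longrightarrow> \<not> P b" if "\<forall>b. b \<preceq> c \<longrightarrow> \<not> P b" for c
      using that no less_succ le_def by metis
  qed
  with \<open>P a\<close> show False using ord.order_refl by blast
qed

lemmas D0_least = S1_least[OF S1_D0]

text \<open>The least number principle is applied to the distance \<open>d\<close> between a
  solution and the bound \<open>b\<close>.\<close>

lemma D0_greatest:
  assumes "D0 (\<lambda>e X. P (e 0))" "P a" "a \<preceq> b"
  shows "\<exists>m. m \<preceq> b \<and> P m \<and> (\<forall>c. m \<prec> c \<longrightarrow> c \<preceq> b \<longrightarrow> \<not> P c)"
proof -
  obtain d0 where "a \<oplus> d0 = b" using \<open>a \<preceq> b\<close> unfolding le_iff_add by blast
  let ?R = "\<lambda>d. \<exists>m. m \<preceq> b \<and> (m \<oplus> d = b \<and> P m)"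
  have "D0 (\<lambda>e X. ?R (e 0))"
    by (intro dfn) (use assms(1) in simp)
  moreover have "?R d0" using \<open>a \<oplus> d0 = b\<close> assms by blast
  ultimately obtain d where "?R d" and least: "\<forall>d'. d' \<prec> d \<longrightarrow> \<not> ?R d'"
    using D0_least[where P = ?R] by (elim exE conjE) blast
  then obtain m where m: "m \<preceq> b" "m \<oplus> d = b" "P m" by blast
  have "\<not> P c" if "m \<prec> c" "c \<preceq> b" for c
  proof
    note c = that
    assume "P c"
    obtain x y where x: "m \<oplus> (x \<oplus> \<one>) = c" and y: "c \<oplus> y = b"
      using c(1)[unfolded less_iff_add] c(2)[unfolded le_iff_add] by (elim exE)
    then have "d \<oplus> m = (y \<oplus> (x \<oplus> \<one>)) \<oplus> m"
      using m(2) by (metis sr.add.assoc sr.add.commute)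
    then have "d = y \<oplus> (x \<oplus> \<one>)" by (rule add_cancel)
    then have "y \<prec> d" unfolding less_iff_add by blast
    with least \<open>P c\<close> y \<open>c \<preceq> b\<close> show False by blast
  qed
  with m show ?thesis by blast
qed

section \<open>Elements of an infinite set\<close>

abbreviation Inf where "Inf \<equiv> infinite_sets M"

definition first where "first x X \<longleftrightarrow> x \<in> X \<and> (\<forall>y. y \<prec> x \<longrightarrow> y \<notin> X)"
definition nxt where "nxt X x y \<longleftrightarrow> x \<in> X \<and> y \<in> X \<and> x \<prec> y \<and> (\<forall>z. z \<prec> y \<longrightarrow> z \<in> X \<longrightarrow> z \<preceq> x)"
text \<open>Repeatedly deleting least elements of \<open>X\<close> leads to its tails, each named by
  its least element. Statements about iterates of \<open>drop_least\<close> can thus quantify over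
  numbers instead of sets.\<close>

definition tail where "tail a X = {z \<in> X. a \<preceq> z}"

lemma D0_first [dfn]: "T g \<Longrightarrow> D0 (\<lambda>e X. first (g e) X)"
  unfolding first_def by (intro dfn)

lemma D0_nxt [dfn]: "T g \<Longrightarrow> T h \<Longrightarrow> D0 (\<lambda>e X. nxt X (g e) (h e))"
  unfolding nxt_def by (intro dfn T_lift)

lemma D0_first_const [dfn]: "T g \<Longrightarrow> A \<in> S \<Longrightarrow> D0 (\<lambda>e X. first (g e) A)"
  unfolding first_def by (intro dfn)

lemma D0_nxt_const [dfn]: "T g \<Longrightarrow> T h \<Longrightarrow> A \<in> S \<Longrightarrow> D0 (\<lambda>e X. nxt A (g e) (h e))"
  unfolding nxt_def by (intro dfn T_lift)

lemma Inf_S: "X \<in> Inf \<Longrightarrow> X \<in> S"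
  and Inf_ex: "X \<in> Inf \<Longrightarrow> \<exists>b\<in>X. a \<prec> b"
  by (simp_all add: infinite_sets_def)

lemma tail_S: "X \<in> S \<Longrightarrow> tail a X \<in> S"
  unfolding tail_def by (intro D0_comprehension dfn)

lemma tail_Inf: "X \<in> Inf \<Longrightarrow> tail a X \<in> Inf"
proof -
  assume X: "X \<in> Inf"
  have "\<exists>c\<in>tail a X. b \<prec> c" for b
  proof -
    obtain c where "c \<in> X" "a \<oplus> b \<prec> c" using Inf_ex[OF X] by blast
    then have "a \<preceq> c" "b \<prec> c"
      using ord.le_less_trans[OF le_add1(1)[of a b]] ord.le_less_trans[OF le_add1(2)[of b a]]
      by (auto simp: le_def)
    with \<open>c \<in> X\<close> show ?thesis unfolding tail_def by blast
  qed
  then show ?thesis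
    using tail_S[OF Inf_S[OF X]] unfolding infinite_sets_def by blast
qed

lemma ex_first: "X \<in> S \<Longrightarrow> a \<in> X \<Longrightarrow> \<exists>x. first x X"
  unfolding first_def by (rule D0_least) (intro dfn)

lemma first_unique: "first x X \<Longrightarrow> first y X \<Longrightarrow> x = y"
  unfolding first_def using less_linear by blast

lemma first_le: "first x X \<Longrightarrow> y \<in> X \<Longrightarrow> x \<preceq> y"
  unfolding first_def le_def using less_linear by blast

lemma ex_nxt:
  assumes "X \<in> Inf" "x \<in> X"
  shows "\<exists>y. nxt X x y"
proof -
  obtain b where b: "b \<in> X \<and> x \<prec> b" using Inf_ex[OF assms(1)] by blast
  have "D0 (\<lambda>e X'. e 0 \<in> X \<and> x \<prec> e 0)"
    using Inf_S[OF assms(1)] by (intro dfn)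
  from D0_least[where P = "\<lambda>y. y \<in> X \<and> x \<prec> y", OF this b]
  show ?thesis
    unfolding nxt_def using assms(2) less_linear le_def by blast
qed

lemma ex_prev:
  assumes "X \<in> S" "y \<in> X" "\<not> first y X"
  shows "\<exists>x. nxt X x y"
proof -
  obtain a where a: "a \<in> X \<and> a \<prec> y"
    using assms(2,3) unfolding first_def by blast
  have "D0 (\<lambda>e X'. e 0 \<in> X \<and> e 0 \<prec> y)"
    using assms(1) by (intro dfn)
  from D0_greatest[where P = "\<lambda>x. x \<in> X \<and> x \<prec> y", OF this a, of y] a
  obtain m where "m \<in> X" "m \<prec> y" "\<forall>c. m \<prec> c \<longrightarrow> c \<preceq> y \<longrightarrow> \<not> (c \<in> X \<and> c \<prec> y)"
    by (auto simp: le_def)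
  then have "nxt X m y"
    unfolding nxt_def using assms(2) less_linear le_def by blast
  then show ?thesis by blast
qed

lemma nxt_unique: "nxt X x y \<Longrightarrow> nxt X x z \<Longrightarrow> y = z"
  unfolding nxt_def le_def using less_linear less_trans less_irrefl by metis

lemma nxtD: "nxt X x y \<Longrightarrow> x \<in> X" "nxt X x y \<Longrightarrow> y \<in> X" "nxt X x y \<Longrightarrow> x \<prec> y"
  "nxt X x y \<Longrightarrow> z \<in> X \<Longrightarrow> x \<prec> z \<Longrightarrow> y \<preceq> z"
  unfolding nxt_def le_def using less_linear less_trans less_irrefl by metis+

lemma nxt_tail: "nxt (tail a X) x y \<longleftrightarrow> a \<preceq> x \<and> nxt X x y"
proof
  assume "nxt (tail a X) x y"
  then show "a \<preceq> x \<and> nxt X x y"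
    unfolding nxt_def tail_def using ord.le_less_trans ord.le_less_linear ord.less_imp_le
    by (metis (no_types, lifting) mem_Collect_eq ord.order_trans)
next
  assume "a \<preceq> x \<and> nxt X x y"
  then show "nxt (tail a X) x y"
    unfolding nxt_def tail_def using ord.less_imp_le ord.order_trans by blast
qed

lemma first_tail: "a \<in> X \<Longrightarrow> first x (tail a X) \<longleftrightarrow> x = a"
  unfolding first_def tail_def using ord.leD ord.le_less_linear ord.order_refl ord.less_le by (metis (no_types, lifting) mem_Collect_eq)

lemma tail_tail: "a \<preceq> b \<Longrightarrow> tail b (tail a X) = tail b X"
  unfolding tail_def using ord.order_trans by auto

lemma drop_least_tail:
  assumes "first x X" "nxt X x y"
  shows "drop_least M X = tail y X"
proof -
  have "(\<forall>b\<in>X. \<not> b \<prec> a) \<longleftrightarrow> a = x" if "a \<in> X" for a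
    using first_unique[OF assms(1), of a] assms(1) that by (auto simp: first_def)
  then have "drop_least M X = X - {x}"
    using assms(1) by (auto simp: drop_least_def first_def)
  moreover have "z \<noteq> x \<longleftrightarrow> y \<preceq> z" if "z \<in> X" for z
  proof
    assume "z \<noteq> x"
    then have "x \<prec> z" using first_le[OF assms(1) that] by (simp add: le_def)
    then show "y \<preceq> z" by (rule nxtD(4)[OF assms(2) that])
  next
    assume "y \<preceq> z"
    with nxtD(3)[OF assms(2)] have "x \<prec> z" by (rule ord.less_le_trans)
    then show "z \<noteq> x" using less_irrefl by auto
  qed
  then have "X - {x} = tail y X" by (auto simp: tail_def)
  ultimately show ?thesis by simp
qed

section \<open>Codes for bounded sets\<close>

text \<open>
  As in the proof of the \<open>\<beta>\<close>-lemma, the numbers \<open>m (i + 1) + 1\<close> are pairwise coprime for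
  \<open>i \<le> b\<close> if \<open>m\<close> is divisible by all positive \<open>d \<le> b\<close>.
\<close>

definition cod where "cod m p i \<longleftrightarrow> (\<exists>k. k \<preceq> p \<and> (m \<otimes> (i \<oplus> \<one>) \<oplus> \<one>) \<otimes> k = p)"

lemma D0_cod [dfn]: "T g \<Longrightarrow> T h \<Longrightarrow> T k \<Longrightarrow> D0 (\<lambda>e X. cod (g e) (h e) (k e))"
  unfolding cod_def by (intro dfn T_lift)

definition dv where "dv u p \<longleftrightarrow> (\<exists>k. u \<otimes> k = p)"

lemma dv_mult: "dv u p \<Longrightarrow> dv u (p \<otimes> q)"
  unfolding dv_def by (metis mul_assoc)

lemma dv_mult2: "dv u (p \<otimes> u)"
  unfolding dv_def by (metis mul_commute)

text \<open>In place of a subtraction the two quotients are compared: if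
  \<open>l \<preceq> k\<close>, then \<open>x\<close> can only be zero.\<close>

lemma dv_cancel:
  assumes "dv u a" "dv u (a \<oplus> x)"
  shows "dv u x"
proof -
  obtain k l where k: "u \<otimes> k = a" and l: "u \<otimes> l = a \<oplus> x" using assms unfolding dv_def by auto
  show ?thesis
  proof (cases "k \<preceq> l")
    case True
    then obtain j where "k \<oplus> j = l" unfolding le_iff_add by auto
    then have "a \<oplus> u \<otimes> j = a \<oplus> x" using k l sr.distrib_left by metis
    then have "u \<otimes> j = x" using add_cancel[of "u \<otimes> j" a x] by (simp add: add_commute)
    then show ?thesis unfolding dv_def by auto
  next
    case False
    then have "l \<preceq> k" using ord.linear by auto
    then have "a \<oplus> x \<preceq> a" using mul_mono[OF ord.order_refl, of l k u] k l by simp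
    then have "a \<oplus> x = a" using le_add1(1)[of a x] ord.order_antisym by simp
    then have "x = \<zero>" using add_cancel[of x a \<zero>] by (simp add: add_commute zero_add)
    then show ?thesis unfolding dv_def using mul_zero[of u] by (intro exI[of _ \<zero>]) simp
  qed
qed

text \<open>The modulus is coprime to \<open>m\<close>: \<open>x\<close> is the difference between
  \<open>x\<close> times the modulus and a multiple of \<open>x \<otimes> m\<close>.\<close>

lemma dv_modulus:
  assumes "dv (m \<otimes> (i \<oplus> \<one>) \<oplus> \<one>) (x \<otimes> m)"
  shows "dv (m \<otimes> (i \<oplus> \<one>) \<oplus> \<one>) x"
proof (rule dv_cancel)
  show "dv (m \<otimes> (i \<oplus> \<one>) \<oplus> \<one>) (x \<otimes> m \<otimes> (i \<oplus> \<one>))"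
    by (rule dv_mult[OF assms])
  have "x \<otimes> (m \<otimes> (i \<oplus> \<one>) \<oplus> \<one>) = x \<otimes> m \<otimes> (i \<oplus> \<one>) \<oplus> x"
    by (simp only: mul_succ[of x "m \<otimes> (i \<oplus> \<one>)"] mul_assoc)
  then show "dv (m \<otimes> (i \<oplus> \<one>) \<oplus> \<one>) (x \<otimes> m \<otimes> (i \<oplus> \<one>) \<oplus> x)"
    using dv_mult2[of "m \<otimes> (i \<oplus> \<one>) \<oplus> \<one>" x] by simp
qed

text \<open>As the modulus is a successor, the quotient is at most the product. This permits the
  bounded quantifier in \<open>cod\<close>.\<close>

lemma cod_dv: "cod m p i \<longleftrightarrow> dv (m \<otimes> (i \<oplus> \<one>) \<oplus> \<one>) p"
proof
  assume "dv (m \<otimes> (i \<oplus> \<one>) \<oplus> \<one>) p"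
  then obtain k where k: "(m \<otimes> (i \<oplus> \<one>) \<oplus> \<one>) \<otimes> k = p" unfolding dv_def by auto
  have "k \<preceq> (m \<otimes> (i \<oplus> \<one>) \<oplus> \<one>) \<otimes> k"
    unfolding succ_mul[of "m \<otimes> (i \<oplus> \<one>)" k] by simp
  with k show "cod m p i" unfolding cod_def by auto
qed (auto simp: cod_def dv_def)

text \<open>In effect \<open>m\<close> is the factorial of \<open>b\<close>, since each step
  multiplies by \<open>b \<oplus> \<one>\<close>. Bounding the quotients by \<open>m\<close> makes
  the induction statement Sigma_1.\<close>

lemma ex_modulus: "\<exists>m. m \<noteq> \<zero> \<and> (\<forall>d. d \<preceq> b \<longrightarrow> d \<noteq> \<zero> \<longrightarrow> dv d m)"
proof -
  let ?P = "\<lambda>b. \<exists>m. m \<noteq> \<zero> \<and> (\<forall>d. d \<preceq> b \<longrightarrow> d \<noteq> \<zero> \<longrightarrow> (\<exists>k. k \<preceq> m \<and> d \<otimes> k = m))"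
  have "?P b"
  proof (rule S1_induct[where P = ?P])
    show "S1 (\<lambda>e X. ?P (e 0))"
      by (rule S1_ex_D0) (intro dfn T_lift)
    show "?P \<zero>" by (intro exI[of _ \<one>]) simp
  next
    fix b assume "?P b"
    then obtain m where m: "m \<noteq> \<zero>" "\<forall>d. d \<preceq> b \<longrightarrow> d \<noteq> \<zero> \<longrightarrow> (\<exists>k. k \<preceq> m \<and> d \<otimes> k = m)" by (elim exE conjE)
    have le: "x \<preceq> x \<otimes> (c \<oplus> \<one>)" for x c unfolding mul_succ by simp
    have "m \<otimes> (b \<oplus> \<one>) \<noteq> \<zero>" using le[of m b] m(1) by (metis le_zero_iff)
    moreover have "\<exists>k. k \<preceq> m \<otimes> (b \<oplus> \<one>) \<and> d \<otimes> k = m \<otimes> (b \<oplus> \<one>)" if d: "d \<preceq> b \<oplus> \<one>" "d \<noteq> \<zero>" for d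
    proof (cases "d = b \<oplus> \<one>")
      case True
      then show ?thesis using le[of m b] by (intro exI[of _ m]) (simp add: mul_commute)
    next
      case False
      then have "d \<preceq> b" using d(1) less_succ unfolding le_def[of d "b \<oplus> \<one>"] by simp
      then obtain k where k: "k \<preceq> m" "d \<otimes> k = m" using m(2) d(2) by auto
      then show ?thesis
        by (intro exI[of _ "k \<otimes> (b \<oplus> \<one>)"] conjI mul_mono) (simp_all add: mul_assoc[symmetric])
    qed
    ultimately show "?P (b \<oplus> \<one>)" by (intro exI[of _ "m \<otimes> (b \<oplus> \<one>)"]) simp
  qed
  then obtain m where "m \<noteq> \<zero>" "\<forall>d. d \<preceq> b \<longrightarrow> d \<noteq> \<zero> \<longrightarrow> (\<exists>k. k \<preceq> m \<and> d \<otimes> k = m)" by (elim exE conjE)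
  then show ?thesis unfolding dv_def by (intro exI[of _ m]) auto
qed

text \<open>The empty product codes the empty set, with which the construction of codes
  starts.\<close>

lemma cod_one: "m \<noteq> \<zero> \<Longrightarrow> \<not> cod m \<one> i"
proof
  assume m: "m \<noteq> \<zero>" and "cod m \<one> i"
  then obtain k where k: "(m \<otimes> (i \<oplus> \<one>) \<oplus> \<one>) \<otimes> k = \<one>" unfolding cod_def by auto
  have "k \<noteq> \<zero>" using k sr.zero_neq_one by (auto simp: mul_zero)
  then obtain l where l: "k = l \<oplus> \<one>" using zero_or_succ[of k] by auto
  have "m \<otimes> (i \<oplus> \<one>) \<oplus> \<one> \<preceq> \<zero> \<oplus> \<one>"
    using k le_add1(2) unfolding l mul_succ[of _ l] zero_add by metis
  then have "m \<otimes> (i \<oplus> \<one>) \<preceq> \<zero>"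
    unfolding succ_le_iff less_succ .
  then have "m \<otimes> i \<oplus> m = \<zero>" by (simp add: mul_succ)
  with m show False using le_add1(2)[of m "m \<otimes> i"] by simp
qed

text \<open>Two moduli differ by \<open>m \<otimes> d\<close>, where \<open>d\<close> is the
  distance of the indices. If the modulus of \<open>i\<close> divides \<open>p\<close> times that of
  \<open>a\<close>, it divides \<open>p \<otimes> (m \<otimes> d)\<close>. Then \<open>m\<close> can
  be cancelled, \<open>d\<close> is replaced by its multiple \<open>m\<close>, and this is cancelled
  again.\<close>

lemma cod_insert:
  assumes m: "\<forall>d. d \<preceq> b \<longrightarrow> d \<noteq> \<zero> \<longrightarrow> dv d m" and "a \<preceq> b" "i \<preceq> b"
  shows "cod m (p \<otimes> (m \<otimes> (a \<oplus> \<one>) \<oplus> \<one>)) i \<longleftrightarrow> i = a \<or> cod m p i"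
proof -
  let ?u = "\<lambda>i. m \<otimes> (i \<oplus> \<one>) \<oplus> \<one>"
  have final: "dv (?u i) p" if "dv (?u i) (p \<otimes> (m \<otimes> d))" "d \<preceq> b" "d \<noteq> \<zero>" for d
  proof -
    have "p \<otimes> (m \<otimes> d) = p \<otimes> d \<otimes> m" by (simp only: mul_assoc mul_commute[of m])
    with that(1) have *: "dv (?u i) (p \<otimes> d)" using dv_modulus by simp
    have "dv d m" using m that(2,3) by simp
    then obtain c where "d \<otimes> c = m" unfolding dv_def by (elim exE)
    then have "p \<otimes> d \<otimes> c = p \<otimes> m" by (simp add: mul_assoc)
    then have "dv (?u i) (p \<otimes> m)" using dv_mult[OF *, of c] by simp
    then show ?thesis by (rule dv_modulus)
  qed
  have shift: "?u (x \<oplus> d) = ?u x \<oplus> m \<otimes> d" for x d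
    by (simp add: sr.distrib_left sr.add.assoc sr.add.commute sr.add.left_commute)
  have "dv (?u i) p" if dvd: "dv (?u i) (p \<otimes> ?u a)" and "i \<noteq> a"
  proof (cases "i \<preceq> a")
    case True
    then obtain d where d: "i \<oplus> d = a" unfolding le_iff_add by auto
    then have "d \<preceq> a" using le_add1(2)[of d i] by simp
    then have "d \<preceq> b" using \<open>a \<preceq> b\<close> by (rule ord.order_trans)
    moreover have "d \<noteq> \<zero>" using d \<open>i \<noteq> a\<close> add_zero by auto
    moreover have "p \<otimes> ?u a = p \<otimes> ?u i \<oplus> p \<otimes> (m \<otimes> d)"
      unfolding d[symmetric] shift[of i d] by (rule distrib_left)
    then have "dv (?u i) (p \<otimes> (m \<otimes> d))"
      using dv_cancel[OF dv_mult2] dvd by simp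
    ultimately show ?thesis using final by simp
  next
    case False
    then have "a \<preceq> i" using ord.linear by auto
    then obtain d where d: "a \<oplus> d = i" unfolding le_iff_add by auto
    then have "d \<preceq> i" using le_add1(2)[of d a] by simp
    then have "d \<preceq> b" using \<open>i \<preceq> b\<close> by (rule ord.order_trans)
    moreover have "d \<noteq> \<zero>" using d \<open>i \<noteq> a\<close> add_zero by auto
    moreover have "p \<otimes> ?u i = p \<otimes> ?u a \<oplus> p \<otimes> (m \<otimes> d)"
      unfolding d[symmetric] shift[of a d] by (rule distrib_left)
    then have "dv (?u i) (p \<otimes> (m \<otimes> d))"
      using dv_cancel[OF dvd] dv_mult2[of "?u i" p] by simp
    ultimately show ?thesis using final by simp
  qed
  then show ?thesis
    unfolding cod_dv using dv_mult[of "?u i" p "?u a"] dv_mult2[of "?u a" p] by auto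
qed

text \<open>The code \<open>p\<close> is the product of the moduli of the elements. As
  \<open>m\<close> is chosen beforehand for the final bound \<open>b\<close>, adding one element at
  a time is an induction on an existential statement about \<open>p\<close> with bounded
  matrix.\<close>

lemma bounded_comprehension:
  assumes "D0 (\<lambda>e X. P (e 0))"
  shows "\<exists>m p. \<forall>i. i \<preceq> b \<longrightarrow> (cod m p i \<longleftrightarrow> P i)"
proof -
  obtain m where m: "m \<noteq> \<zero>" "\<forall>d. d \<preceq> b \<longrightarrow> d \<noteq> \<zero> \<longrightarrow> dv d m" using ex_modulus[of b] by (elim exE conjE)
  let ?P = "\<lambda>c. \<exists>p. \<forall>i. i \<preceq> b \<longrightarrow> (cod m p i \<longleftrightarrow> i \<prec> c \<and> P i)"
  have "?P c" for c
  proof (rule S1_induct[where P = ?P])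
    show "S1 (\<lambda>e X. ?P (e 0))"
      by (rule S1_ex_D0) (intro dfn T_lift, use assms in simp)
    show "?P \<zero>"
      using cod_one[OF m(1)] not_less_zero by (intro exI[of _ \<one>]) simp
  next
    fix c assume "?P c"
    then obtain p where p: "\<forall>i. i \<preceq> b \<longrightarrow> (cod m p i \<longleftrightarrow> i \<prec> c \<and> P i)" by (elim exE)
    show "?P (c \<oplus> \<one>)"
    proof (cases "c \<preceq> b \<and> P c")
      case True
      then show ?thesis
        using p cod_insert[OF m(2), of c _ p]
        by (intro exI[of _ "p \<otimes> (m \<otimes> (c \<oplus> \<one>) \<oplus> \<one>)"]) (auto simp: less_succ le_def)
    next
      case False
      then show ?thesis using p by (intro exI[of _ p]) (auto simp: less_succ le_def)
    qed
  qed
  from this[of "b \<oplus> \<one>"] show ?thesis by (auto simp: less_succ)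
qed

section \<open>Parity of the position of an element\<close>

text \<open>A coded 2-colouring of the elements of \<open>X\<close> up to \<open>b\<close> in which
  neighbours differ. It replaces counting: two elements have the same colour iff an even number of
  steps separates them.\<close>

definition alt where
  "alt X b m p \<longleftrightarrow> (\<forall>y. y \<preceq> b \<longrightarrow> (\<forall>x. x \<preceq> b \<longrightarrow> nxt X x y \<longrightarrow> (cod m p x \<longleftrightarrow> \<not> cod m p y)))"

lemma D0_alt [dfn]: "T g \<Longrightarrow> T h \<Longrightarrow> T k \<Longrightarrow> D0 (\<lambda>e X. alt X (g e) (h e) (k e))"
  unfolding alt_def by (intro dfn T_lift)

lemma D0_alt_const [dfn]: "T g \<Longrightarrow> T h \<Longrightarrow> T k \<Longrightarrow> A \<in> S \<Longrightarrow> D0 (\<lambda>e X. alt A (g e) (h e) (k e))"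
  unfolding alt_def by (intro dfn T_lift)

lemma ex_alt_aux:
  assumes "X \<in> S"
  shows "\<exists>m p. alt X b m p"
proof (rule S1_induct[where P = "\<lambda>b. \<exists>m p. alt X b m p"])
  show "S1 (\<lambda>e X'. \<exists>m p. alt X (e 0) m p)"
    by (rule S1_ex, rule S1_ex_D0, intro dfn assms)
  show "\<exists>m p. alt X \<zero> m p"
  proof (intro exI)
    \<comment> \<open>Any code works, since successive elements are distinct and only one number is
      at most \<open>\<zero>\<close>.\<close>
    show "alt X \<zero> \<zero> \<zero>" unfolding alt_def nxt_def by (auto simp: less_irrefl)
  qed
next
  fix b assume "\<exists>m p. alt X b m p"
  then obtain m p where mp: "alt X b m p" by (elim exE)
  \<comment> \<open>Old colours are kept up to \<open>b\<close>, beyond which the old code is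
    arbitrary; \<open>b \<oplus> \<one>\<close> gets the colour opposite to that of its predecessor
    in \<open>X\<close>.\<close>
  let ?P = "\<lambda>i. (i \<preceq> b \<and> cod m p i) \<or> (i = b \<oplus> \<one> \<and> (\<exists>x. x \<preceq> b \<and> (nxt X x (b \<oplus> \<one>) \<and> \<not> cod m p x)))"
  have "D0 (\<lambda>e X. ?P (e 0))"
    by (intro dfn T_lift assms)
  from bounded_comprehension[OF this, of "b \<oplus> \<one>"]
  obtain m' p' where *: "\<forall>i. i \<preceq> b \<oplus> \<one> \<longrightarrow> (cod m' p' i \<longleftrightarrow> ?P i)" by (elim exE)
  have old: "cod m' p' i \<longleftrightarrow> cod m p i" if "i \<preceq> b" for i
  proof -
    have "i \<prec> b \<oplus> \<one>" using that less_succ by simp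
    then have "i \<preceq> b \<oplus> \<one>" "i \<noteq> b \<oplus> \<one>" using less_irrefl by (auto simp: le_def)
    then show ?thesis using * that by simp
  qed
  have "alt X (b \<oplus> \<one>) m' p'"
    unfolding alt_def
  proof (intro allI impI)
    fix y x assume xy: "y \<preceq> b \<oplus> \<one>" "x \<preceq> b \<oplus> \<one>" "nxt X x y"
    then have "x \<prec> b \<oplus> \<one>" using nxtD(3)[OF xy(3)] ord.less_le_trans by simp
    then have "x \<preceq> b" using less_succ by simp
    show "cod m' p' x \<longleftrightarrow> \<not> cod m' p' y"
    proof (cases "y = b \<oplus> \<one>")
      case True
      have "\<not> b \<oplus> \<one> \<preceq> b" unfolding succ_le_iff by (rule less_irrefl)
      then have "cod m' p' y \<longleftrightarrow> (\<exists>x'. x' \<preceq> b \<and> (nxt X x' (b \<oplus> \<one>) \<and> \<not> cod m p x'))"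
        unfolding True using *[rule_format, of "b \<oplus> \<one>"] by simp
      moreover have "x' = x" if "nxt X x' (b \<oplus> \<one>)" for x'
      proof (rule ord.order_antisym)
        show "x' \<preceq> x" using xy(3) that unfolding True by (simp add: nxt_def)
        show "x \<preceq> x'" using xy(3) that unfolding True by (simp add: nxt_def)
      qed
      ultimately have "cod m' p' y \<longleftrightarrow> \<not> cod m p x"
        using \<open>x \<preceq> b\<close> xy(3)[unfolded True] by metis
      then show ?thesis using old[OF \<open>x \<preceq> b\<close>] by simp
    next
      case False
      then have "y \<preceq> b" using xy(1) less_succ unfolding le_def[of y "b \<oplus> \<one>"] by simp
      then have "cod m p x \<longleftrightarrow> \<not> cod m p y"
        using mp xy(3) \<open>x \<preceq> b\<close> unfolding alt_def by simp
      then show ?thesis using old[OF \<open>x \<preceq> b\<close>] old[OF \<open>y \<preceq> b\<close>] by simp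
    qed
  qed
  then show "\<exists>m p. alt X (b \<oplus> \<one>) m p" by (intro exI)
qed

lemma ex_alt:
  assumes "X \<in> S"
  shows "\<exists>m p. alt X b m p \<and> cod m p b"
proof -
  obtain m p where mp: "alt X b m p" using ex_alt_aux[OF assms, of b] by (elim exE)
  \<comment> \<open>The colours are swapped if necessary, so that \<open>b\<close> itself belongs to
    the coded set.\<close>
  have "D0 (\<lambda>e X. cod m p (e 0) \<longleftrightarrow> cod m p b)"
    by (intro dfn)
  from bounded_comprehension[OF this, of b]
  obtain m' p' where *: "\<forall>i. i \<preceq> b \<longrightarrow> (cod m' p' i \<longleftrightarrow> (cod m p i \<longleftrightarrow> cod m p b))" by (elim exE)
  have "alt X b m' p'"
    using mp unfolding alt_def by (auto simp: *)
  moreover have "cod m' p' b" by (simp add: *)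
  ultimately show ?thesis by (intro exI conjI)
qed

text \<open>Agreement of two alternating colourings is preserved in both directions between
  neighbours. A least element that deviates from the first one is refuted by its
  predecessor.\<close>

lemma alt_agree:
  assumes "X \<in> S" and alt: "alt X b m p" "alt X b m' p'" and b: "b \<in> X" "cod m p b" "cod m' p' b"
    and a: "a \<in> X" "a \<preceq> b"
  shows "cod m p a \<longleftrightarrow> cod m' p' a"
proof -
  define ag where "ag c \<longleftrightarrow> (cod m p c \<longleftrightarrow> cod m' p' c)" for c
  obtain x where x: "first x X" using ex_first[OF \<open>X \<in> S\<close> \<open>b \<in> X\<close>] by (elim exE)
  have same: "ag c \<longleftrightarrow> ag x" if "c \<in> X" "c \<preceq> b" for c
  proof (rule ccontr)
    let ?P = "\<lambda>c. c \<in> X \<and> c \<preceq> b \<and> \<not> (ag c \<longleftrightarrow> ag x)"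
    assume "\<not> (ag c \<longleftrightarrow> ag x)"
    then have c: "?P c" using that by simp
    have "D0 (\<lambda>e X. ?P (e 0))"
      unfolding ag_def by (intro dfn assms)
    from D0_least[where P = ?P, OF this c]
    obtain l where l: "?P l" "\<forall>c. c \<prec> l \<longrightarrow> \<not> ?P c" by (elim exE conjE) simp
    then have "\<not> first l X" using first_unique[OF x] by auto
    then obtain k where k: "nxt X k l" using ex_prev[OF \<open>X \<in> S\<close>] l(1) by auto
    then have "k \<prec> l" "k \<in> X" by (rule nxtD)+
    then have "k \<preceq> b" using l(1) by (auto simp: le_def intro: less_trans)
    have "ag k \<longleftrightarrow> ag l" using \<open>k \<preceq> b\<close> alt k l(1) unfolding alt_def ag_def by auto
    then show False using l \<open>k \<prec> l\<close> \<open>k \<in> X\<close> \<open>k \<preceq> b\<close> by auto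
  qed
  have "ag b" using b unfolding ag_def by simp
  then show ?thesis using same[OF b(1)] same[OF a] unfolding ag_def by simp
qed

text \<open>This expresses that the number of steps from the least element of \<open>X\<close> to
  \<open>b\<close> is even.\<close>

definition ev where
  "ev X b \<longleftrightarrow> (\<exists>m p x. alt X b m p \<and> cod m p b \<and> first x X \<and> cod m p x)"

text \<open>Parity can be read off any suitable code, so oddness is an existential statement as
  well. The graph of the colouring below relies on this.\<close>

lemma ev_alt:
  assumes "X \<in> S" "b \<in> X" "alt X b m p" "cod m p b" "first x X"
  shows "ev X b \<longleftrightarrow> cod m p x"
proof
  assume "ev X b"
  then obtain m' p' x' where *: "alt X b m' p'" "cod m' p' b" "first x' X" "cod m' p' x'"
    unfolding ev_def by (elim exE conjE)
  then have "x' = x" using assms(5) first_unique by auto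
  have "x \<in> X" "x \<preceq> b" using assms(2,5) first_le by (auto simp: first_def)
  then show "cod m p x"
    using alt_agree[OF assms(1) assms(3) *(1) assms(2,4) *(2)] *(4) \<open>x' = x\<close> by simp
next
  assume "cod m p x"
  with assms show "ev X b"
    unfolding ev_def by (intro exI[of _ m] exI[of _ p] exI[of _ x] conjI)
qed

lemma ev_first: "X \<in> S \<Longrightarrow> first x X \<Longrightarrow> ev X x"
  using ex_alt[of X x] unfolding ev_def by auto

text \<open>One colouring serves \<open>X\<close> and its tail. The starting points \<open>x\<close>
  and \<open>y\<close> are neighbours and have opposite colours.\<close>

lemma ev_step:
  assumes "X \<in> S" "first x X" "nxt X x y" "b \<in> X" "b \<noteq> x"
  shows "ev X b \<longleftrightarrow> \<not> ev (tail y X) b"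
proof -
  obtain m p where mp: "alt X b m p" "cod m p b" using ex_alt[OF assms(1), of b] by (elim exE conjE)
  have "x \<preceq> b" using assms(2,4) first_le by simp
  then have "x \<prec> b" using assms(5) by (simp add: le_def)
  then have "y \<preceq> b" using nxtD(4)[OF assms(3,4)] by simp
  have "alt (tail y X) b m p" using mp(1) unfolding alt_def nxt_tail by auto
  moreover have "b \<in> tail y X" using assms(4) \<open>y \<preceq> b\<close> unfolding tail_def by simp
  moreover have "first y (tail y X)" using first_tail nxtD(2)[OF assms(3)] by simp
  ultimately have "ev (tail y X) b \<longleftrightarrow> cod m p y"
    using ev_alt tail_S[OF assms(1)] mp(2) by simp
  moreover have "ev X b \<longleftrightarrow> cod m p x"
    using ev_alt[OF assms(1,4) mp assms(2)] .
  moreover have "cod m p x \<longleftrightarrow> \<not> cod m p y"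
    using mp(1) \<open>x \<preceq> b\<close> \<open>y \<preceq> b\<close> assms(3) unfolding alt_def by simp
  ultimately show ?thesis by simp
qed

section \<open>Enumeration of an infinite set\<close>

text \<open>A computation history for the recursion that lists \<open>X\<close>: each coded pair of
  an index and an element is initial or justified by a coded pair with the previous index.\<close>

definition chain where
  "chain X b m p \<longleftrightarrow> (\<forall>k. k \<preceq> b \<longrightarrow> (\<forall>z. z \<preceq> b \<longrightarrow> pair k z \<preceq> b \<longrightarrow> cod m p (pair k z) \<longrightarrow>
    (k = \<zero> \<and> first z X) \<or>
    (\<exists>l. l \<preceq> k \<and> (\<exists>y. y \<preceq> z \<and> (k = l \<oplus> \<one> \<and> nxt X y z \<and> cod m p (pair l y))))))"

text \<open>\<open>x\<close> is element number \<open>j\<close> of \<open>X\<close> in increasing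
  order, counted from \<open>\<zero>\<close>.\<close>

definition enum where
  "enum X j x \<longleftrightarrow> (\<exists>b m p. chain X b m p \<and> pair j x \<preceq> b \<and> cod m p (pair j x))"

lemma D0_chain_const [dfn]: "T g \<Longrightarrow> T h \<Longrightarrow> T k \<Longrightarrow> A \<in> S \<Longrightarrow> D0 (\<lambda>e X. chain A (g e) (h e) (k e))"
  unfolding chain_def by (intro dfn T_lift)

lemma S1_enum: "A \<in> S \<Longrightarrow> T g \<Longrightarrow> T h \<Longrightarrow> S1 (\<lambda>e X. enum A (g e) (h e))"
  unfolding enum_def by (rule S1_ex, rule S1_ex, rule S1_ex_D0, intro dfn T_lift)

lemma chainI:
  assumes "\<And>k z. pair k z \<preceq> b \<Longrightarrow> cod m p (pair k z) \<Longrightarrow> (k = \<zero> \<and> first z X) \<or>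
    (\<exists>l y. k = l \<oplus> \<one> \<and> nxt X y z \<and> cod m p (pair l y))"
  shows "chain X b m p"
  unfolding chain_def
proof (intro allI impI)
  fix k z assume "pair k z \<preceq> b" "cod m p (pair k z)"
  then consider "k = \<zero> \<and> first z X" | l y where "k = l \<oplus> \<one>" "nxt X y z" "cod m p (pair l y)"
    using assms[of k z] by auto
  then show "(k = \<zero> \<and> first z X) \<or>
    (\<exists>l. l \<preceq> k \<and> (\<exists>y. y \<preceq> z \<and> (k = l \<oplus> \<one> \<and> nxt X y z \<and> cod m p (pair l y))))"
  proof cases
    case 1
    then show ?thesis by simp
  next
    case 2
    moreover have "y \<preceq> z" using nxtD(3)[OF 2(2)] by (simp add: le_def)
    moreover have "l \<preceq> k" using 2(1) by simp
    ultimately show ?thesis by (intro disjI2 exI[of _ l] exI[of _ y] conjI)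
  qed
qed

lemma chainD:
  assumes "chain X b m p" "pair k z \<preceq> b" "cod m p (pair k z)"
  obtains "k = \<zero>" "first z X"
    | l y where "k = l \<oplus> \<one>" "nxt X y z" "cod m p (pair l y)" "pair l y \<preceq> b"
proof -
  have "k \<preceq> b" "z \<preceq> b"
    using ord.order_trans[OF le_pair(1) assms(2)] ord.order_trans[OF le_pair(2) assms(2)] by simp_all
  with assms have "(k = \<zero> \<and> first z X) \<or>
    (\<exists>l. l \<preceq> k \<and> (\<exists>y. y \<preceq> z \<and> (k = l \<oplus> \<one> \<and> nxt X y z \<and> cod m p (pair l y))))"
    unfolding chain_def by simp
  then consider "k = \<zero> \<and> first z X" | l y where "l \<preceq> k" "y \<preceq> z" "k = l \<oplus> \<one>" "nxt X y z" "cod m p (pair l y)"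
    by (elim disjE exE conjE) simp_all
  then show thesis
  proof cases
    case 1
    then show thesis using that(1) by simp
  next
    case 2
    have "pair l y \<preceq> b" using pair_mono[OF 2(1,2)] assms(2) by (rule ord.order_trans)
    with 2 show thesis using that(2) by simp
  qed
qed

lemma enum_zero:
  assumes "first x X"
  shows "enum X \<zero> x"
proof -
  have "D0 (\<lambda>e X. e 0 = pair \<zero> x)" by (intro dfn)
  from bounded_comprehension[OF this, of "pair \<zero> x"]
  obtain m p where mp: "\<forall>i. i \<preceq> pair \<zero> x \<longrightarrow> (cod m p i \<longleftrightarrow> i = pair \<zero> x)" by (elim exE)
  have "chain X (pair \<zero> x) m p"
    by (rule chainI) (use mp assms in auto)
  moreover have "cod m p (pair \<zero> x)" using mp by simp
  ultimately show ?thesis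
    unfolding enum_def by (intro exI[of _ "pair \<zero> x"] exI[of _ m] exI[of _ p] conjI) simp_all
qed

lemma enum_succ:
  assumes "enum X j x" "nxt X x y"
  shows "enum X (j \<oplus> \<one>) y"
proof -
  obtain b m p where bmp: "chain X b m p" "pair j x \<preceq> b" "cod m p (pair j x)"
    using assms(1) unfolding enum_def by (elim exE conjE)
  define c where "c = pair (j \<oplus> \<one>) y"
  \<comment> \<open>The history is cut at \<open>b\<close>, beyond which the old code carries no
    information, and extended by the pair \<open>c\<close>. The bound \<open>b \<oplus> c\<close>
    covers both.\<close>
  have "D0 (\<lambda>e X. (e 0 \<preceq> b \<and> cod m p (e 0)) \<or> e 0 = c)" by (intro dfn)
  from bounded_comprehension[OF this, of "b \<oplus> c"]
  obtain n q where nq: "\<forall>i. i \<preceq> b \<oplus> c \<longrightarrow> (cod n q i \<longleftrightarrow> (i \<preceq> b \<and> cod m p i) \<or> i = c)" by (elim exE)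
  have old: "cod n q i" if "i \<preceq> b" "cod m p i" for i
  proof -
    have "i \<preceq> b \<oplus> c" using that(1) le_add1(1) by (rule ord.order_trans)
    then show ?thesis using nq that by simp
  qed
  have "chain X (b \<oplus> c) n q"
  proof (rule chainI)
    fix k z assume kz: "pair k z \<preceq> b \<oplus> c" "cod n q (pair k z)"
    then consider "pair k z \<preceq> b" "cod m p (pair k z)" | "pair k z = c" using nq by auto
    then show "(k = \<zero> \<and> first z X) \<or> (\<exists>l y. k = l \<oplus> \<one> \<and> nxt X y z \<and> cod n q (pair l y))"
    proof cases
      case 1
      from bmp(1) this show ?thesis
      proof (cases rule: chainD)
        case (2 l y)
        then show ?thesis using old[of "pair l y"] by (intro disjI2 exI[of _ l] exI[of _ y]) simp
      qed simp
    next
      case 2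
      then show ?thesis using assms(2) old[OF bmp(2,3)] unfolding c_def
        by (intro disjI2 exI[of _ j] exI[of _ x]) simp
    qed
  qed
  moreover have "cod n q c" using nq by simp
  ultimately show ?thesis
    unfolding enum_def c_def by (intro exI[of _ "b \<oplus> pair (j \<oplus> \<one>) y"] exI[of _ n] exI[of _ q] conjI) simp_all
qed

lemma enum_cases:
  assumes "enum X j x"
  obtains "j = \<zero>" "first x X" | k z where "j = k \<oplus> \<one>" "nxt X z x" "enum X k z"
proof -
  obtain b m p where bmp: "chain X b m p" "pair j x \<preceq> b" "cod m p (pair j x)"
    using assms unfolding enum_def by (elim exE conjE)
  then show thesis
  proof (cases rule: chainD)
    case 1
    then show thesis by (rule that(1))
  next
    case (2 l y)
    then have "enum X l y"
      unfolding enum_def using bmp(1) by (intro exI[of _ b] exI[of _ m] exI[of _ p] conjI)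
    with 2(1,2) show thesis by (rule that(2))
  qed
qed

lemma enum_mem: "enum X j x \<Longrightarrow> x \<in> X"
  by (erule enum_cases) (auto simp: first_def dest: nxtD)

lemma enum_total:
  assumes "X \<in> Inf"
  shows "\<exists>x. enum X j x"
proof (rule S1_induct[where P = "\<lambda>j. \<exists>x. enum X j x"])
  show "S1 (\<lambda>e X'. \<exists>x. enum X (e 0) x)"
    by (rule S1_ex) (intro S1_enum Inf_S assms T_var)
  obtain a where "a \<in> X" using Inf_ex[OF assms] by auto
  then obtain x where "first x X" using ex_first[OF Inf_S[OF assms]] by auto
  then show "\<exists>x. enum X \<zero> x" using enum_zero by auto
next
  fix j assume "\<exists>x. enum X j x"
  then obtain x where x: "enum X j x" by auto
  then obtain y where "nxt X x y" using ex_nxt[OF assms enum_mem] by auto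
  from enum_succ[OF x this] show "\<exists>x. enum X (j \<oplus> \<one>) x" by (rule exI)
qed

lemma enum_unique:
  assumes "X \<in> S" "enum X j x" "enum X j y"
  shows "x = y"
proof -
  have "\<forall>x y. enum X j x \<longrightarrow> enum X j y \<longrightarrow> x = y"
  proof (rule P1_induct[where P = "\<lambda>j. \<forall>x y. enum X j x \<longrightarrow> enum X j y \<longrightarrow> x = y"])
    show "P1 (\<lambda>e X'. \<forall>x y. enum X (e 0) x \<longrightarrow> enum X (e 0) y \<longrightarrow> x = y)"
      by (rule P1_all, rule P1_all, rule P1_imp, rule S1_enum[OF assms(1)], rule T_var, rule T_var,
          rule P1_imp, rule S1_enum[OF assms(1)], rule T_var, rule T_var, rule P1_D0, intro dfn)
    show "\<forall>x y. enum X \<zero> x \<longrightarrow> enum X \<zero> y \<longrightarrow> x = y"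
    proof (intro allI impI)
      fix x y assume "enum X \<zero> x" "enum X \<zero> y"
      moreover have "first z X" if "enum X \<zero> z" for z
        using that
      proof (cases rule: enum_cases)
        case (2 k y)
        then show ?thesis using succ_neq_zero[of k] by simp
      qed
      ultimately show "x = y" using first_unique[of x X y] by simp
    qed
  next
    fix j assume IH: "\<forall>x y. enum X j x \<longrightarrow> enum X j y \<longrightarrow> x = y"
    have prev: "\<exists>z. nxt X z x \<and> enum X j z" if "enum X (j \<oplus> \<one>) x" for x
      using that
    proof (cases rule: enum_cases)
      case (2 k z)
      then show ?thesis using succ_inj[of j k] by auto
    qed (simp add: succ_neq_zero)
    show "\<forall>x y. enum X (j \<oplus> \<one>) x \<longrightarrow> enum X (j \<oplus> \<one>) y \<longrightarrow> x = y"
    proof (intro allI impI)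
      fix x y assume "enum X (j \<oplus> \<one>) x" "enum X (j \<oplus> \<one>) y"
      then obtain z w where "nxt X z x" "enum X j z" "nxt X w y" "enum X j w"
        using prev[of x] prev[of y] by auto
      then show "x = y" using IH nxt_unique[of X z x y] by auto
    qed
  qed
  then show ?thesis using assms by auto
qed

section \<open>Three colours from an alternating bit\<close>

lemma mrg_upd_params:
  "(mrg e (case_nat x (case_nat y r)))(1 := a, 3 := b) = mrg e (case_nat a (case_nat b r))"
proof
  fix n
  show "((mrg e (case_nat x (case_nat y r)))(1 := a, 3 := b)) n = mrg e (case_nat a (case_nat b r)) n"
  proof (cases n rule: nat_parity_cases)
    case (2 k)
    consider "k = 0" | "k = 1" | l where "k = Suc (Suc l)"
      by (metis One_nat_def not0_implies_Suc)
    then show ?thesis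
      by cases (simp_all add: 2 mrg_def)
  next
    case (1 k)
    then have "n \<noteq> 1" "n \<noteq> 3" by presburger+
    then show ?thesis by (simp add: 1)
  qed
qed

text \<open>This leads from the semantic class back to a formula of the form that
  \<open>Delta2_function\<close> requires, with value and argument in the variables 0.\<close>

lemma S2_formula:
  assumes "S2 (\<lambda>e X. R (e 0) X)"
  shows "\<exists>\<phi> e E. Sigma2 \<phi> \<and> range E \<subseteq> S \<and> (\<forall>X\<in>S. \<forall>q. sat M (e(0 := q)) (E(0 := X)) \<phi> \<longleftrightarrow> R q X)"
proof -
  obtain Q where "D0 Q" and Q: "\<forall>e. \<forall>X\<in>S. R (e 0) X \<longleftrightarrow> (\<exists>u. \<forall>v. Q (case_nat v (case_nat u e)) X)"
    using assms unfolding S2_def by blast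
  then obtain \<theta> r E where \<theta>: "repD \<theta> r E Q" unfolding D0_def by blast
  obtain A where A: "A \<in> S" using S_nonempty by blast
  let ?\<theta> = "fren \<rho>Q id (fren \<rho>Q id \<theta>)"
  \<comment> \<open>Variables 1 and 3 are the first two parameter slots, freed by the double use of
    \<open>\<rho>Q\<close>.\<close>
  let ?\<phi> = "ExN 1 (AllN 3 ?\<theta>)"
  let ?e = "mrg (\<lambda>_. \<zero>) (case_nat \<zero> (case_nat \<zero> r))" and ?E = "case_nat A E"
  have b: "bounded_fm \<theta>" "range E \<subseteq> S" using \<theta> by (simp_all add: repD_def)
  then have "Sigma2 ?\<phi>"
    unfolding Sigma2_def Pi1_def by (auto simp: bounded_fm_fren inj_\<rho>)
  moreover have "range ?E \<subseteq> S"
    using A b(2) by (rule range_case_nat)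
  moreover have "sat M (?e(0 := q)) (?E(0 := X)) ?\<phi> \<longleftrightarrow> R q X" if X: "X \<in> S" for X q
  proof -
    have E: "?E(0 := X) = case_nat X E" by (auto simp: fun_eq_iff split: nat.splits)
    let ?q = "(\<lambda>_. \<zero>)(0 := q)"
    have "sat M ((mrg ?q (case_nat \<zero> (case_nat \<zero> r)))(1 := u, 3 := v)) (case_nat X E) ?\<theta>
        \<longleftrightarrow> Q (case_nat v (case_nat u ?q)) X" for u v
    proof -
      have "sat M (mrg ?q (case_nat u (case_nat v r))) (case_nat X E) ?\<theta>
          \<longleftrightarrow> sat M (mrg ?q (case_nat u (case_nat v r)) \<circ> \<rho>Q \<circ> \<rho>Q) (case_nat X E) \<theta>"
        using b(1) by (simp add: sat_fren bounded_fm_fren inj_\<rho>)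
      also have "\<dots> \<longleftrightarrow> Q (case_nat v (case_nat u ?q)) X"
        using \<theta> X by (simp add: mrg_\<rho> repD_def)
      finally show ?thesis unfolding mrg_upd_params .
    qed
    then show ?thesis
      unfolding E sat.simps mrg_upd_0 using Q[rule_format, OF X, of ?q] by simp
  qed
  ultimately show ?thesis by (intro exI[of _ ?\<phi>] exI[of _ ?e] exI[of _ ?E] conjI ballI allI)
qed

declare sr.one_add_one [simp del]

definition bit where "bit P = (if P then \<one> else \<zero>)"

lemma bit_neq [simp]: "bit P = bit Q \<longleftrightarrow> P = Q" "bit P \<noteq> \<one> \<oplus> \<one>" "\<one> \<oplus> \<one> \<noteq> bit P"
proof -
  have "\<one> \<oplus> \<one> \<noteq> \<one>" using add_cancel[of \<one> \<one> \<zero>] sr.zero_neq_one by (auto simp: zero_add)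
  then show "bit P = bit Q \<longleftrightarrow> P = Q" "bit P \<noteq> \<one> \<oplus> \<one>" "\<one> \<oplus> \<one> \<noteq> bit P"
    using sr.zero_neq_one succ_neq_zero[of \<one>] unfolding bit_def by (auto dest: sym)
qed

text \<open>
  The bit \<open>be a X\<close> describes the tail of \<open>X\<close> that starts with \<open>a \<in> X\<close>. The colour of \<open>X\<close> is its bit
  if an even number of steps leads from \<open>X\<close> to the last tail before the first change of the bit,
  and \<open>2\<close> otherwise. \<open>C\<close> is needed besides \<open>R\<close> since \<open>\<Sigma>\<^sup>0\<^sub>2\<close>-collection is not available.
\<close>

lemma bad_colouring:
  assumes inv: "\<And>X x y a. X \<in> Inf \<Longrightarrow> first x X \<Longrightarrow> nxt X x y \<Longrightarrow> a \<in> X \<Longrightarrow> y \<preceq> a \<Longrightarrow> be a (tail y X) = be a X"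
    and R: "S2 (\<lambda>e X. R (e 0) (e 1) X)" "\<And>X i a. X \<in> Inf \<Longrightarrow> a \<in> X \<Longrightarrow> R i a X \<longleftrightarrow> i = bit (be a X)"
    and C: "S2 (\<lambda>e X. C (e 0) (e 1) X)"
      "\<And>X i b. X \<in> Inf \<Longrightarrow> b \<in> X \<Longrightarrow> C i b X \<longleftrightarrow> (\<forall>a\<in>X. a \<preceq> b \<longrightarrow> i = bit (be a X))"
    and change: "\<And>X x. X \<in> Inf \<Longrightarrow> first x X \<Longrightarrow>
      \<exists>y\<in>X. be y X \<noteq> be x X \<and> (\<forall>a\<in>X. a \<prec> y \<longrightarrow> be x X = be a X)"
  shows "\<exists>G. Delta2_function M (fst (discrete3 M)) G \<and> bad M (discrete3 M) G"
proof -
  \<comment> \<open>\<open>b\<close> is the last element of the initial block of \<open>X\<close> on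
    which the bit is constant.\<close>
  define lastb where "lastb X b \<longleftrightarrow> b \<in> X \<and> (\<forall>a\<in>X. a \<preceq> b \<longrightarrow> be b X = be a X) \<and>
    (\<exists>y. nxt X b y \<and> be y X \<noteq> be b X)" for X b
  have lastI: "lastb X b"
    if "b \<in> X" "\<And>a. a \<in> X \<Longrightarrow> a \<preceq> b \<Longrightarrow> be b X = be a X" "nxt X b y" "be y X \<noteq> be b X" for X b y
    unfolding lastb_def using that(1,3,4) by (intro conjI ballI impI that(2) exI[of _ y])
  have lastD: "b \<in> X" "\<And>a. a \<in> X \<Longrightarrow> a \<preceq> b \<Longrightarrow> be b X = be a X" if "lastb X b" for X b
    using that unfolding lastb_def by blast+
  have last_nxt: "\<exists>y. nxt X b y \<and> be y X \<noteq> be b X" if "lastb X b" for X b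
    using that[unfolded lastb_def] by (elim conjE)
  have ex_last: "\<exists>b. lastb X b" if X: "X \<in> Inf" for X
  proof -
    obtain a where "a \<in> X" using Inf_ex[OF X] by auto
    then obtain x where x: "first x X" using ex_first[OF Inf_S[OF X]] by auto
    obtain y where y: "y \<in> X" "be y X \<noteq> be x X" "\<forall>a\<in>X. a \<prec> y \<longrightarrow> be x X = be a X"
      using change[OF X x] by auto
    then have "\<not> first y X" using first_unique[OF x] by auto
    then obtain b where b: "nxt X b y" using ex_prev[OF Inf_S[OF X] y(1)] by auto
    have below: "be x X = be a X" if "a \<in> X" "a \<preceq> b" for a
      by (rule bspec[OF y(3) that(1), THEN mp], rule ord.le_less_trans[OF that(2) nxtD(3)[OF b]])
    have "b \<in> X" using b by (rule nxtD)
    then have xb: "be x X = be b X" using below[of b] by simp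
    have "lastb X b"
      using \<open>b \<in> X\<close> _ b by (rule lastI) (use below xb y(2) in metis)+
    then show ?thesis ..
  qed
  have no_less: "\<not> b \<prec> c" if l: "lastb X b" "lastb X c" for X b c
  proof
    assume "b \<prec> c"
    obtain y where y: "nxt X b y" "be y X \<noteq> be b X"
      using last_nxt[OF l(1)] by (elim exE conjE)
    have "y \<preceq> c" using nxtD(4)[OF y(1) lastD(1)[OF l(2)] \<open>b \<prec> c\<close>] .
    then have "be c X = be y X" by (rule lastD(2)[OF l(2) nxtD(2)[OF y(1)]])
    moreover have "be c X = be b X"
      using \<open>b \<prec> c\<close> by (intro lastD(2)[OF l(2) nxtD(1)[OF y(1)]]) (simp add: le_def)
    ultimately show False using y(2) by simp
  qed
  then have last_unique: "b = c" if "lastb X b" "lastb X c" for X b c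
    using that less_linear[of b c] by auto
  define G where "G X = (let b = THE b. lastb X b in if ev X b then bit (be b X) else \<one> \<oplus> \<one>)" for X
  have G: "G X = (if ev X b then bit (be b X) else \<one> \<oplus> \<one>)" if "lastb X b" for X b
  proof -
    have "(THE b. lastb X b) = b" using that last_unique by (intro the_equality)
    then show ?thesis unfolding G_def by simp
  qed
  \<comment> \<open>\<open>C\<close> and \<open>R\<close> occur only positively: the change at
    \<open>y\<close> is expressed by a value \<open>j\<close> different from \<open>i\<close>, since
    a negation of \<open>R\<close> need not be Sigma_2. The quantified code \<open>m\<close>,
    \<open>p\<close> decides either parity.\<close>
  define W where "W c X \<longleftrightarrow> (\<exists>i j b y m p x. C i b X \<and> R j y X \<and> b \<in> X \<and> nxt X b y \<and> i \<noteq> j \<and>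
    alt X b m p \<and> cod m p b \<and> first x X \<and> (cod m p x \<and> c = i \<or> \<not> cod m p x \<and> c = \<one> \<oplus> \<one>))" for c X
  have "S2 (\<lambda>e X. W (e 0) X)"
    unfolding W_def
    by (rule S2_ex, rule S2_ex, rule S2_ex, rule S2_ex, rule S2_ex, rule S2_ex, rule S2_ex,
        rule S2_conj, rule S2_app2[OF C(1)], intro dfn, intro dfn,
        rule S2_conj, rule S2_app2[OF R(1)], intro dfn, intro dfn, rule S2_D0, intro dfn)
  moreover have W: "W c X \<longleftrightarrow> G X = c" if X: "X \<in> Inf" for X c
  proof
    assume "W c X"
    then obtain i j b y m p x where *: "C i b X" "R j y X" "b \<in> X" "nxt X b y" "i \<noteq> j"
      "alt X b m p" "cod m p b" "first x X" "cod m p x \<and> c = i \<or> \<not> cod m p x \<and> c = \<one> \<oplus> \<one>"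
      unfolding W_def by (elim exE conjE)
    have i: "i = bit (be a X)" if "a \<in> X" "a \<preceq> b" for a
      using C(2)[OF X *(3)] *(1) that by simp
    have ib: "i = bit (be b X)" using i[OF *(3)] by simp
    have "j = bit (be y X)" using R(2)[OF X nxtD(2)[OF *(4)]] *(2) by simp
    then have "be y X \<noteq> be b X" using ib *(5) by auto
    moreover have "be b X = be a X" if "a \<in> X" "a \<preceq> b" for a
      using i[OF that] ib by simp
    ultimately have "lastb X b" using *(3,4) by (intro lastI)
    then show "G X = c"
      using G[of X b] ev_alt[OF Inf_S[OF X] *(3,6,7,8)] *(9) ib by auto
  next
    assume "G X = c"
    obtain b where b: "lastb X b" using ex_last[OF X] ..
    then obtain y where y: "nxt X b y" "be y X \<noteq> be b X"
      using last_nxt[OF b] by (elim exE conjE)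
    note bX = lastD[OF b]
    obtain x where x: "first x X" using ex_first[OF Inf_S[OF X] bX(1)] by auto
    obtain m p where mp: "alt X b m p" "cod m p b" using ex_alt[OF Inf_S[OF X], of b] by (elim exE conjE)
    have "\<forall>a\<in>X. a \<preceq> b \<longrightarrow> bit (be b X) = bit (be a X)"
      using bX(2) by (intro ballI impI arg_cong[where f = bit])
    then have "C (bit (be b X)) b X" by (rule C(2)[OF X bX(1), THEN iffD2])
    moreover have "R (bit (be y X)) y X" using R(2)[OF X nxtD(2)[OF y(1)]] by simp
    moreover have "bit (be b X) \<noteq> bit (be y X)" using y(2) by auto
    moreover have "cod m p x \<and> c = bit (be b X) \<or> \<not> cod m p x \<and> c = \<one> \<oplus> \<one>"
      using G[OF b] ev_alt[OF Inf_S[OF X] bX(1) mp x] \<open>G X = c\<close> by auto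
    ultimately show "W c X"
      unfolding W_def using bX(1) y(1) mp x
      by (intro exI[of _ "bit (be b X)"] exI[of _ "bit (be y X)"] exI[of _ b] exI[of _ y]
          exI[of _ m] exI[of _ p] exI[of _ x] conjI)
  qed
  obtain \<phi> e E where \<phi>: "Sigma2 \<phi>" "range E \<subseteq> S"
    "\<forall>X\<in>S. \<forall>q. sat M (e(0 := q)) (E(0 := X)) \<phi> \<longleftrightarrow> W q X"
    using S2_formula[OF \<open>S2 (\<lambda>e X. W (e 0) X)\<close>] by (elim exE conjE)
  have "G X \<in> {\<zero>, \<one>, \<one> \<oplus> \<one>}" if X: "X \<in> Inf" for X
  proof -
    obtain b where b: "lastb X b" using ex_last[OF X] ..
    show ?thesis unfolding G[OF b] bit_def by simp
  qed
  then have "\<forall>X\<in>Inf. G X \<in> fst (discrete3 M)" by (simp add: discrete3_def)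
  moreover have "\<forall>X\<in>Inf. \<forall>q. sat M (e(0 := q)) (E(0 := X)) \<phi> \<longleftrightarrow> G X = q"
    using \<phi>(3) W Inf_S by simp
  ultimately have Delta2: "Delta2_function M (fst (discrete3 M)) G"
    unfolding Delta2_function_def using \<phi>(1,2)
    by (intro conjI exI[of _ \<phi>] exI[of _ e] exI[of _ E])
  have "G X \<noteq> G (drop_least M X)" if X: "X \<in> Inf" for X
  proof -
    obtain b where b: "lastb X b" using ex_last[OF X] ..
    note bX = lastD[OF b]
    obtain z where z: "nxt X b z" "be z X \<noteq> be b X"
      using last_nxt[OF b] by (elim exE conjE)
    obtain x where x: "first x X" using ex_first[OF Inf_S[OF X] bX(1)] by auto
    then have "x \<in> X" by (simp add: first_def)
    obtain y where y: "nxt X x y" using ex_nxt[OF X \<open>x \<in> X\<close>] by auto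
    let ?Y = "tail y X"
    have Y: "?Y \<in> Inf" using tail_Inf[OF X] .
    have "G X \<noteq> G ?Y"
    proof (cases "b = x")
      \<comment> \<open>The bit changes already at \<open>y\<close>: \<open>X\<close> shows its own
        bit, while the colour of the tail is the opposite bit or 2.\<close>
      case True
      then have "z = y" using z(1) y nxt_unique by simp
      have GX: "G X = bit (be x X)" using G[OF b] ev_first[OF Inf_S[OF X] x] True by simp
      obtain c where c: "lastb ?Y c" using ex_last[OF Y] ..
      have "y \<in> ?Y" using nxtD(2)[OF y] by (simp add: tail_def)
      moreover have "c \<in> ?Y" by (rule lastD(1)[OF c])
      then have "y \<preceq> c" by (simp add: tail_def)
      ultimately have "be c ?Y = be y ?Y" by (rule lastD(2)[OF c])
      also have "\<dots> = be y X" using inv[OF X x y nxtD(2)[OF y]] by simp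
      finally have "be c ?Y \<noteq> be x X" using z(2) \<open>z = y\<close> True by simp
      then show ?thesis unfolding GX G[OF c] by auto
    next
      \<comment> \<open>\<open>X\<close> and its tail share the element \<open>b\<close>, and their
        distances to it differ by one. So exactly one of them is coloured 2.\<close>
      case False
      then have "x \<prec> b" using first_le[OF x bX(1)] by (simp add: le_def)
      then have yb: "y \<preceq> b" using nxtD(4)[OF y bX(1)] by simp
      have same: "be a ?Y = be a X" if "a \<in> X" "y \<preceq> a" for a
        using inv[OF X x y that] .
      have "b \<prec> z" using z(1) by (rule nxtD)
      with yb have "y \<preceq> z" by (auto simp: le_def intro: less_trans)
      have "b \<in> ?Y" using bX(1) yb by (simp add: tail_def)
      then have "lastb ?Y b"
      proof (rule lastI)
        show "nxt ?Y b z" using z(1) yb by (simp add: nxt_tail)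
        show "be z ?Y \<noteq> be b ?Y"
          using same[OF bX(1) yb] same[OF nxtD(2)[OF z(1)] \<open>y \<preceq> z\<close>] z(2) by simp
        show "be b ?Y = be a ?Y" if "a \<in> ?Y" "a \<preceq> b" for a
        proof -
          have a: "a \<in> X" "y \<preceq> a" using that(1) by (simp_all add: tail_def)
          show ?thesis using same[OF a] same[OF bX(1) yb] bX(2)[OF a(1) that(2)] by simp
        qed
      qed
      then show ?thesis
        using G[OF b] G[of ?Y b] ev_step[OF Inf_S[OF X] x y bX(1) False] same[OF bX(1) yb] by auto
    qed
    then show ?thesis using drop_least_tail[OF x y] by simp
  qed
  moreover have "p = q" if "ord_le M (discrete3 M) p q" for p q
    using that by (auto simp: ord_le_def discrete3_def)
  ultimately have "bad M (discrete3 M) G"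
    unfolding bad_def by metis
  with Delta2 show ?thesis by blast
qed

section \<open>Arithmetical comprehension from the discrete order\<close>

text \<open>Comprehension for Sigma_1 classes, which over the base theory is equivalent to
  arithmetical comprehension.\<close>

definition ACA where "ACA \<longleftrightarrow> (\<forall>P. S1 (\<lambda>e X. P (e 0)) \<longrightarrow> {a. P a} \<in> S)"

lemma not_ACA_obtain:
  assumes "\<not> ACA"
  obtains A where "D0 (\<lambda>e X. A (e 0) (e 1))" "{i. \<exists>s. A s i} \<notin> S"
proof -
  obtain P where P: "S1 (\<lambda>e X. P (e 0))" "{a. P a} \<notin> S"
    using assms unfolding ACA_def by auto
  obtain Q where Q: "D0 Q" "\<forall>e. \<forall>X\<in>S. P (e 0) \<longleftrightarrow> (\<exists>a. Q (case_nat a e) X)"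
    using P(1) unfolding S1_def by blast
  obtain X where X: "X \<in> S" using S_nonempty by blast
  let ?A = "\<lambda>s i. Q (case_nat s (case_nat i (\<lambda>_. \<zero>))) X"
  have "P i \<longleftrightarrow> (\<exists>s. ?A s i)" for i
    using Q(2)[rule_format, OF X, of "case_nat i (\<lambda>_. \<zero>)"] by simp
  with P(2) have "{i. \<exists>s. ?A s i} \<notin> S" by simp
  moreover have "D0 (\<lambda>e X. ?A (e 0) (e 1))"
    using D0_fix2[OF Q(1) X] by simp
  ultimately show thesis by (rule that[rotated])
qed

end

section \<open>True stages of a class that is not a set\<close>

locale no_set = rca0 +
  fixes A
  assumes D0_A: "D0 (\<lambda>e X. A (e 0) (e 1))"
    and no_set: "{i. \<exists>s. A s i} \<notin> S"
begin

text \<open>A stage codes the enumerated number with its least witness; all other numbers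
  \<open>t\<close> enumerate nothing. So each number of the class is enumerated exactly once, and
  never at a stage below it.\<close>

definition stage where
  "stage t i \<longleftrightarrow> (\<exists>s. s \<preceq> t \<and> (t = pair i s \<and> A s i \<and> (\<forall>r. r \<prec> s \<longrightarrow> \<not> A r i)))"

lemma D0_stage [dfn]: "T g \<Longrightarrow> T h \<Longrightarrow> D0 (\<lambda>e X. stage (g e) (h e))"
  unfolding stage_def by (intro dfn D0_app2[OF D0_A] T_lift)

lemma stage_le: "stage t i \<Longrightarrow> i \<preceq> t"
  unfolding stage_def using le_pair by auto

lemma stage_inj:
  assumes "stage t i" "stage u i"
  shows "t = u"
proof -
  obtain r s where "t = pair i r" "A r i" "\<forall>q. q \<prec> r \<longrightarrow> \<not> A q i"
    "u = pair i s" "A s i" "\<forall>q. q \<prec> s \<longrightarrow> \<not> A q i"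
    using assms unfolding stage_def by (elim exE conjE)
  then show ?thesis using less_linear[of r s] by auto
qed

lemma stage_iff: "(\<exists>s. A s i) \<longleftrightarrow> (\<exists>t. stage t i)"
proof
  assume "\<exists>s. A s i"
  then obtain s where s: "A s i" ..
  have "D0 (\<lambda>e X. A (e 0) i)"
    by (intro D0_app2[OF D0_A] dfn)
  from D0_least[where P = "\<lambda>s. A s i", OF this s]
  obtain l where "A l i" "\<forall>r. r \<prec> l \<longrightarrow> \<not> A r i" by (elim exE conjE)
  then have "stage (pair i l) i"
    unfolding stage_def by (intro exI[of _ l]) (simp add: le_pair(2))
  then show "\<exists>t. stage t i" ..
next
  assume "\<exists>t. stage t i"
  then show "\<exists>s. A s i" unfolding stage_def by (elim exE conjE) (rule exI)
qed

text \<open>A bound on the stages would give the class a bounded definition and make it a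
  set.\<close>

lemma ex_stage: "\<exists>t i. n \<prec> t \<and> stage t i"
proof (rule ccontr)
  assume "\<not> ?thesis"
  then have "t \<preceq> n" if "stage t i" for t i
    using that ord.le_less_linear by auto
  then have "(\<exists>s. A s i) \<longleftrightarrow> (\<exists>t. t \<preceq> n \<and> stage t i)" for i
    unfolding stage_iff by auto
  moreover have "{i. \<exists>t. t \<preceq> n \<and> stage t i} \<in> S"
    by (rule D0_comprehension) (intro dfn T_lift)
  ultimately show False using no_set by simp
qed

definition true where
  "true t \<longleftrightarrow> (\<exists>i. i \<preceq> t \<and> (stage t i \<and> (\<forall>u. t \<prec> u \<longrightarrow> (\<forall>j. j \<preceq> u \<longrightarrow> stage u j \<longrightarrow> i \<prec> j))))"

lemma P1_true: "T g \<Longrightarrow> P1 (\<lambda>e X. true (g e))"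
  unfolding true_def
  by (rule P1_bex_le, assumption, rule P1_conj, rule P1_D0, intro dfn T_lift, assumption,
      rule P1_all_D0, intro dfn T_lift)

text \<open>The stage after \<open>n\<close> that enumerates the least number still to come is
  true.\<close>

lemma ex_true: "\<exists>t. n \<prec> t \<and> true t"
proof -
  let ?P = "\<lambda>i. \<exists>t. n \<prec> t \<and> stage t i"
  have "S1 (\<lambda>e X. ?P (e 0))" by (rule S1_ex_D0) (intro dfn)
  moreover obtain i where "?P i" using ex_stage[of n] by auto
  ultimately obtain i where i: "?P i" "\<forall>j. j \<prec> i \<longrightarrow> \<not> ?P j"
    using S1_least[where P = ?P] by (elim exE conjE) blast
  then obtain t where t: "n \<prec> t" "stage t i" by auto
  have "i \<prec> j" if "t \<prec> u" "stage u j" for u j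
  proof -
    have "n \<prec> u" using t(1) that(1) by (rule less_trans)
    then have "\<not> j \<prec> i" using i(2) that(2) by auto
    moreover have "j \<noteq> i" using stage_inj[OF t(2), of u] that less_irrefl by auto
    ultimately show ?thesis using less_linear[of i j] by auto
  qed
  then have "true t"
    unfolding true_def using t(2) stage_le[OF t(2)] by (intro exI[of _ i]) simp
  with t(1) show ?thesis by auto
qed

text \<open>The interval is open at \<open>a\<close> and closed at the next element, so every true
  stage beyond the least element of \<open>X\<close> belongs to exactly one interval.\<close>

definition Z where "Z a X \<longleftrightarrow> (\<exists>y. nxt X a y \<and> (\<forall>t. t \<preceq> y \<longrightarrow> a \<prec> t \<longrightarrow> \<not> true t))"

text \<open>\<open>true\<close> is Pi_1, and by collection its negation stays Sigma_1 under the
  bounded quantifier. Hence \<open>Z\<close> and its negation are both Sigma_2.\<close>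

lemma S1_Z: "S1 (\<lambda>e X. Z (e 0) X)"
  unfolding Z_def
  by (rule S1_ex, rule S1_conj, rule S1_D0, intro dfn, rule S1_ball_le, intro dfn,
      rule S1_imp, rule P1_D0, intro dfn, rule S1_neg, rule P1_true, intro dfn)

lemma Z_iff: "nxt X a y \<Longrightarrow> Z a X \<longleftrightarrow> (\<forall>t. t \<preceq> y \<longrightarrow> a \<prec> t \<longrightarrow> \<not> true t)"
  unfolding Z_def using nxt_unique[of X a] by auto

text \<open>
  If every interval between successive elements of \<open>X\<close> contains a true stage, then counting
  elements of \<open>X\<close> bounds the stages at which small numbers are enumerated.
\<close>

lemma ex_Z:
  assumes X: "X \<in> Inf"
  shows "\<exists>a\<in>X. Z a X"
proof (rule ccontr)
  assume no: "\<not> ?thesis"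
  have tr: "\<exists>t. t \<preceq> y \<and> a \<prec> t \<and> true t" if "nxt X a y" for a y
    using no nxtD(1)[OF that] Z_iff[OF that] by auto
  \<comment> \<open>Stages after \<open>x\<close> enumerate no number below \<open>j\<close>, so
    membership of those numbers is decided by stage \<open>x\<close>.\<close>
  let ?settled = "\<lambda>j x. \<forall>u. x \<prec> u \<longrightarrow> (\<forall>i. i \<preceq> u \<longrightarrow> stage u i \<longrightarrow> j \<preceq> i)"
  have settled: "\<forall>x. enum X j x \<longrightarrow> ?settled j x" for j
  proof (rule P1_induct[where P = "\<lambda>j. \<forall>x. enum X j x \<longrightarrow> ?settled j x"])
    show "P1 (\<lambda>e X'. \<forall>x. enum X (e 0) x \<longrightarrow> ?settled (e 0) x)"
      by (rule P1_all, rule P1_imp, rule S1_enum[OF Inf_S[OF X]], rule T_var, rule T_var,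
          rule P1_all_D0, intro dfn T_lift)
    show "\<forall>x. enum X \<zero> x \<longrightarrow> ?settled \<zero> x" by simp
  next
    fix j assume IH: "\<forall>x. enum X j x \<longrightarrow> ?settled j x"
    show "\<forall>x. enum X (j \<oplus> \<one>) x \<longrightarrow> ?settled (j \<oplus> \<one>) x"
    proof (intro allI impI)
      fix x u i assume x: "enum X (j \<oplus> \<one>) x" and u: "x \<prec> u" "i \<preceq> u" "stage u i"
      from x obtain z where z: "nxt X z x" "enum X j z"
      proof (cases rule: enum_cases)
        case (2 k z)
        then show thesis using that succ_inj[of j k] by auto
      qed (simp add: succ_neq_zero)
      obtain t where t: "t \<preceq> x" "z \<prec> t" "true t" using tr[OF z(1)] by auto
      then obtain k where k: "k \<preceq> t" "stage t k" "\<forall>u. t \<prec> u \<longrightarrow> (\<forall>j. j \<preceq> u \<longrightarrow> stage u j \<longrightarrow> k \<prec> j)"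
        unfolding true_def by auto
      \<comment> \<open>The true stage \<open>t\<close> lies after \<open>z\<close>, so by induction
        it enumerates some \<open>k\<close> that is at least \<open>j\<close>. All later stages
        enumerate more than \<open>k\<close>.\<close>
      have "j \<preceq> k" using IH z(2) t(2) k(1,2) by auto
      moreover have "k \<prec> i" using k(3) u ord.le_less_trans[OF t(1) u(1)] by auto
      ultimately have "j \<prec> i" by (rule ord.le_less_trans)
      then show "j \<oplus> \<one> \<preceq> i" by (simp add: succ_le_iff)
    qed
  qed
  \<comment> \<open>Element number \<open>i \<oplus> \<one>\<close> settles all numbers up to
    \<open>i\<close>. This yields a Pi_1 definition of the class, which Delta_1 comprehension would
    turn into a set.\<close>
  have "(\<exists>s. A s i) \<longleftrightarrow> (\<forall>x. enum X (i \<oplus> \<one>) x \<longrightarrow> (\<exists>t. t \<preceq> x \<and> stage t i))" for i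
  proof
    assume "\<exists>s. A s i"
    then obtain t where t: "stage t i" unfolding stage_iff ..
    show "\<forall>x. enum X (i \<oplus> \<one>) x \<longrightarrow> (\<exists>t. t \<preceq> x \<and> stage t i)"
    proof (intro allI impI)
      fix x assume x: "enum X (i \<oplus> \<one>) x"
      have "\<not> x \<prec> t"
      proof
        assume "x \<prec> t"
        then have "i \<oplus> \<one> \<preceq> i" using settled x t stage_le[OF t] by auto
        then show False using less_irrefl by (simp add: succ_le_iff)
      qed
      then show "\<exists>t. t \<preceq> x \<and> stage t i" using t ord.le_less_linear[of t x] by auto
    qed
  next
    assume "\<forall>x. enum X (i \<oplus> \<one>) x \<longrightarrow> (\<exists>t. t \<preceq> x \<and> stage t i)"
    then show "\<exists>s. A s i" unfolding stage_iff using enum_total[OF X, of "i \<oplus> \<one>"] by auto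
  qed
  moreover have "S1 (\<lambda>e X. \<exists>s. A s (e 0))"
    by (rule S1_ex_D0) (use D0_A in simp)
  moreover have "P1 (\<lambda>e X'. \<forall>x. enum X (e 0 \<oplus> \<one>) x \<longrightarrow> (\<exists>t. t \<preceq> x \<and> stage t (e 0)))"
    by (rule P1_all, rule P1_imp, rule S1_enum[OF Inf_S[OF X]], intro dfn, intro dfn, rule P1_D0, intro dfn T_lift)
  ultimately have "{i. \<exists>s. A s i} \<in> S"
    using D1_comprehension[of "\<lambda>i. \<exists>s. A s i"] by simp
  with no_set show False ..
qed

text \<open>The last element of \<open>X\<close> before a true stage starts an interval that
  contains this stage.\<close>

lemma ex_not_Z:
  assumes X: "X \<in> Inf"
  shows "\<exists>a\<in>X. \<not> Z a X"
proof -
  obtain x where x: "x \<in> X" using Inf_ex[OF X] by auto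
  obtain t where t: "x \<prec> t" "true t" using ex_true[of x] by auto
  have "D0 (\<lambda>e X'. e 0 \<in> X \<and> e 0 \<prec> t)" by (intro dfn Inf_S[OF X])
  moreover have "x \<in> X \<and> x \<prec> t" using x t(1) by simp
  moreover have "x \<preceq> t" using t(1) by (simp add: le_def)
  ultimately obtain a where a: "a \<in> X" "a \<prec> t" "\<forall>c. a \<prec> c \<longrightarrow> c \<preceq> t \<longrightarrow> \<not> (c \<in> X \<and> c \<prec> t)"
    using D0_greatest[where P = "\<lambda>a. a \<in> X \<and> a \<prec> t"] by (elim exE conjE) blast
  obtain y where y: "nxt X a y" using ex_nxt[OF X a(1)] ..
  have "\<not> y \<prec> t" using a(3) nxtD(2,3)[OF y] by (auto simp: le_def)
  then have "t \<preceq> y" using ord.le_less_linear[of t y] by auto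
  then have "\<not> Z a X" using Z_iff[OF y] t(2) a(2) by auto
  with a(1) show ?thesis by auto
qed

text \<open>Bit one is Pi_1 and bit zero is Sigma_1. Both classes are closed under bounded
  quantifiers, which provides the relation on blocks, and both obey a least number principle, which
  locates the first change.\<close>

lemma bad_discrete3: "\<exists>G. Delta2_function M (fst (discrete3 M)) G \<and> bad M (discrete3 M) G"
proof (rule bad_colouring[where be = "\<lambda>a X. \<not> Z a X"])
  show "(\<not> Z a (tail y X)) = (\<not> Z a X)" if "y \<preceq> a" for X y a
    using that unfolding Z_def by (simp add: nxt_tail)
  have R: "S2 (\<lambda>e X. (e 0 = \<one> \<and> \<not> Z (e 1) X) \<or> (e 0 = \<zero> \<and> Z (e 1) X))"
    by (rule S2_disj, rule S2_conj, rule S2_D0, intro dfn, rule S2_P1, rule P1_neg,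
        rule S1_app1[OF S1_Z], intro dfn, rule S2_conj, rule S2_D0, intro dfn, rule S2_S1,
        rule S1_app1[OF S1_Z], intro dfn)
  then show "S2 (\<lambda>e X. (\<lambda>i a X. (i = \<one> \<and> \<not> Z a X) \<or> (i = \<zero> \<and> Z a X)) (e 0) (e 1) X)" .
  show "((i = \<one> \<and> \<not> Z a X) \<or> (i = \<zero> \<and> Z a X)) \<longleftrightarrow> i = bit (\<not> Z a X)" for X i a
    by (simp add: bit_def)
  have "S2 (\<lambda>e X. (e 0 = \<one> \<and> (\<forall>a. a \<preceq> e 1 \<longrightarrow> a \<in> X \<longrightarrow> \<not> Z a X)) \<or>
      (e 0 = \<zero> \<and> (\<forall>a. a \<preceq> e 1 \<longrightarrow> a \<in> X \<longrightarrow> Z a X)))"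
    by (rule S2_disj, rule S2_conj, rule S2_D0, intro dfn, rule S2_P1, rule P1_ball_le, intro dfn,
        rule P1_imp, rule S1_D0, intro dfn, rule P1_neg, rule S1_app1[OF S1_Z], intro dfn,
        rule S2_conj, rule S2_D0, intro dfn, rule S2_S1, rule S1_ball_le, intro dfn,
        rule S1_imp, rule P1_D0, intro dfn, rule S1_app1[OF S1_Z], intro dfn)
  then show "S2 (\<lambda>e X. (\<lambda>i b X. (i = \<one> \<and> (\<forall>a. a \<preceq> b \<longrightarrow> a \<in> X \<longrightarrow> \<not> Z a X)) \<or>
      (i = \<zero> \<and> (\<forall>a. a \<preceq> b \<longrightarrow> a \<in> X \<longrightarrow> Z a X))) (e 0) (e 1) X)" .
  show "((i = \<one> \<and> (\<forall>a. a \<preceq> b \<longrightarrow> a \<in> X \<longrightarrow> \<not> Z a X)) \<or>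
      (i = \<zero> \<and> (\<forall>a. a \<preceq> b \<longrightarrow> a \<in> X \<longrightarrow> Z a X))) \<longleftrightarrow>
      (\<forall>a\<in>X. a \<preceq> b \<longrightarrow> i = bit (\<not> Z a X))" (is "?l \<longleftrightarrow> ?r") if "b \<in> X" for X i b
  proof
    assume ?l
    then show ?r by (auto simp: bit_def)
  next
    assume r: ?r
    then have "i = bit (\<not> Z b X)" using that by simp
    then have i: "i = \<one> \<and> \<not> Z b X \<or> i = \<zero> \<and> Z b X" by (auto simp: bit_def)
    have "Z a X \<longleftrightarrow> Z b X" if "a \<preceq> b" "a \<in> X" for a
      using r that \<open>i = bit (\<not> Z b X)\<close> by auto
    with i show ?l by auto
  qed
  fix X x assume X: "X \<in> Inf" and x: "first x X"
  have "\<exists>y. (y \<in> X \<and> (\<not> Z y X) \<noteq> (\<not> Z x X)) \<and> (\<forall>a. a \<prec> y \<longrightarrow> \<not> (a \<in> X \<and> (\<not> Z a X) \<noteq> (\<not> Z x X)))"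
  proof (cases "Z x X")
    case True
    obtain a where "a \<in> X \<and> \<not> Z a X" using ex_not_Z[OF X] by auto
    moreover have "P1 (\<lambda>e X'. e 0 \<in> X \<and> \<not> Z (e 0) X)"
      by (rule P1_conj, rule P1_D0, intro dfn Inf_S[OF X], rule P1_neg,
          rule S1_fixX[OF S1_Z Inf_S[OF X]])
    ultimately show ?thesis
      using P1_least[where P = "\<lambda>y. y \<in> X \<and> \<not> Z y X"] True by simp
  next
    case False
    obtain a where "a \<in> X \<and> Z a X" using ex_Z[OF X] by auto
    moreover have "S1 (\<lambda>e X'. e 0 \<in> X \<and> Z (e 0) X)"
      by (rule S1_conj, rule S1_D0, intro dfn Inf_S[OF X], rule S1_fixX[OF S1_Z Inf_S[OF X]])
    ultimately show ?thesis
      using S1_least[where P = "\<lambda>y. y \<in> X \<and> Z y X"] False by simp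
  qed
  then show "\<exists>y\<in>X. (\<not> Z y X) \<noteq> (\<not> Z x X) \<and> (\<forall>a\<in>X. a \<prec> y \<longrightarrow> (\<not> Z x X) = (\<not> Z a X))"
    by auto
qed

end

section \<open>Consequences of arithmetical comprehension\<close>

text \<open>Membership in set variable 0 is restricted to numbers from \<open>Var y\<close> on, so
  that a formula about a tail of \<open>X\<close> becomes one about \<open>X\<close> and a number.
  The last equation also covers set quantifiers, which bounded formulas lack.\<close>

fun frest :: "nat \<Rightarrow> fm \<Rightarrow> fm" where
  "frest y (Mem t X) = (if X = 0 then And (Mem t 0) (Or (Less (Var y) t) (Eq (Var y) t)) else Mem t X)"
| "frest y (Neg \<phi>) = Neg (frest y \<phi>)"
| "frest y (And \<phi> \<psi>) = And (frest y \<phi>) (frest y \<psi>)"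
| "frest y (Or \<phi> \<psi>) = Or (frest y \<phi>) (frest y \<psi>)"
| "frest y (Imp \<phi> \<psi>) = Imp (frest y \<phi>) (frest y \<psi>)"
| "frest y (AllN x \<phi>) = AllN x (frest y \<phi>)"
| "frest y (ExN x \<phi>) = ExN x (frest y \<phi>)"
| "frest y \<phi> = \<phi>"

lemma bounded_fm_frest: "bounded_fm \<theta> \<Longrightarrow> bounded_fm (frest y \<theta>)"
  by (induction rule: bounded_fm.induct) (auto intro!: bounded_fm.intros)

context rca0
begin

text \<open>\<open>y\<close> lies outside the range of the renaming, so no quantifier captures the
  starting point of the tail.\<close>

lemma sat_frest:
  assumes "bounded_fm \<theta>" "inj \<rho>" "y \<notin> range \<rho>"
  shows "sat M e E (frest y (fren \<rho> id \<theta>)) \<longleftrightarrow> sat M (e \<circ> \<rho>) (E(0 := tail (e y) (E 0))) \<theta>"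
  using assms
proof (induction arbitrary: e rule: bounded_fm.induct)
  case (8 \<phi> x t)
  then have "y \<noteq> \<rho> x" by auto
  then have "sat M (e(\<rho> x := a)) E (frest y (fren \<rho> id \<phi>))
      \<longleftrightarrow> sat M ((e \<circ> \<rho>)(x := a)) (E(0 := tail (e y) (E 0))) \<phi>" for a
    using "8.IH"[OF "8.prems", of "e(\<rho> x := a)"] by (simp only: fun_upd_comp_inj[OF assms(2)] fun_upd_other not_False_eq_True)
  then show ?case
    by (simp only: fren.simps tren.simps frest.simps sat.simps tm_val.simps tm_val_tren
        fun_upd_comp_inj[OF assms(2)] fun_upd_same)
next
  case (9 \<phi> x t)
  then have "y \<noteq> \<rho> x" by auto
  then have "sat M (e(\<rho> x := a)) E (frest y (fren \<rho> id \<phi>))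
      \<longleftrightarrow> sat M ((e \<circ> \<rho>)(x := a)) (E(0 := tail (e y) (E 0))) \<phi>" for a
    using "9.IH"[OF "9.prems", of "e(\<rho> x := a)"] by (simp only: fun_upd_comp_inj[OF assms(2)] fun_upd_other not_False_eq_True)
  then show ?case
    by (simp only: fren.simps tren.simps frest.simps sat.simps tm_val.simps tm_val_tren
        fun_upd_comp_inj[OF assms(2)] fun_upd_same)
qed (auto simp: tm_val_tren tail_def le_def)

lemma D0_tail:
  assumes "D0 P"
  shows "D0 (\<lambda>e X. P (\<lambda>n. e (Suc n)) (tail (e 0) X))"
proof -
  obtain \<theta> r E where \<theta>: "repD \<theta> r E P" using assms unfolding D0_def by blast
  let ?\<rho> = "\<lambda>n :: nat. if even n then n + 2 else n"
  have inj: "inj ?\<rho>"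
    unfolding inj_def by (auto elim!: evenE)
  have range: "0 \<notin> range ?\<rho>"
    by (auto split: if_splits)
  have "mrg e r \<circ> ?\<rho> = mrg (\<lambda>n. e (Suc n)) r" for e
    by (simp add: fun_eq_iff mrg_def)
  moreover have "(case_nat X E)(0 := Y) = case_nat Y E" for X Y
    by (auto simp: fun_eq_iff split: nat.splits)
  moreover have "mrg e r 0 = e 0" for e
    by (simp add: mrg_def)
  ultimately have "repD (frest 0 (fren ?\<rho> id \<theta>)) r E (\<lambda>e X. P (\<lambda>n. e (Suc n)) (tail (e 0) X))"
    using \<theta> inj range unfolding repD_def
    by (simp add: bounded_fm_frest bounded_fm_fren sat_frest tail_S)
  then show ?thesis unfolding D0_def by blast
qed

lemma S2_tail:
  assumes "S2 (\<lambda>e X. R (e 0) X)" "T g" "T h"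
  shows "S2 (\<lambda>e X. R (g e) (tail (h e) X))"
proof -
  obtain Q where Q: "D0 Q" "\<forall>e. \<forall>X\<in>S. R (e 0) X \<longleftrightarrow> (\<exists>u. \<forall>v. Q (case_nat v (case_nat u e)) X)"
    using assms unfolding S2_def by blast
  have "D0 (\<lambda>e X. Q e (tail (e 3) X))"
    using D0_subst[OF D0_tail[OF Q(1)] T_var[of 3]] by simp
  then have "S2 (\<lambda>e X. R (e 0) (tail (e 1) X))"
    by (rule S2_I) (use Q(2) in \<open>simp add: tail_S numeral_eq_Suc\<close>)
  then show ?thesis
    by (rule S2_app2[OF _ assms(2,3)])
qed

lemma P1_fix2:
  assumes "P1 P" "X0 \<in> S"
  shows "P1 (\<lambda>e' X. P (case_nat (e' 0) (case_nat (e' 1) e)) X0)"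
proof -
  obtain Q where Q: "D0 Q" "\<forall>e. \<forall>X\<in>S. P e X \<longleftrightarrow> (\<forall>a. Q (case_nat a e) X)"
    using assms(1) unfolding P1_def by blast
  show ?thesis
    by (rule P1_I[OF D0_fix3[OF Q(1) assms(2), of e]]) (simp add: Q(2) assms(2) numeral_eq_Suc)
qed

lemma P1_skip2:
  assumes "P1 P"
  shows "P1 (\<lambda>e X. P (case_nat (e 0) (case_nat (e 1) (\<lambda>n. e (Suc (Suc (Suc n)))))) X)"
proof -
  obtain Q where Q: "D0 Q" "\<forall>e. \<forall>X\<in>S. P e X \<longleftrightarrow> (\<forall>a. Q (case_nat a e) X)"
    using assms(1) unfolding P1_def by blast
  let ?\<pi> = "case_nat 0 (case_nat 1 (case_nat 2 (\<lambda>n. Suc (Suc (Suc (Suc n))))))"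
  have "D0 (\<lambda>e X. Q (\<lambda>n. e (?\<pi> n)) X)"
    by (rule D0_reindex[OF Q(1)]) (auto simp: inj_def split: nat.splits)
  moreover have "(\<lambda>n. e (?\<pi> n)) =
      case_nat (e 0) (case_nat (e 1) (case_nat (e 2) (\<lambda>n. e (Suc (Suc (Suc (Suc n)))))))" for e :: "nat \<Rightarrow> 'm"
    by (simp add: fun_eq_iff split: nat.splits)
  ultimately have "D0 (\<lambda>e X. Q (case_nat (e 0) (case_nat (e 1) (case_nat (e 2) (\<lambda>n. e (Suc (Suc (Suc (Suc n)))))))) X)"
    by (simp only:)
  then show ?thesis
    by (rule P1_I) (simp add: Q(2) numeral_eq_Suc)
qed

lemma S2_fixX: "S2 P \<Longrightarrow> X0 \<in> S \<Longrightarrow> S2 (\<lambda>e X. P e X0)"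
proof -
  assume "S2 P" "X0 \<in> S"
  then obtain Q where Q: "D0 Q" "\<forall>e. \<forall>X\<in>S. P e X \<longleftrightarrow> (\<exists>u. \<forall>v. Q (case_nat v (case_nat u e)) X)"
    unfolding S2_def by blast
  show ?thesis
    by (rule S2_I[OF D0_fixX[OF Q(1) \<open>X0 \<in> S\<close>]]) (simp add: Q(2) \<open>X0 \<in> S\<close>)
qed

text \<open>The complement is Sigma_1. Once the relation is a set of the model, it may occur in
  bounded matrices.\<close>

lemma ACA_P1_pairs:
  assumes "ACA" "P1 (\<lambda>e X. R (e 0) (e 1))"
  shows "{n. \<exists>u. u \<preceq> n \<and> (\<exists>a. a \<preceq> n \<and> (n = pair u a \<and> R u a))} \<in> S" (is "?A \<in> S")
proof -
  have "S1 (\<lambda>e X. \<not> (\<exists>u. u \<preceq> e 0 \<and> (\<exists>a. a \<preceq> e 0 \<and> (e 0 = pair u a \<and> R u a))))"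
    by (rule S1_neg, rule P1_bex_le, intro dfn, rule P1_bex_le, intro dfn, rule P1_conj, rule P1_D0,
        intro dfn, rule P1_app2[OF assms(2)], intro dfn, intro dfn)
  then have "- ?A \<in> S" using assms(1) unfolding ACA_def Compl_eq by simp
  then have "{n. n \<notin> - ?A} \<in> S" by (rule D0_comprehension[OF D0_neg[OF D0_mem[OF T_var]]])
  moreover have "{n. n \<notin> - ?A} = ?A" by blast
  ultimately show ?thesis by (simp only:)
qed

text \<open>Relative to the set that codes its Pi_1 matrix, the predicate is Sigma_1, so
  \<open>ACA\<close> applies a second time.\<close>

lemma ACA_S2:
  assumes "ACA" "S2 (\<lambda>e X. P (e 0))"
  shows "{a. P a} \<in> S"
proof -
  obtain R where R: "P1 R" "\<forall>e. \<forall>X\<in>S. P (e 0) \<longleftrightarrow> (\<exists>u. R (case_nat u e) X)"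
    using S2_D_P1[OF assms(2)] by (elim exE conjE)
  obtain X where X: "X \<in> S" using S_nonempty by blast
  let ?R = "\<lambda>u a. R (case_nat u (case_nat a (\<lambda>_. \<zero>))) X"
  have "P1 (\<lambda>e X. ?R (e 0) (e 1))"
    using P1_fix2[OF R(1) X] by simp
  from ACA_P1_pairs[OF assms(1) this]
  obtain N where N: "N \<in> S" "N = {n. \<exists>u. u \<preceq> n \<and> (\<exists>a. a \<preceq> n \<and> (n = pair u a \<and> ?R u a))}" by simp
  have "P a \<longleftrightarrow> (\<exists>u. pair u a \<in> N)" for a
    using R(2)[rule_format, OF X, of "case_nat a (\<lambda>_. \<zero>)"] le_pair unfolding N(2) by simp
  moreover have "S1 (\<lambda>e X. \<exists>u. pair u (e 0) \<in> N)"
    by (rule S1_ex_D0) (intro dfn N(1))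
  ultimately show ?thesis using assms(1) unfolding ACA_def by simp
qed

text \<open>For fixed set and arguments the Pi_1 matrix is a set, so collection yields the bound
  \<open>w\<close>. That set only verifies the equivalence; the defining formula is uniform in
  \<open>X\<close>.\<close>

lemma ACA_S2_ball_le:
  assumes "ACA" "T g" "S2 (\<lambda>e X. P (e 0) (\<lambda>n. e (Suc n)) X)"
  shows "S2 (\<lambda>e X. \<forall>a. a \<preceq> g e \<longrightarrow> P a e X)"
proof -
  obtain R where R: "P1 R" "\<forall>e. \<forall>X\<in>S. P (e 0) (\<lambda>n. e (Suc n)) X \<longleftrightarrow> (\<exists>u. R (case_nat u e) X)"
    using S2_D_P1[OF assms(3)] by (elim exE conjE)
  have P: "P a e X \<longleftrightarrow> (\<exists>u. R (case_nat u (case_nat a e)) X)" if "X \<in> S" for a e X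
    using R(2)[rule_format, OF that, of "case_nat a e"] by simp
  have "S2 (\<lambda>e X. \<exists>w. \<forall>a. a \<preceq> g e \<longrightarrow> (\<exists>u. u \<preceq> w \<and> R (case_nat u (case_nat a e)) X))"
    by (rule S2_ex_P1, rule P1_ball_le, rule T_lift, rule assms(2), rule P1_bex_le, rule T_var)
      (use P1_skip2[OF R(1)] in simp)
  then show ?thesis
  proof (rule S2_cong)
    fix e X assume X: "X \<in> S"
    let ?R = "\<lambda>u a. R (case_nat u (case_nat a e)) X"
    have "P1 (\<lambda>e X. ?R (e 0) (e 1))"
      using P1_fix2[OF R(1) X] by simp
    from ACA_P1_pairs[OF assms(1) this]
    obtain N where N: "N \<in> S" "N = {n. \<exists>u. u \<preceq> n \<and> (\<exists>a. a \<preceq> n \<and> (n = pair u a \<and> ?R u a))}" by simp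
    have "?R u a \<longleftrightarrow> pair u a \<in> N" for u a
      using le_pair unfolding N(2) by simp
    moreover have "D0 (\<lambda>e X. (\<lambda>u a. pair u a \<in> N) (e 0) (e 1))" by (intro dfn N(1))
    note collection[OF this, of "g e"]
    ultimately show "(\<forall>a. a \<preceq> g e \<longrightarrow> P a e X) \<longleftrightarrow>
        (\<exists>w. \<forall>a. a \<preceq> g e \<longrightarrow> (\<exists>u. u \<preceq> w \<and> ?R u a))"
      unfolding P[OF X] by auto
  qed
qed

lemma Sigma2_S2:
  assumes "Sigma2 \<phi>" "range E \<subseteq> S"
  shows "S2 (\<lambda>e' X. sat M (e(0 := e' 0)) (E(0 := X)) \<phi>)"
proof -
  obtain x y \<theta> where \<theta>: "bounded_fm \<theta>" "\<phi> = ExN x (AllN y \<theta>)"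
    using assms(1) unfolding Sigma2_def Pi1_def by auto
  \<comment> \<open>The order of the cases mirrors shadowing: \<open>y\<close> is quantified inside
    \<open>x\<close>, and both may coincide with each other or with the value variable 0.\<close>
  define \<rho> where "\<rho> n = (if n = y then 0 else if n = x then 2 else if n = 0 then 4 else Suc (2 * n))" for n
  define \<sigma> where "\<sigma> n = (if n = 0 then 0 else Suc n)" for n :: nat
  define k where "k e' n = (if n = y then e' 0 else if n = x then e' 1 else if n = 0 then e' 2 else e n)"
    for e' :: "nat \<Rightarrow> 'm" and n
  have inj: "inj \<rho>"
    unfolding inj_def \<rho>_def by (auto split: if_splits; presburger)
  have "(mrg e' e \<circ> \<rho>) n = k e' n" for e' n
  proof -
    have "mrg e' e 2 = e' 1" "mrg e' e 4 = e' 2" "mrg e' e 0 = e' 0"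
      by (simp_all add: mrg_def)
    then show ?thesis by (simp add: \<rho>_def k_def)
  qed
  then have k: "mrg e' e \<circ> \<rho> = k e'" for e' by auto
  have \<sigma>: "case_nat X E \<circ> \<sigma> = E(0 := X)" for X
    by (auto simp: \<sigma>_def fun_eq_iff)
  have "repD (fren \<rho> \<sigma> \<theta>) e E (\<lambda>e' X. sat M (k e') (E(0 := X)) \<theta>)"
    using \<theta>(1) inj assms(2) by (simp add: repD_def bounded_fm_fren sat_fren k \<sigma>)
  then have "D0 (\<lambda>e' X. sat M (k e') (E(0 := X)) \<theta>)" unfolding D0_def by blast
  then show ?thesis
  proof (rule S2_I)
    fix e' X assume "X \<in> S"
    have "(e(0 := e' 0, x := u, y := v)) = k (case_nat v (case_nat u e'))" for u v
      by (auto simp: k_def fun_eq_iff numeral_eq_Suc)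
    then show "sat M (e(0 := e' 0)) (E(0 := X)) \<phi> \<longleftrightarrow>
        (\<exists>u. \<forall>v. sat M (k (case_nat v (case_nat u e'))) (E(0 := X)) \<theta>)"
      unfolding \<theta>(2) by simp
  qed
qed

section \<open>Sums of well orders\<close>

lemma ord_sum_quasi_order:
  assumes "is_quasi_order M \<Omega>"
  shows "is_quasi_order M (ord_sum M \<Omega> \<Omega>)"
proof -
  obtain A L where \<Omega>: "\<Omega> = (A, L)" by (cases \<Omega>)
  have AL: "A \<in> S" "L \<in> S" "\<And>p. p \<in> A \<Longrightarrow> pair p p \<in> L"
    "\<And>p q r. p \<in> A \<Longrightarrow> q \<in> A \<Longrightarrow> r \<in> A \<Longrightarrow> pair p q \<in> L \<Longrightarrow> pair q r \<in> L \<Longrightarrow> pair p r \<in> L"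
    using assms unfolding is_quasi_order_def \<Omega> ord_le_def fst_conv snd_conv by (elim conjE, blast)+
  have fst: "fst (ord_sum M \<Omega> \<Omega>) = {n. \<exists>q. q \<preceq> n \<and> (q \<in> A \<and> (n = pair \<zero> q \<or> n = pair \<one> q))}"
    unfolding ord_sum_def \<Omega> by (auto simp: le_pair)
  have snd: "snd (ord_sum M \<Omega> \<Omega>) = {n. \<exists>p. p \<preceq> n \<and> (\<exists>q. q \<preceq> n \<and> (p \<in> A \<and> q \<in> A \<and> pair p q \<in> L \<and>
      (n = pair (pair \<zero> p) (pair \<zero> q) \<or> n = pair (pair \<one> p) (pair \<one> q))))}"
  proof -
    have "p \<preceq> pair (pair i p) (pair i q)" "q \<preceq> pair (pair i p) (pair i q)" for p q i
      by (rule ord.order_trans[OF le_pair(2) le_pair(1)], rule ord.order_trans[OF le_pair(2) le_pair(2)])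
    then show ?thesis unfolding ord_sum_def \<Omega> ord_le_def by auto
  qed
  have "fst (ord_sum M \<Omega> \<Omega>) \<in> S"
    unfolding fst by (rule D0_comprehension, intro dfn T_lift AL(1,2))
  moreover have "snd (ord_sum M \<Omega> \<Omega>) \<in> S"
    unfolding snd by (rule D0_comprehension, intro dfn T_lift AL(1,2))
  moreover have le: "ord_le M (ord_sum M \<Omega> \<Omega>) (pair i p) (pair j q) \<longleftrightarrow>
      i = j \<and> (i = \<zero> \<or> i = \<one>) \<and> p \<in> A \<and> q \<in> A \<and> pair p q \<in> L" for i j p q
    by (auto simp: ord_sum_def \<Omega> ord_le_def)
  have el: "\<exists>i q. x = pair i q \<and> (i = \<zero> \<or> i = \<one>) \<and> q \<in> A" if "x \<in> fst (ord_sum M \<Omega> \<Omega>)" for x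
    using that by (auto simp: ord_sum_def \<Omega>)
  have "ord_le M (ord_sum M \<Omega> \<Omega>) x x" if "x \<in> fst (ord_sum M \<Omega> \<Omega>)" for x
    using el[OF that] AL(3) by (auto simp: le)
  moreover have "ord_le M (ord_sum M \<Omega> \<Omega>) x z"
    if xyz: "x \<in> fst (ord_sum M \<Omega> \<Omega>)" "y \<in> fst (ord_sum M \<Omega> \<Omega>)" "z \<in> fst (ord_sum M \<Omega> \<Omega>)"
      "ord_le M (ord_sum M \<Omega> \<Omega>) x y" "ord_le M (ord_sum M \<Omega> \<Omega>) y z" for x y z
  proof -
    obtain i p j q k r where "x = pair i p" "y = pair j q" "z = pair k r"
      using el[OF xyz(1)] el[OF xyz(2)] el[OF xyz(3)] by auto
    then show ?thesis using xyz(4,5) AL(4)[of p q r] by (auto simp: le)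
  qed
  moreover have "snd (ord_sum M \<Omega> \<Omega>) \<subseteq>
      {pair p q | p q. p \<in> fst (ord_sum M \<Omega> \<Omega>) \<and> q \<in> fst (ord_sum M \<Omega> \<Omega>)}"
    by (auto simp: ord_sum_def \<Omega>)
  ultimately show ?thesis
    unfolding is_quasi_order_def by (intro conjI ballI impI) (assumption | elim conjE)+
qed

lemma ord_le_ord_sum:
  assumes "i = \<zero> \<or> i = \<one>" "p \<in> fst \<Omega>" "q \<in> fst \<Omega>" "ord_le M \<Omega> p q"
  shows "ord_le M (ord_sum M \<Omega> \<Omega>) (pair i p) (pair i q)"
  using assms by (auto simp: ord_le_def ord_sum_def)

lemma linear_order_not_le:
  assumes "\<not> ord_le M \<Omega> p q" "is_linear_order M \<Omega>" "p \<in> fst \<Omega>" "q \<in> fst \<Omega>"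
  shows "ord_le M \<Omega> q p \<and> q \<noteq> p"
proof -
  have "\<forall>p\<in>fst \<Omega>. \<forall>q\<in>fst \<Omega>. ord_le M \<Omega> p q \<or> ord_le M \<Omega> q p"
    using assms(2) unfolding is_linear_order_def by (elim conjE)
  moreover have "\<forall>p\<in>fst \<Omega>. ord_le M \<Omega> p p"
    using assms(2) unfolding is_linear_order_def is_quasi_order_def by (elim conjE)
  ultimately show ?thesis using assms(1,3,4) by blast
qed

text \<open>\<open>ACA\<close> enters three times: for Sigma_2 collection in the relation on blocks,
  for a descending sequence that belongs to the model, and for the first change of the bit.\<close>

lemma ACA_bad_discrete3:
  assumes "ACA" and wo: "is_well_order M \<Omega>"
    and F: "Delta2_function M (fst (ord_sum M \<Omega> \<Omega>)) F" and bad: "bad M (ord_sum M \<Omega> \<Omega>) F"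
  shows "\<exists>G. Delta2_function M (fst (discrete3 M)) G \<and> bad M (discrete3 M) G"
proof -
  obtain \<phi> e E where \<phi>: "Sigma2 \<phi>" "range E \<subseteq> S"
    "\<forall>X\<in>Inf. \<forall>q. sat M (e(0 := q)) (E(0 := X)) \<phi> \<longleftrightarrow> F X = q"
    using F unfolding Delta2_function_def by (elim conjE exE)
  define Fr where "Fr q X \<longleftrightarrow> sat M (e(0 := q)) (E(0 := X)) \<phi>" for q X
  have Fr: "Fr q X \<longleftrightarrow> F X = q" if "X \<in> Inf" for q X
    using \<phi>(3) that unfolding Fr_def by simp
  have S2_Fr: "S2 (\<lambda>e X. Fr (e 0) X)"
    unfolding Fr_def by (rule Sigma2_S2[OF \<phi>(1,2)])
  have F_val: "\<exists>i q. (i = \<zero> \<or> i = \<one>) \<and> q \<in> fst \<Omega> \<and> F X = pair i q" if "X \<in> Inf" for X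
  proof -
    have "F X \<in> fst (ord_sum M \<Omega> \<Omega>)" using F that unfolding Delta2_function_def by auto
    then show ?thesis unfolding ord_sum_def by auto
  qed
  define be where "be a X \<longleftrightarrow> (\<exists>q. F (tail a X) = pair \<one> q)" for a X
  have be: "F Y = pair i q \<Longrightarrow> Y = tail a X \<Longrightarrow> Y \<in> Inf \<Longrightarrow> i = bit (be a X)" for i q Y a X
    using F_val[of Y] unfolding be_def bit_def by auto
  define R where "R i a X \<longleftrightarrow> (\<exists>q. Fr (pair i q) (tail a X))" for i a X
  have R: "R i a X \<longleftrightarrow> i = bit (be a X)" if X: "X \<in> Inf" for i a X
  proof -
    obtain j q where "F (tail a X) = pair j q" using F_val[OF tail_Inf[OF X, of a]] by auto
    then show ?thesis
      unfolding R_def Fr[OF tail_Inf[OF X]] using be[OF _ refl tail_Inf[OF X]] by auto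
  qed
  have S2_R: "S2 (\<lambda>e X. R (e 0) (e 1) X)"
    unfolding R_def by (rule S2_ex) (intro S2_tail[OF S2_Fr] dfn)
  have desc: False if X: "X \<in> Inf" and const: "\<And>y. y \<in> X \<Longrightarrow> be y X \<longleftrightarrow> B" for X B
  proof -
    let ?i = "bit B"
    have i: "?i = \<zero> \<or> ?i = \<one>" by (simp add: bit_def)
    have val: "\<exists>q. q \<in> fst \<Omega> \<and> F (tail a X) = pair ?i q" if "a \<in> X" for a
    proof -
      obtain j q where "q \<in> fst \<Omega>" "F (tail a X) = pair j q" using F_val[OF tail_Inf[OF X, of a]] by auto
      then show ?thesis using be[OF _ refl tail_Inf[OF X]] const[OF that] by auto
    qed
    \<comment> \<open>The graph of the sequence whose \<open>j\<close>-th term is the second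
      component of \<open>F\<close> at the tail starting with element number
      \<open>j\<close>.\<close>
    let ?P = "\<lambda>n. \<exists>j a q. n = pair j q \<and> enum X j a \<and> Fr (pair ?i q) (tail a X)"
    have "S2 (\<lambda>e X. Fr (pair ?i (e 0)) (tail (e (Suc 0)) X))"
      by (intro S2_tail[OF S2_Fr] dfn)
    from S2_fixX[OF this Inf_S[OF X]]
    have S2_Fr_X: "S2 (\<lambda>e X'. Fr (pair ?i (e 0)) (tail (e (Suc 0)) X))" .
    have "S2 (\<lambda>e X'. \<exists>j a q. e 0 = pair j q \<and> enum X j a \<and> Fr (pair ?i q) (tail a X))"
      by (rule S2_ex, rule S2_ex, rule S2_ex, rule S2_conj, rule S2_D0, intro dfn, rule S2_conj, rule S2_S1,
          intro S1_enum Inf_S X dfn, rule S2_Fr_X)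
    then have f: "{n. ?P n} \<in> S" using ACA_S2[OF \<open>ACA\<close>, of ?P] by simp
    define f where "f = {n. ?P n}"
    have mem: "pair j q \<in> f \<longleftrightarrow> (\<exists>a. enum X j a \<and> F (tail a X) = pair ?i q)" for j q
      unfolding f_def Fr[OF tail_Inf[OF X]] by auto
    have fst_mem: "q \<in> fst \<Omega>" if jq: "pair j q \<in> f" for j q
    proof -
      obtain a where a: "enum X j a" "F (tail a X) = pair ?i q" using jq mem by auto
      then show ?thesis using val[OF enum_mem[OF a(1)]] by auto
    qed
    have "is_sequence M f (fst \<Omega>)"
      unfolding is_sequence_def
    proof (intro conjI allI)
      show "f \<in> S" using f unfolding f_def .
      show "f \<subseteq> {pair n a | n a. a \<in> fst \<Omega>}"
      proof
        fix n assume n: "n \<in> f"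
        then obtain j q where "n = pair j q" unfolding f_def by auto
        with n fst_mem show "n \<in> {pair n a | n a. a \<in> fst \<Omega>}" by auto
      qed
      fix n
      obtain a where a: "enum X n a" using enum_total[OF X] by auto
      obtain q where q: "F (tail a X) = pair ?i q" using val[OF enum_mem[OF a]] by auto
      show "\<exists>!a. pair n a \<in> f"
      proof (rule ex1I[of _ q])
        show "pair n q \<in> f" using mem a q by auto
        fix r assume "pair n r \<in> f"
        then obtain b where "enum X n b" "F (tail b X) = pair ?i r" using mem by auto
        then show "r = q" using enum_unique[OF Inf_S[OF X] a] q by auto
      qed
    qed
    moreover have "ord_le M \<Omega> b a \<and> b \<noteq> a" if ab: "pair n a \<in> f" "pair (n \<oplus> \<one>) b \<in> f" for n a b
    proof -
      obtain x where x: "enum X n x" "F (tail x X) = pair ?i a" using ab(1) mem by auto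
      obtain y where y: "enum X (n \<oplus> \<one>) y" "F (tail y X) = pair ?i b" using ab(2) mem by auto
      have "nxt X x y"
        using y(1)
      proof (cases rule: enum_cases)
        case (2 k z)
        then have "enum X n z" using succ_inj[of n k] by simp
        then show ?thesis using enum_unique[OF Inf_S[OF X] x(1)] 2(2) by simp
      qed (simp add: succ_neq_zero)
      then have "x \<preceq> y" using nxtD(3) by (simp add: le_def)
      have "first x (tail x X)"
        using first_tail[of x X] nxtD(1)[OF \<open>nxt X x y\<close>] by simp
      moreover have "nxt (tail x X) x y"
        using \<open>nxt X x y\<close> ord.order_refl by (simp only: nxt_tail)
      ultimately have "drop_least M (tail x X) = tail y (tail x X)"
        by (rule drop_least_tail)
      then have "drop_least M (tail x X) = tail y X" using tail_tail[OF \<open>x \<preceq> y\<close>] by simp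
      then have "\<not> ord_le M (ord_sum M \<Omega> \<Omega>) (pair ?i a) (pair ?i b)"
        using bad tail_Inf[OF X, of x] x(2) y(2) unfolding bad_def by auto
      \<comment> \<open>Both values lie in the same summand, so badness concerns
        \<open>\<Omega>\<close> alone; linearity then gives strict descent.\<close>
      then have "\<not> ord_le M \<Omega> a b"
        using ord_le_ord_sum[OF i fst_mem[OF ab(1)] fst_mem[OF ab(2)]] by (rule contrapos_nn)
      moreover have "is_linear_order M \<Omega>" using wo unfolding is_well_order_def by simp
      ultimately show ?thesis
        using fst_mem[OF ab(1)] fst_mem[OF ab(2)] by (intro linear_order_not_le)
    qed
    ultimately show False using wo unfolding is_well_order_def by blast
  qed
  show ?thesis
  proof (rule bad_colouring[where be = be])
    show "be a (tail y X) = be a X" if "y \<preceq> a" for X y a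
      unfolding be_def tail_tail[OF that] ..
    show "S2 (\<lambda>e X. R (e 0) (e 1) X)" by (rule S2_R)
    show "R i a X \<longleftrightarrow> i = bit (be a X)" if "X \<in> Inf" for X i a using R[OF that] .
    have "S2 (\<lambda>e X. \<forall>a. a \<preceq> e 1 \<longrightarrow> (a \<notin> X \<or> R (e 0) a X))"
      by (rule ACA_S2_ball_le[OF \<open>ACA\<close>], intro dfn, rule S2_disj, rule S2_D0, intro dfn,
          rule S2_app2[OF S2_R], intro dfn, intro dfn)
    then show "S2 (\<lambda>e X. (\<lambda>i b X. \<forall>a. a \<preceq> b \<longrightarrow> (a \<notin> X \<or> R i a X)) (e 0) (e 1) X)" .
    show "(\<forall>a. a \<preceq> b \<longrightarrow> (a \<notin> X \<or> R i a X)) \<longleftrightarrow> (\<forall>a\<in>X. a \<preceq> b \<longrightarrow> i = bit (be a X))"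
      if "X \<in> Inf" for X i b
      unfolding R[OF that] by auto
    fix X x assume X: "X \<in> Inf" and x: "first x X"
    \<comment> \<open>Once the elements with bit one form a set, the least number principle for
      bounded predicates finds the first change.\<close>
    let ?B = "{a. R \<one> a X}"
    have "S2 (\<lambda>e X'. R \<one> (e 0) X)"
      by (rule S2_fixX[OF S2_app2[OF S2_R] Inf_S[OF X]]; intro dfn)
    then have B: "?B \<in> S" using ACA_S2[OF \<open>ACA\<close>, of "\<lambda>a. R \<one> a X"] by simp
    have B_iff: "a \<in> ?B \<longleftrightarrow> be a X" for a
      using R[OF X] sr.zero_neq_one by (auto simp: bit_def split: if_splits)
    obtain y where y: "y \<in> X" "be y X \<noteq> be x X" using desc[OF X, of "be x X"] by auto
    let ?P = "\<lambda>y. y \<in> X \<and> \<not> (y \<in> ?B \<longleftrightarrow> x \<in> ?B)"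
    have "D0 (\<lambda>e X'. ?P (e 0))" by (intro dfn B Inf_S[OF X])
    moreover have "?P y" using y unfolding B_iff by simp
    ultimately have "\<exists>m. ?P m \<and> (\<forall>b. b \<prec> m \<longrightarrow> \<not> ?P b)" by (rule D0_least[where P = ?P])
    then show "\<exists>y\<in>X. be y X \<noteq> be x X \<and> (\<forall>a\<in>X. a \<prec> y \<longrightarrow> be x X = be a X)"
      unfolding B_iff by (elim exE conjE) (intro bexI conjI; auto)
  qed
qed

end

theorem theorem2p15:
  fixes M :: "'m l2_structure"
  assumes "rca0_model M"
  assumes "Delta2_BQO M (discrete3 M)"
  shows "\<forall>\<Omega>. is_well_order M \<Omega> \<longrightarrow> Delta2_BQO M (ord_sum M \<Omega> \<Omega>)"
proof (intro allI impI)
  fix \<Omega> assume wo: "is_well_order M \<Omega>"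
  interpret rca0 M by unfold_locales fact
  have no: "\<nexists>G. Delta2_function M (fst (discrete3 M)) G \<and> bad M (discrete3 M) G"
    using assms(2) by (simp add: Delta2_BQO_def)
  have "ACA"
  proof (rule ccontr)
    assume "\<not> ACA"
    then obtain A where "D0 (\<lambda>e X. A (e 0) (e 1))" "{i. \<exists>s. A s i} \<notin> S"
      by (rule not_ACA_obtain)
    then interpret no_set M A by unfold_locales
    show False using bad_discrete3 no by contradiction
  qed
  moreover have "is_quasi_order M (ord_sum M \<Omega> \<Omega>)"
    using wo by (intro ord_sum_quasi_order) (simp add: is_well_order_def is_linear_order_def)
  ultimately show "Delta2_BQO M (ord_sum M \<Omega> \<Omega>)"
    unfolding Delta2_BQO_def using ACA_bad_discrete3[OF _ wo] no by blast
qed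

end
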